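(* Assume that there exists $\alpha^*\in[0,1)$ such that for all $\alpha\in(\alpha^*,1]$: (i) the function $x\mapsto\mathbb{E}[h_\alpha(x-D)]$ is quasiconvex on $\mathbb{X}$; and (ii) $\lim_{x\to-\infty}\mathbb{E}[h_\alpha(x-D)]>K+\inf_{x\in\mathbb{X}}\mathbb{E}[h_\alpha(x-D)]$. For each $\alpha\in(\alpha^*,1)$ let an optimal $(s'_\alpha,S'_\alpha)$ policy for the discount factor $\alpha$ be given. Then for every sequence $\{\alpha_n\}_{n\ge1}$ of nonnegative discount factors with $\alpha_n\uparrow1$ and $\alpha_1>\alpha^*$ there exist a subsequence $\{\alpha_{n_k}\}_{k\ge1}$, a stationary policy $\varphi$, and the function $\tilde u(x):=\liminf_{k\to+\infty,\,y\to x}u_{\alpha_{n_k}}(y)$ such that for all $x\in\mathbb{X}$ $$w+\tilde u(x)=K\mathbf{1}_{\{\varphi(x)>0\}}+H(x+\varphi(x))-\bar c x=\min\Big\{\min_{a\ge0}[K+H(x+a)],\,H(x)\Big\}-\bar c x,\qquad(\ast)$$ where $H(x):=\bar c x+\mathbb{E}[h(x-D)]+\mathbb{E}[\tilde u(x-D)]$. In addition, the functions $\tilde u$ and $H$ are continuous and inf-compact, and a stationary optimal policy $\varphi$ satisfying $(\ast)$ can be selected as an $(s^*,S^* )$ policy, where $(s^*,S^* )=\lim_{k\to+\infty}(s'_{\alpha_{n_k}},S'_{\alpha_{n_k}})$ is a limit point of the sequence $\{(s'_{\alpha_n},S'_{\alpha_n})\}_{n\ge1}$. It can also be selected as an $(s,S)$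 policy with real numbers $S$ and $s$ satisfying $$S\in\operatorname*{arg\,min}_{x\in\mathbb{X}}H(x),\qquad s=\inf\{x\le S:\ H(x)\le K+H(S)\}.$$
   Context: Inventory model. Either (a) $\mathbb{X}=\mathbb{R}$ (states) and $\mathbb{A}=[0,+\infty)$ (actions), or (b) $\mathbb{X}=\mathbb{Z}$, $\mathbb{A}=\{0,1,2,\ldots\}$ and the demand is integer valued. Constants $K>0$ (fixed ordering cost), $\bar c>0$ (unit ordering cost). $D_1,D_2,\ldots$ are i.i.d. nonnegative finite random variables, $D$ has the same distribution as $D_1$, $\mathbb{E}[D]<+\infty$, $P(D>0)>0$. The holding/backlog cost function $h$ is such that $x\mapsto\mathbb{E}[h(x-D)]$ is finite, continuous and nonnegative on $\mathbb{X}$ and $\mathbb{E}[h(x-D)]\to+\infty$ as $|x|\to+\infty$. Dynamics: $x_{t+1}=x_t+a_t-D_{t+1}$, $t=0,1,\ldots$. One-step cost: $c(x,a)=K\mathbf{1}_{\{a>0\}}+\bar c a+\mathbb{E}[h(x+a-D)]$. Policies may be randomized and history-dependent; $\mathbb{E}_x^\pi$ is the expectation for initial state $x$ and policy $\pi$. A stationary policy is identified with a map $\varphi:\mathbb{X}\to\mathbb{A}$. $v_\alpha^\pi(x)=\mathbb{E}_x^\pi[\sum_{t=0}^\infty\alpha^t c(x_t,a_t)]$ and $v_\alpha(x)=\inf_\pi v^\pi_\alpha(x)$ for $\alpha\in[0,1)$; $\pi$ is optimal for discount factor $\alpha$ if $v_\alpha^\pi=v_\alpha$ on $\mathbb{X}$.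 $m_\alpha:=\inf_{x\in\mathbb{X}}v_\alpha(x)$, $u_\alpha(x):=v_\alpha(x)-m_\alpha$, and $w:=\lim_{\alpha\uparrow1}(1-\alpha)m_\alpha$ (this limit exists under the hypotheses). Average cost: $w^\pi(x)=\limsup_{N\to+\infty}\frac1N\mathbb{E}_x^\pi[\sum_{t=0}^{N-1}c(x_t,a_t)]$; "optimal" stationary policy in the conclusion means average-cost optimal, i.e. $w^\varphi(x)=\inf_{\pi}w^{\pi}(x)$ for all $x\in\mathbb{X}$. For $\alpha\in(0,1]$: $h_\alpha(x):=h(x)+(1-\alpha)\bar c x+\bar c\,\mathbb{E}[D]$. The notation $\liminf_{k\to\infty,y\to x}u_{\alpha_{n_k}}(y)$ means the largest number that is $\le\liminf_{k}u_{\alpha_{n_k}}(y_k)$ for all sequences $y_k\to x$. A function is inf-compact if all its sublevel sets $\{f\le\lambda\}$, $\lambda\in\mathbb{R}$, are compact. A function $f$ is quasiconvex if $f(\lambda x+(1-\lambda)y)\le\max\{f(x),f(y)\}$ for all $x,y$ and $\lambda\in[0,1]$ (if $\mathbb{X}=\mathbb{Z}$, whenever $x,y,\lambda x+(1-\lambda)y\in\mathbb{Z}$). For reals $s\le S$, an $(s,S)$ policy is the stationary policy that orders up to level $S$ (action $S-x$) if the current state $x<s$ and does not order (action $0$) if $x\ge s$. Under the hypotheses an optimal $(s,S)$ policy exists for every $\alpha\in(\alpha^*,1)$.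
   Formalization: For X = Z the given levels s'_α, S'_α are required to be integers; with real s'_α the limit claim fails, e.g. D = 1, h(x) = |x|, K = 0.1, unit cost 1, (s'_α, S'_α) = (1-α, 1), whose limit (0, 1) is not average-cost optimal. *)

theory Defs
  imports "HOL-Probability.Probability"
begin

subsection \<open>Functions on a set of states\<close>

definition quasiconvex_on :: "real set \<Rightarrow> (real \<Rightarrow> real) \<Rightarrow> bool" where
  "quasiconvex_on X f \<longleftrightarrow>
     (\<forall>x\<in>X. \<forall>y\<in>X. \<forall>l\<in>{0..1}. l * x + (1 - l) * y \<in> X \<longrightarrow>
        f (l * x + (1 - l) * y) \<le> max (f x) (f y))"

definition inf_compact_on :: "real set \<Rightarrow> (real \<Rightarrow> real) \<Rightarrow> bool" where
  "inf_compact_on X f \<longleftrightarrow> (\<forall>l. compact {x\<in>X. f x \<le> l})"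

text \<open>The lower limit of \<open>f k y\<close> as \<open>k \<rightarrow> \<infinity>\<close> and \<open>y \<rightarrow> x\<close> jointly: the largest number that is
  below \<open>liminf f k (y k)\<close> for every sequence \<open>y\<close> in \<open>X\<close> converging to \<open>x\<close>.\<close>

definition joint_liminf :: "real set \<Rightarrow> (nat \<Rightarrow> real \<Rightarrow> ereal) \<Rightarrow> real \<Rightarrow> ereal" where
  "joint_liminf X f x =
     (INF y\<in>{y. (\<forall>k. y k \<in> X) \<and> y \<longlonglongrightarrow> x}. liminf (\<lambda>k. f k (y k)))"

subsection \<open>The inventory model\<close>

text \<open>The state space is a set of reals (\<open>UNIV\<close> or \<open>\<int>\<close>), so that both variants of the model are
  treated at once. The demands are \<open>demand 1\<close>, \<open>demand 2\<close>, \dots; \<open>demand 0\<close> is not used.\<close>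

record 'w inventory =
  omega :: "'w measure"
  demand :: "nat \<Rightarrow> 'w \<Rightarrow> real"
  states :: "real set"
  holding :: "real \<Rightarrow> real"
  setup_cost :: real
  unit_cost :: real

definition actions :: "'w inventory \<Rightarrow> real set" where
  "actions I = states I \<inter> {0..}"

text \<open>\<open>mean_after I f x = E[f (x - D)]\<close>.\<close>

definition mean_after :: "'w inventory \<Rightarrow> (real \<Rightarrow> real) \<Rightarrow> real \<Rightarrow> real" where
  "mean_after I f x = (\<integral>\<omega>. f (x - demand I 1 \<omega>) \<partial>omega I)"

definition mean_demand :: "'w inventory \<Rightarrow> real" where
  "mean_demand I = (\<integral>\<omega>. demand I 1 \<omega> \<partial>omega I)"

locale inventory_model = prob_space "omega I" for I :: "'w inventory" +
  assumes states: "states I = UNIV \<or> states I = \<int>"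
    and setup_cost_pos: "setup_cost I > 0"
    and unit_cost_pos: "unit_cost I > 0"
    and demand_indep: "indep_vars (\<lambda>_. borel) (demand I) {1..}"
    and demand_ident: "\<And>t. t \<ge> 1 \<Longrightarrow>
      distr (omega I) borel (demand I t) = distr (omega I) borel (demand I 1)"
    and demand_nonneg: "\<And>t \<omega>. t \<ge> 1 \<Longrightarrow> \<omega> \<in> space (omega I) \<Longrightarrow> demand I t \<omega> \<ge> 0"
    and demand_states: "\<And>t \<omega>. t \<ge> 1 \<Longrightarrow> \<omega> \<in> space (omega I) \<Longrightarrow> demand I t \<omega> \<in> states I"
    and demand_integrable: "integrable (omega I) (demand I 1)"
    and demand_nontrivial: "prob {\<omega> \<in> space (omega I). demand I 1 \<omega> > 0} > 0"
    and holding_integrable: "\<And>x. x \<in> states I \<Longrightarrow>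
      integrable (omega I) (\<lambda>\<omega>. holding I (x - demand I 1 \<omega>))"
    and holding_continuous: "continuous_on (states I) (mean_after I (holding I))"
    and holding_nonneg: "\<And>x. x \<in> states I \<Longrightarrow> mean_after I (holding I) x \<ge> 0"
    and holding_coercive:
      "filterlim (mean_after I (holding I)) at_top (inf at_infinity (principal (states I)))"

definition cost :: "'w inventory \<Rightarrow> real \<Rightarrow> real \<Rightarrow> real" where
  "cost I x a = setup_cost I * of_bool (a > 0) + unit_cost I * a + mean_after I (holding I) (x + a)"

text \<open>\<open>h\<^sub>\<alpha>(x) = h(x) + (1 - \<alpha>) c x + c E[D]\<close>, with \<open>c\<close> the unit cost.\<close>

definition disc_holding :: "'w inventory \<Rightarrow> real \<Rightarrow> real \<Rightarrow> real" where
  "disc_holding I \<alpha> x =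
     holding I x + (1 - \<alpha>) * unit_cost I * x + unit_cost I * mean_demand I"

subsection \<open>Policies\<close>

definition state_space :: "'w inventory \<Rightarrow> real measure" where
  "state_space I = restrict_space borel (states I)"

definition action_space :: "'w inventory \<Rightarrow> real measure" where
  "action_space I = restrict_space borel (actions I)"

definition step_space :: "'w inventory \<Rightarrow> (real \<times> real) measure" where
  "step_space I = state_space I \<Otimes>\<^sub>M action_space I"

text \<open>A policy maps the time \<open>t\<close>, the past \<open>(x\<^sub>0, a\<^sub>0), \<dots>, (x\<^bsub>t-1\<^esub>, a\<^bsub>t-1\<^esub>)\<close> and the current state
  \<open>x\<^sub>t\<close> to the distribution of the action \<open>a\<^sub>t\<close>.\<close>

type_synonym policy = "nat \<Rightarrow> (nat \<Rightarrow> real \<times> real) \<Rightarrow> real \<Rightarrow> real measure"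

definition policies :: "'w inventory \<Rightarrow> policy set" where
  "policies I = {\<pi>. \<forall>t. (\<lambda>(\<eta>, x). \<pi> t \<eta> x) \<in>
     PiM {0..<t} (\<lambda>_. step_space I) \<Otimes>\<^sub>M state_space I \<rightarrow>\<^sub>M prob_algebra (action_space I)}"

definition stationary_policies :: "'w inventory \<Rightarrow> (real \<Rightarrow> real) set" where
  "stationary_policies I = state_space I \<rightarrow>\<^sub>M action_space I"

definition stationary :: "'w inventory \<Rightarrow> (real \<Rightarrow> real) \<Rightarrow> policy" where
  "stationary I \<phi> = (\<lambda>t \<eta> x. return (action_space I) (\<phi> x))"

definition sS_policy :: "real \<Rightarrow> real \<Rightarrow> real \<Rightarrow> real" where
  "sS_policy s S x = (if x < s then S - x else 0)"

text \<open>The distribution of \<open>(x\<^sub>t, a\<^sub>t)\<close> given the past, where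
  \<open>x\<^bsub>t+1\<^esub> = x\<^sub>t + a\<^sub>t - D\<^bsub>t+1\<^esub>\<close>; Ionescu-Tulcea turns these kernels into the distribution
  of the whole trajectory.\<close>

definition next_state ::
    "'w inventory \<Rightarrow> real \<Rightarrow> nat \<Rightarrow> (nat \<Rightarrow> real \<times> real) \<Rightarrow> real measure" where
  "next_state I x0 t \<eta> = (case t of
       0 \<Rightarrow> return (state_space I) x0
     | Suc n \<Rightarrow> distr (omega I) (state_space I)
                 (\<lambda>\<omega>. fst (\<eta> n) + snd (\<eta> n) - demand I (Suc n) \<omega>))"

definition step_kernel ::
    "'w inventory \<Rightarrow> policy \<Rightarrow> real \<Rightarrow> nat \<Rightarrow> (nat \<Rightarrow> real \<times> real) \<Rightarrow> (real \<times> real) measure" where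
  "step_kernel I \<pi> x0 t \<eta> =
     next_state I x0 t \<eta> \<bind> (\<lambda>x. \<pi> t \<eta> x \<bind> (\<lambda>a. return (step_space I) (x, a)))"

definition trajectory ::
    "'w inventory \<Rightarrow> policy \<Rightarrow> real \<Rightarrow> (nat \<Rightarrow> real \<times> real) measure" where
  "trajectory I \<pi> x0 =
     projective_family.lim UNIV
       (Ionescu_Tulcea.CI (step_kernel I \<pi> x0) (\<lambda>_. step_space I)) (\<lambda>_. step_space I)"

text \<open>The kernels meet the hypotheses of the Ionescu-Tulcea theorem, so \<^const>\<open>trajectory\<close> is
  the strategic measure of the policy.\<close>

context inventory_model
begin

lemma states_add: "x \<in> states I \<Longrightarrow> y \<in> states I \<Longrightarrow> x + y \<in> states I"
  using states by (elim disjE) simp_all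

lemma states_diff: "x \<in> states I \<Longrightarrow> y \<in> states I \<Longrightarrow> x - y \<in> states I"
  using states by (elim disjE) simp_all

lemma space_state_action: "space (state_space I) = states I" "space (action_space I) = actions I"
  by (auto simp: state_space_def action_space_def space_restrict_space)

lemma space_step: "space (step_space I) = states I \<times> actions I"
  by (auto simp: step_space_def space_pair_measure space_state_action)

lemma demand_measurable: "demand I (Suc n) \<in> borel_measurable (omega I)"
  using demand_indep unfolding indep_vars_def by simp

lemma next_state_measurable:
  assumes "x0 \<in> states I"
  shows "next_state I x0 t \<in> PiM {0..<t} (\<lambda>_. step_space I) \<rightarrow>\<^sub>M prob_algebra (state_space I)"
proof (cases t)
  case 0
  have "return (state_space I) x0 \<in> space (prob_algebra (state_space I))"
    using assms by (simp add: space_prob_algebra prob_space_return space_state_action)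
  then show ?thesis
    unfolding next_state_def 0 nat.case by (rule measurable_const)
next
  case (Suc n)
  let ?P = "PiM {0..<t} (\<lambda>_. step_space I)"
  have c: "(\<lambda>\<eta>. \<eta> n) \<in> ?P \<rightarrow>\<^sub>M step_space I"
    using Suc by (intro measurable_component_singleton) auto
  have f: "(\<lambda>\<eta>. fst (\<eta> n)) \<in> borel_measurable ?P" "(\<lambda>\<eta>. snd (\<eta> n)) \<in> borel_measurable ?P"
  proof -
    have "(\<lambda>\<eta>. fst (\<eta> n)) \<in> ?P \<rightarrow>\<^sub>M state_space I"
      using measurable_compose[OF c[unfolded step_space_def] measurable_fst]
      by (simp add: step_space_def)
    then show "(\<lambda>\<eta>. fst (\<eta> n)) \<in> borel_measurable ?P" unfolding state_space_def
      by (simp add: measurable_restrict_space2_iff)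
    have "(\<lambda>\<eta>. snd (\<eta> n)) \<in> ?P \<rightarrow>\<^sub>M action_space I"
      using measurable_compose[OF c[unfolded step_space_def] measurable_snd]
      by (simp add: step_space_def)
    then show "(\<lambda>\<eta>. snd (\<eta> n)) \<in> borel_measurable ?P" unfolding action_space_def
      by (simp add: measurable_restrict_space2_iff)
  qed
  have sp: "\<eta> n \<in> states I \<times> actions I" if "\<eta> \<in> space ?P" for \<eta>
    using measurable_space[OF c that] by (simp add: space_step)
  have m: "(\<lambda>(\<eta>,\<omega>). fst (\<eta> n) + snd (\<eta> n) - demand I (Suc n) \<omega>) \<in> ?P \<Otimes>\<^sub>M omega I \<rightarrow>\<^sub>M state_space I"
    unfolding state_space_def
  proof (rule measurable_restrict_space2)
    show "(\<lambda>(\<eta>, \<omega>). fst (\<eta> n) + snd (\<eta> n) - demand I (Suc n) \<omega>)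
        \<in> space (?P \<Otimes>\<^sub>M omega I) \<rightarrow> states I"
    proof (clarsimp simp: space_pair_measure)
      fix \<eta> \<omega> assume \<eta>: "\<eta> \<in> space ?P" and \<omega>: "\<omega> \<in> space (omega I)"
      have "fst (\<eta> n) \<in> states I" "snd (\<eta> n) \<in> states I"
        using sp[OF \<eta>] by (auto simp: actions_def mem_Times_iff)
      then show "fst (\<eta> n) + snd (\<eta> n) - demand I (Suc n) \<omega> \<in> states I"
        using demand_states[OF _ \<omega>, of "Suc n"] by (intro states_add states_diff) simp_all
    qed
    have "(\<lambda>p. fst (fst p n)) \<in> borel_measurable (?P \<Otimes>\<^sub>M omega I)"
      "(\<lambda>p. snd (fst p n)) \<in> borel_measurable (?P \<Otimes>\<^sub>M omega I)"
      "(\<lambda>p. demand I (Suc n) (snd p)) \<in> borel_measurable (?P \<Otimes>\<^sub>M omega I)"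
      by (rule measurable_compose[OF measurable_fst f(1)] measurable_compose[OF measurable_fst f(2)]
          measurable_compose[OF measurable_snd demand_measurable])+
    then show "(\<lambda>(\<eta>, \<omega>). fst (\<eta> n) + snd (\<eta> n) - demand I (Suc n) \<omega>)
        \<in> borel_measurable (?P \<Otimes>\<^sub>M omega I)"
      unfolding split_def by (intro borel_measurable_diff borel_measurable_add)
  qed
  have omega: "(\<lambda>_. omega I) \<in> ?P \<rightarrow>\<^sub>M prob_algebra (omega I)"
    by (intro measurable_const) (simp add: space_prob_algebra prob_space_axioms)
  have eq: "next_state I x0 t = (\<lambda>\<eta>. distr (omega I) (state_space I)
      (\<lambda>\<omega>. fst (\<eta> n) + snd (\<eta> n) - demand I (Suc n) \<omega>))"
    unfolding next_state_def Suc nat.case ..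
  show ?thesis
    unfolding eq by (rule measurable_distr_prob_space2[OF omega m])
qed

lemma step_kernel_Ionescu_Tulcea:
  assumes "x0 \<in> states I" "\<pi> \<in> policies I"
  shows "Ionescu_Tulcea (step_kernel I \<pi> x0) (\<lambda>_. step_space I)"
proof -
  have k: "step_kernel I \<pi> x0 t \<in> PiM {0..<t} (\<lambda>_. step_space I) \<rightarrow>\<^sub>M prob_algebra (step_space I)" for t
  proof -
    let ?P = "PiM {0..<t} (\<lambda>_. step_space I)"
    note next_state_measurable[OF assms(1), measurable]
    have p[measurable]: "(\<lambda>(\<eta>, x). \<pi> t \<eta> x) \<in> ?P \<Otimes>\<^sub>M state_space I \<rightarrow>\<^sub>M prob_algebra (action_space I)"
      using assms(2) by (simp add: policies_def)
    have r: "(\<lambda>q. return (step_space I) (snd (fst q), snd q)) \<in> (?P \<Otimes>\<^sub>M state_space I) \<Otimes>\<^sub>M action_space I \<rightarrow>\<^sub>M prob_algebra (step_space I)"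
      unfolding step_space_def by measurable
    have b: "(\<lambda>(\<eta>,x). \<pi> t \<eta> x \<bind> (\<lambda>a. return (step_space I) (x, a))) \<in> ?P \<Otimes>\<^sub>M state_space I \<rightarrow>\<^sub>M prob_algebra (step_space I)"
      unfolding split_def
      by (rule measurable_bind_prob_space2[OF p[unfolded split_def]]) (use r in \<open>simp add: split_def\<close>)
    show ?thesis unfolding step_kernel_def
      by (rule measurable_bind_prob_space2[OF next_state_measurable[OF assms(1)] b])
  qed
  show ?thesis
  proof (rule Ionescu_Tulcea.intro)
    show "step_kernel I \<pi> x0 t
        \<in> PiM {0..<t} (\<lambda>_. step_space I) \<rightarrow>\<^sub>M subprob_algebra (step_space I)" for t
      using k by (rule measurable_prob_algebraD)
    show "prob_space (step_kernel I \<pi> x0 t \<eta>)"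
      if "\<eta> \<in> space (PiM {0..<t} (\<lambda>_. step_space I))" for t \<eta>
      using measurable_space[OF k that] by (simp add: space_prob_algebra)
  qed
qed

lemma stationary_in_policies:
  assumes "\<phi> \<in> stationary_policies I"
  shows "stationary I \<phi> \<in> policies I"
proof -
  have "(\<lambda>p. \<phi> (snd p)) \<in> N \<Otimes>\<^sub>M state_space I \<rightarrow>\<^sub>M action_space I"
    for N :: "(nat \<Rightarrow> real \<times> real) measure"
    using measurable_compose[OF measurable_snd] assms unfolding stationary_policies_def .
  from measurable_compose[OF this measurable_return_prob_space] show ?thesis
    by (simp add: policies_def stationary_def split_def)
qed

end

text \<open>The one-step costs are nonnegative, hence expected costs are taken in \<^typ>\<open>ennreal\<close>.\<close>

definition disc_cost :: "'w inventory \<Rightarrow> real \<Rightarrow> policy \<Rightarrow> real \<Rightarrow> ennreal" where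
  "disc_cost I \<alpha> \<pi> x =
     (\<integral>\<^sup>+\<eta>. (\<Sum>t. ennreal (\<alpha> ^ t * cost I (fst (\<eta> t)) (snd (\<eta> t)))) \<partial>trajectory I \<pi> x)"

definition disc_value :: "'w inventory \<Rightarrow> real \<Rightarrow> real \<Rightarrow> ennreal" where
  "disc_value I \<alpha> x = (INF \<pi>\<in>policies I. disc_cost I \<alpha> \<pi> x)"

definition disc_optimal :: "'w inventory \<Rightarrow> real \<Rightarrow> (real \<Rightarrow> real) \<Rightarrow> bool" where
  "disc_optimal I \<alpha> \<phi> \<longleftrightarrow> \<phi> \<in> stationary_policies I \<and>
     (\<forall>x\<in>states I. disc_cost I \<alpha> (stationary I \<phi>) x = disc_value I \<alpha> x)"

definition min_value :: "'w inventory \<Rightarrow> real \<Rightarrow> ennreal" where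
  "min_value I \<alpha> = (INF x\<in>states I. disc_value I \<alpha> x)"

definition rel_value :: "'w inventory \<Rightarrow> real \<Rightarrow> real \<Rightarrow> ereal" where
  "rel_value I \<alpha> x = enn2ereal (disc_value I \<alpha> x) - enn2ereal (min_value I \<alpha>)"

definition avg_cost :: "'w inventory \<Rightarrow> policy \<Rightarrow> real \<Rightarrow> ennreal" where
  "avg_cost I \<pi> x = limsup (\<lambda>N.
     (\<integral>\<^sup>+\<eta>. (\<Sum>t<N. ennreal (cost I (fst (\<eta> t)) (snd (\<eta> t)))) \<partial>trajectory I \<pi> x) / of_nat N)"

definition avg_optimal :: "'w inventory \<Rightarrow> (real \<Rightarrow> real) \<Rightarrow> bool" where
  "avg_optimal I \<phi> \<longleftrightarrow> \<phi> \<in> stationary_policies I \<and>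
     (\<forall>x\<in>states I. avg_cost I (stationary I \<phi>) x = (INF \<pi>\<in>policies I. avg_cost I \<pi> x))"

subsection \<open>The average-cost optimality equation\<close>

definition order_fun :: "'w inventory \<Rightarrow> (real \<Rightarrow> real) \<Rightarrow> real \<Rightarrow> real" where
  "order_fun I u x = unit_cost I * x + mean_after I (holding I) x + mean_after I u x"

text \<open>\<open>a\<close> below witnesses that the minimum over all actions is attained.\<close>

definition avg_optimality_eq ::
    "'w inventory \<Rightarrow> real \<Rightarrow> (real \<Rightarrow> real) \<Rightarrow> (real \<Rightarrow> real) \<Rightarrow> bool" where
  "avg_optimality_eq I w u \<phi> \<longleftrightarrow> (\<forall>x\<in>states I.
     w + u x = setup_cost I * of_bool (\<phi> x > 0) + order_fun I u (x + \<phi> x) - unit_cost I * x \<and>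
     (\<exists>a. is_arg_min (\<lambda>a. setup_cost I + order_fun I u (x + a)) (\<lambda>a. a \<in> actions I) a \<and>
        w + u x = min (setup_cost I + order_fun I u (x + a)) (order_fun I u x) - unit_cost I * x))"

end

theory Submission
  imports Defs "HOL-Complex_Analysis.Great_Picard"
begin

text \<open>After adding \<open>c x\<close> to the discounted value function, the optimality of the \<open>(s, S)\<close> policy says that
  the excess \<open>e\<close> of this function over its minimum is the constant \<open>K\<close> below \<open>s\<close> and solves the renewal
  equation \<open>e(x) = f(x) + \<alpha> E[e(x - D)]\<close> above \<open>s\<close>. Quasiconvexity keeps \<open>s\<close> bounded below as
  \<open>\<alpha> \<rightarrow> 1\<close>, coercivity keeps \<open>S\<close> bounded above. As \<open>P(D > 0) > 0\<close>, the renewal equation then yields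
  bounds and moduli of continuity of \<open>e\<close> that are uniform in \<open>\<alpha>\<close>, so that a subsequence converges
  locally uniformly and the discounted optimality equation passes to the limit. The average cost of the
  limiting policy is at most the limit \<open>w\<close> of \<open>(1 - \<alpha>) m\<^sub>\<alpha>\<close> along the subsequence, while by the
  Abelian comparison no policy does better than any such limit; hence the limit exists along the whole
  family, and the policy is optimal.\<close>


text \<open>The obstacle is that the factor \<alpha> stops contracting as \<alpha> tends to 1, so
  direct bounds from the discounted equation are of order \<open>1 / (1 - \<alpha>)\<close>.
  Downward drift takes the place of contraction: some \<delta> > 0 has
  \<open>P(D > \<delta>) = p > 0\<close>, and an estimate on a bounded region is paid for by a
  factor \<open>n / p\<close>, where n counts the \<delta>-steps down to a region in which the
  estimate is trivial. It is trivial below s because the excess is constant there; the relative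
  value itself has slope -c towards minus infinity. The excess is normalized at S, where it
  vanishes, and the gap to the normalization by \<open>m_\<alpha>\<close> is carried along as one
  bounded number. No general dynamic programming theorem enters: the value function is the cost of
  the given optimal stationary policy and hence solves the one-step equation, and a single deviation
  in the first period gives the inequality for every other action. Both state spaces are treated
  together; on the integers equicontinuity is trivial.\<close>

context Ionescu_Tulcea
begin

lemma C_eq_distr_lim:
  "C 0 n (\<lambda>_. undefined) = distr PF.lim (PiM {0..<n} M) (\<lambda>\<eta>. restrict \<eta> {0..<n})"
proof -
  have "CI {0..<n} = C 0 n (\<lambda>_. undefined)"
  proof -
    have u: "up_to {0..<n} = n"
      unfolding up_to_def by (rule Least_equality) (auto simp: not_le[symmetric])
    have *: "(\<lambda>_. undefined) \<in> space (PiM {0..<0} M)"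
      by (simp add: space_PiM)
    show ?thesis
      unfolding CI_def u using distr_C[OF le_refl *, of n] by simp
  qed
  then show ?thesis
    using distr_lim[of "{0..<n}"] by simp
qed

text \<open>Disintegration at time t: given the coordinates before t, coordinate t has law
  \<open>P t\<close>. All expected one-period costs of Markov policies are computed from this
  identity.\<close>

lemma nn_integral_lim_step:
  assumes F[measurable]: "F \<in> borel_measurable (M t)"
  shows "(\<integral>\<^sup>+\<eta>. F (\<eta> t) \<partial>PF.lim) = (\<integral>\<^sup>+\<eta>. \<integral>\<^sup>+x. F x \<partial>P t (restrict \<eta> {0..<t}) \<partial>PF.lim)"
proof -
  let ?u = "\<lambda>_. undefined"
  have *: "?u \<in> space (PiM {0..<0} M)" by (simp add: space_PiM)
  have r: "(\<lambda>\<eta>. restrict \<eta> {0..<n}) \<in> PF.lim \<rightarrow>\<^sub>M PiM {0..<n} M" for n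
    by (subst measurable_cong_sets[OF PF.sets_lim refl]) (auto intro!: measurable_restrict_subset)
  have comp: "(\<lambda>\<eta>. F (\<eta> t)) \<in> borel_measurable (PiM {0..<Suc t} M)"
    by (rule measurable_compose[OF measurable_component_singleton[of t "{0..<Suc t}" M] F]) simp
  have inner: "(\<lambda>\<eta>. \<integral>\<^sup>+x. F x \<partial>P t \<eta>) \<in> borel_measurable (PiM {0..<t} M)"
    by measurable
  have "(\<integral>\<^sup>+\<eta>. F (\<eta> t) \<partial>PF.lim)
      = (\<integral>\<^sup>+\<eta>. F (\<eta> t) \<partial>C 0 (Suc t) ?u)"
    unfolding C_eq_distr_lim using comp by (subst nn_integral_distr[OF r]) simp_all
  also have "\<dots> = (\<integral>\<^sup>+\<eta>. \<integral>\<^sup>+\<eta>'. F (\<eta>' t) \<partial>eP t \<eta> \<partial>C 0 t ?u)"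
  proof -
    have "eP t \<in> C 0 t ?u \<rightarrow>\<^sub>M subprob_algebra (PiM {0..<Suc t} M)"
      by (subst measurable_cong_sets[OF _ refl, where M'="PiM {0..<t} M"]) (use sets_C[OF *, of t] in simp_all)
    from nn_integral_bind[OF comp this] show ?thesis by simp
  qed
  also have "\<dots> = (\<integral>\<^sup>+\<eta>. \<integral>\<^sup>+x. F x \<partial>P t \<eta> \<partial>C 0 t ?u)"
    by (intro nn_integral_cong) (simp add: space_C[OF *] nn_integral_eP[OF _ comp])
  also have "\<dots> = (\<integral>\<^sup>+\<eta>. \<integral>\<^sup>+x. F x \<partial>P t (restrict \<eta> {0..<t}) \<partial>PF.lim)"
    unfolding C_eq_distr_lim using inner by (subst nn_integral_distr[OF r]) simp_all
  finally show ?thesis .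
qed

end

subsection \<open>Costs along trajectories\<close>

context inventory_model
begin

text \<open>The total mass is already visible in the projection onto the empty index set, which is a
  probability measure of the projective family.\<close>

lemma prob_space_trajectory:
  assumes "x \<in> states I" "\<pi> \<in> policies I"
  shows "prob_space (trajectory I \<pi> x)"
    and sets_trajectory: "sets (trajectory I \<pi> x) = sets (PiM UNIV (\<lambda>_. step_space I))"
proof -
  interpret IT: Ionescu_Tulcea "step_kernel I \<pi> x" "\<lambda>_. step_space I"
    by (rule step_kernel_Ionescu_Tulcea[OF assms])
  have "prob_space (distr IT.PF.lim (PiM {} (\<lambda>_. step_space I)) (\<lambda>\<eta>. restrict \<eta> {}))"
    by (subst IT.distr_lim) (simp_all add: IT.PF.prob_space_P)
  moreover have "(\<lambda>\<eta>. restrict \<eta> {}) \<in> IT.PF.lim \<rightarrow>\<^sub>M PiM {} (\<lambda>_. step_space I)"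
    by (subst measurable_cong_sets[OF IT.PF.sets_lim refl]) (auto intro!: measurable_restrict_subset)
  ultimately show "prob_space (trajectory I \<pi> x)"
    unfolding trajectory_def by (rule prob_space_distrD[rotated])
  show "sets (trajectory I \<pi> x) = sets (PiM UNIV (\<lambda>_. step_space I))"
    unfolding trajectory_def by (rule IT.PF.sets_lim)
qed

lemma demand1_measurable [measurable]: "demand I 1 \<in> borel_measurable (omega I)"
  using demand_measurable[of 0] by simp

lemma zero_state: "0 \<in> states I"
  using states by (elim disjE) simp_all

lemma minus_demand_measurable:
  assumes "y \<in> states I"
  shows "(\<lambda>\<omega>. y - demand I (Suc n) \<omega>) \<in> omega I \<rightarrow>\<^sub>M state_space I"
  unfolding state_space_def
  using assms demand_measurable[of n] demand_states[of "Suc n"]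
  by (intro measurable_restrict_space2) (auto intro!: states_diff)

lemma minus_demand1_measurable:
  assumes "y \<in> states I"
  shows "(\<lambda>\<omega>. y - demand I 1 \<omega>) \<in> omega I \<rightarrow>\<^sub>M state_space I"
  using minus_demand_measurable[OF assms, of 0] by simp

text \<open>The demands are identically distributed as real random variables, while the transition
  kernels are measures on \<open>state_space\<close>; the equality of laws is carried over by
  restriction to the measurable set of states.\<close>

lemma demand_distr_state:
  assumes "y \<in> states I"
  shows "distr (omega I) (state_space I) (\<lambda>\<omega>. y - demand I (Suc n) \<omega>)
       = distr (omega I) (state_space I) (\<lambda>\<omega>. y - demand I 1 \<omega>)"
proof -
  have sp: "(\<lambda>d. y - d) \<in> restrict_space borel (states I) \<rightarrow>\<^sub>M state_space I"
    unfolding state_space_def using assms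
    by (intro measurable_restrict_space2 measurable_restrict_space1) (auto simp: space_restrict_space intro: states_diff)
  have X: "states I \<inter> space borel \<in> sets borel"
    using states by (auto intro: borel_closed closed_Ints)
  have d: "demand I (Suc k) \<in> omega I \<rightarrow>\<^sub>M state_space I" for k
    unfolding state_space_def using demand_states[of "Suc k"] demand_measurable
    by (intro measurable_restrict_space2) auto
  have eq: "distr (omega I) (state_space I) (demand I (Suc k))
      = restrict_space (distr (omega I) borel (demand I (Suc k))) (states I)" for k
  proof (rule measure_eqI)
    fix A assume A: "A \<in> sets (distr (omega I) (state_space I) (demand I (Suc k)))"
    then obtain B where B: "A = states I \<inter> B" "B \<in> sets borel"
      by (auto simp: state_space_def sets_restrict_space)
    have A': "A \<in> sets borel"
      using B X by auto
    have "emeasure (distr (omega I) (state_space I) (demand I (Suc k))) A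
        = emeasure (omega I) (demand I (Suc k) -` A \<inter> space (omega I))"
      using A by (intro emeasure_distr d) simp
    also have "\<dots> = emeasure (distr (omega I) borel (demand I (Suc k))) A"
      using A' demand_measurable by (intro emeasure_distr[symmetric]) auto
    also have "\<dots> = emeasure (restrict_space (distr (omega I) borel (demand I (Suc k))) (states I)) A"
      using X B by (intro emeasure_restrict_space[symmetric]) auto
    finally show "emeasure (distr (omega I) (state_space I) (demand I (Suc k))) A = \<dots>" .
  qed (simp add: state_space_def sets_restrict_space)
  have same: "distr (omega I) (state_space I) (demand I (Suc n)) = distr (omega I) (state_space I) (demand I 1)"
    unfolding eq using eq[of 0] demand_ident[of "Suc n"] by simp
  have "distr (omega I) (state_space I) (\<lambda>\<omega>. y - demand I (Suc k) \<omega>)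
      = distr (distr (omega I) (state_space I) (demand I (Suc k))) (state_space I) (\<lambda>d. y - d)" for k
    by (subst distr_distr[OF _ d]) (use sp in \<open>auto simp: comp_def state_space_def\<close>)
  from this[of n] this[of 0] same show ?thesis by simp
qed

text \<open>The \<open>ennreal\<close> counterpart of \<open>mean_after\<close>. It needs no
  integrability, so cost recursions can be stated before any value is known to be finite.\<close>

definition after :: "(real \<Rightarrow> ennreal) \<Rightarrow> real \<Rightarrow> ennreal" where
  "after \<psi> y = (\<integral>\<^sup>+\<omega>. \<psi> (y - demand I 1 \<omega>) \<partial>omega I)"

definition markov :: "(nat \<Rightarrow> real \<Rightarrow> real) \<Rightarrow> policy" where
  "markov f = (\<lambda>t \<eta> x. return (action_space I) (f t x))"

lemma stationary_eq_markov: "stationary I \<phi> = markov (\<lambda>_. \<phi>)"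
  by (simp add: stationary_def markov_def)

lemma markov_in_policies:
  assumes "\<And>t. f t \<in> stationary_policies I"
  shows "markov f \<in> policies I"
proof -
  have "(\<lambda>p. f t (snd p)) \<in> N \<Otimes>\<^sub>M state_space I \<rightarrow>\<^sub>M action_space I"
    for N :: "(nat \<Rightarrow> real \<times> real) measure" and t
    using measurable_compose[OF measurable_snd assms[of t, unfolded stationary_policies_def]] .
  from measurable_compose[OF this measurable_return_prob_space] show ?thesis
    by (simp add: policies_def markov_def split_def)
qed

lemma after_measurable:
  assumes "\<psi> \<in> borel_measurable (state_space I)"
  shows "after \<psi> \<in> borel_measurable (state_space I)"
proof -
  have "(\<lambda>(y, \<omega>). y - demand I 1 \<omega>) \<in> state_space I \<Otimes>\<^sub>M omega I \<rightarrow>\<^sub>M state_space I"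
    unfolding state_space_def
  proof (rule measurable_restrict_space2)
    show "(\<lambda>(y, \<omega>). y - demand I 1 \<omega>) \<in> space (restrict_space borel (states I) \<Otimes>\<^sub>M omega I) \<rightarrow> states I"
      using demand_states[of 1] by (auto simp: space_pair_measure space_restrict_space intro: states_diff)
    have "fst \<in> borel_measurable (restrict_space borel (states I) \<Otimes>\<^sub>M omega I)"
      using measurable_fst[of "restrict_space borel (states I)" "omega I"]
      by (simp add: measurable_restrict_space2_iff)
    moreover have "(\<lambda>p. demand I 1 (snd p)) \<in> borel_measurable (restrict_space borel (states I) \<Otimes>\<^sub>M omega I)"
      by measurable
    ultimately show "(\<lambda>(y, \<omega>). y - demand I 1 \<omega>) \<in> borel_measurable (restrict_space borel (states I) \<Otimes>\<^sub>M omega I)"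
      unfolding split_def by (rule borel_measurable_diff)
  qed
  from measurable_compose[OF this assms] show ?thesis
    unfolding after_def by (intro borel_measurable_nn_integral) (simp add: split_def)
qed

lemma action_measurable_state:
  assumes "\<phi> \<in> stationary_policies I"
  shows "(\<lambda>x. x + \<phi> x) \<in> state_space I \<rightarrow>\<^sub>M state_space I"
    and "\<phi> \<in> borel_measurable (state_space I)"
    and "x \<in> states I \<Longrightarrow> \<phi> x \<in> actions I"
    and "x \<in> states I \<Longrightarrow> x + \<phi> x \<in> states I"
proof -
  have m: "\<phi> \<in> state_space I \<rightarrow>\<^sub>M restrict_space borel (actions I)"
    using assms by (simp add: stationary_policies_def action_space_def)
  then show b: "\<phi> \<in> borel_measurable (state_space I)"
    by (simp add: measurable_restrict_space2_iff)
  have a: "\<phi> x \<in> actions I" if "x \<in> states I" for x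
    using measurable_space[OF m, of x] that by (simp add: space_state_action space_restrict_space)
  then show "x \<in> states I \<Longrightarrow> \<phi> x \<in> actions I" .
  have s: "x + \<phi> x \<in> states I" if "x \<in> states I" for x
    using a[OF that] that by (auto simp: actions_def intro: states_add)
  then show "x \<in> states I \<Longrightarrow> x + \<phi> x \<in> states I" .
  have "(\<lambda>x. x) \<in> borel_measurable (state_space I)"
    unfolding state_space_def by (rule measurable_restrict_space1) simp
  then have "(\<lambda>x. x + \<phi> x) \<in> borel_measurable (state_space I)"
    using b by (rule borel_measurable_add)
  then show "(\<lambda>x. x + \<phi> x) \<in> state_space I \<rightarrow>\<^sub>M state_space I"
    using s by (subst (2) state_space_def, intro measurable_restrict_space2) (auto simp: space_state_action)
qed

lemma graph_measurable:
  assumes "\<phi> \<in> stationary_policies I"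
  shows "(\<lambda>x. (x, \<phi> x)) \<in> state_space I \<rightarrow>\<^sub>M step_space I"
  using assms unfolding step_space_def stationary_policies_def by (intro measurable_Pair) auto

lemma holding_borel: "mean_after I (holding I) \<in> borel_measurable (state_space I)"
  unfolding state_space_def using holding_continuous by (rule borel_measurable_continuous_on_restrict)

lemma add_step_measurable: "(\<lambda>p. fst p + snd p) \<in> step_space I \<rightarrow>\<^sub>M state_space I"
proof -
  have "fst \<in> borel_measurable (step_space I)" "snd \<in> borel_measurable (step_space I)"
    using measurable_fst[of "state_space I" "action_space I"] measurable_snd[of "state_space I" "action_space I"]
    by (auto simp: step_space_def state_space_def action_space_def measurable_restrict_space2_iff)
  then show ?thesis
    unfolding state_space_def
    by (intro measurable_restrict_space2 borel_measurable_add)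
      (auto simp: space_step actions_def intro: states_add)
qed

lemma cost_measurable: "(\<lambda>p. cost I (fst p) (snd p)) \<in> borel_measurable (step_space I)"
proof -
  have "snd \<in> borel_measurable (step_space I)"
    using measurable_snd[of "state_space I" "action_space I"]
    by (simp add: step_space_def action_space_def measurable_restrict_space2_iff)
  with measurable_compose[OF add_step_measurable holding_borel] show ?thesis
    unfolding cost_def by measurable
qed

lemma cost_nonneg:
  assumes "x \<in> states I" "a \<in> actions I"
  shows "cost I x a \<ge> 0"
proof -
  have "x + a \<in> states I" using assms by (auto simp: actions_def intro: states_add)
  then show ?thesis
    using holding_nonneg[of "x + a"] assms(2) setup_cost_pos unit_cost_pos
    by (auto simp: cost_def actions_def)
qed

text \<open>Both cost criteria depend on the policy only through this sequence. The comparison of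
  average and discounted costs of an arbitrary, possibly randomized policy thereby becomes a
  statement about sequences.\<close>

definition expected_cost :: "policy \<Rightarrow> real \<Rightarrow> nat \<Rightarrow> ennreal" where
  "expected_cost \<pi> x t = (\<integral>\<^sup>+\<eta>. ennreal (cost I (fst (\<eta> t)) (snd (\<eta> t))) \<partial>trajectory I \<pi> x)"

lemma coordinate_measurable:
  assumes "x \<in> states I" "\<pi> \<in> policies I"
  shows "(\<lambda>\<eta>. \<eta> t) \<in> trajectory I \<pi> x \<rightarrow>\<^sub>M step_space I"
  by (subst measurable_cong_sets[OF sets_trajectory[OF assms] refl]) (rule measurable_component_singleton, simp)

lemma space_trajectory:
  assumes "x \<in> states I" "\<pi> \<in> policies I" "\<eta> \<in> space (trajectory I \<pi> x)"
  shows "\<eta> t \<in> states I \<times> actions I"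
  using measurable_space[OF coordinate_measurable[OF assms(1,2)] assms(3)] by (simp add: space_step)

lemma disc_cost_eq_suminf:
  assumes "x \<in> states I" "\<pi> \<in> policies I" "0 \<le> \<alpha>"
  shows "disc_cost I \<alpha> \<pi> x = (\<Sum>t. ennreal (\<alpha> ^ t) * expected_cost \<pi> x t)"
proof -
  have m: "(\<lambda>\<eta>. cost I (fst (\<eta> t)) (snd (\<eta> t))) \<in> borel_measurable (trajectory I \<pi> x)" for t
    using measurable_compose[OF coordinate_measurable[OF assms(1,2)] cost_measurable] .
  have "disc_cost I \<alpha> \<pi> x = (\<Sum>t. \<integral>\<^sup>+\<eta>. ennreal (\<alpha> ^ t * cost I (fst (\<eta> t)) (snd (\<eta> t))) \<partial>trajectory I \<pi> x)"
    unfolding disc_cost_def using m by (intro nn_integral_suminf) measurable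
  also have "(\<lambda>t. \<integral>\<^sup>+\<eta>. ennreal (\<alpha> ^ t * cost I (fst (\<eta> t)) (snd (\<eta> t))) \<partial>trajectory I \<pi> x)
      = (\<lambda>t. ennreal (\<alpha> ^ t) * expected_cost \<pi> x t)"
    unfolding expected_cost_def using m assms(3)
    by (intro ext) (subst nn_integral_cmult[symmetric], simp, simp add: ennreal_mult')
  finally show ?thesis .
qed

lemma avg_cost_eq:
  assumes "x \<in> states I" "\<pi> \<in> policies I"
  shows "avg_cost I \<pi> x = limsup (\<lambda>N. (\<Sum>t<N. expected_cost \<pi> x t) / of_nat N)"
proof -
  have m: "(\<lambda>\<eta>. cost I (fst (\<eta> t)) (snd (\<eta> t))) \<in> borel_measurable (trajectory I \<pi> x)" for t
    using measurable_compose[OF coordinate_measurable[OF assms(1,2)] cost_measurable] .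
  then show ?thesis
    unfolding avg_cost_def expected_cost_def by (subst nn_integral_sum) auto
qed

end

section \<open>Abelian comparison of averages and discounted sums\<close>

lemma sum_power_le:
  fixes d :: "nat \<Rightarrow> real"
  assumes "0 \<le> \<beta>" "\<beta> \<le> 1" "\<And>n. (\<Sum>t<n. d t) \<le> B"
  shows "(\<Sum>t<n. \<beta> ^ t * d t) \<le> B"
proof -
  define T where "T n = (\<Sum>t<n. d t)" for n
  \<comment> \<open>Summation by parts: the weights \<open>(1 - \<beta>) * \<beta> ^ t\<close> for t
    < n together with \<open>\<beta> ^ n\<close> add up to 1, so the discounted sum is an average of
    partial sums.\<close>
  have "(\<Sum>t<n. \<beta> ^ t * d t) = (\<Sum>t<n. (1 - \<beta>) * \<beta> ^ t * T (Suc t)) + \<beta> ^ n * T n"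
    by (induction n) (simp_all add: T_def algebra_simps)
  also have "\<dots> \<le> (\<Sum>t<n. (1 - \<beta>) * \<beta> ^ t * B) + \<beta> ^ n * B"
    using assms by (intro add_mono sum_mono mult_left_mono) (auto simp: T_def simp del: sum.lessThan_Suc)
  also have "\<dots> = B"
    by (induction n) (simp_all add: algebra_simps)
  finally show ?thesis .
qed

text \<open>Once the averages stay below L, the partial sums are at most B + L n, with B the sum of
  the terms before that index. Subtracting L from each term and summing by parts yields the
  discounted bound. As B does not depend on \<beta>, it vanishes in the limit after multiplication
  by \<open>1 - \<beta>\<close>.\<close>

lemma disc_sum_le_of_limsup_avg:
  fixes c :: "nat \<Rightarrow> ennreal"
  assumes L: "limsup (\<lambda>N. (\<Sum>t<N. c t) / of_nat N) < ennreal L"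
  obtains B where "B \<ge> 0"
    "\<And>\<beta>. 0 \<le> \<beta> \<Longrightarrow> \<beta> < 1 \<Longrightarrow> (\<Sum>t. ennreal (\<beta> ^ t) * c t) \<le> ennreal (B + L / (1 - \<beta>))"
proof -
  have L0: "L > 0"
    using L by (metis ennreal_eq_0_iff not_less_zero not_le)
  obtain N0 where N0: "N0 > 0" "\<And>N. N \<ge> N0 \<Longrightarrow> (\<Sum>t<N. c t) / of_nat N < ennreal L"
  proof -
    have "\<forall>\<^sub>F N in sequentially. (\<Sum>t<N. c t) / of_nat N < ennreal L"
      using L by (rule Limsup_lessD)
    then obtain N1 where "\<And>N. N \<ge> N1 \<Longrightarrow> (\<Sum>t<N. c t) / of_nat N < ennreal L"
      by (auto simp: eventually_sequentially)
    then show ?thesis by (intro that[of "Suc N1"]) auto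
  qed
  have S: "(\<Sum>t<N. c t) \<le> ennreal (L * real N)" if "N \<ge> N0" for N
  proof -
    have N: "N > 0" using that N0(1) by simp
    have "(\<Sum>t<N. c t) = (\<Sum>t<N. c t) / of_nat N * of_nat N"
      using N by (simp add: ennreal_divide_times ennreal_times_divide mult_divide_eq_ennreal)
    also have "\<dots> \<le> ennreal L * of_nat N"
      using N0(2)[OF that] by (intro mult_right_mono) auto
    also have "\<dots> = ennreal (L * real N)"
      using L0 by (simp add: ennreal_mult ennreal_of_nat_eq_real_of_nat)
    finally show ?thesis .
  qed
  \<comment> \<open>An infinite term would make all later averages infinite; hence the rest can be
    computed in the reals.\<close>
  have fin: "c t < \<top>" for t
  proof -
    have "c t \<le> (\<Sum>t<max N0 (Suc t). c t)"
      by (rule member_le_sum) auto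
    also have "\<dots> \<le> ennreal (L * real (max N0 (Suc t)))" by (rule S) simp
    finally show ?thesis by (rule le_less_trans) simp
  qed
  define r where "r t = enn2real (c t)" for t
  have r: "c t = ennreal (r t)" "r t \<ge> 0" for t
    using fin[of t] by (auto simp: r_def)
  define B where "B = (\<Sum>t<N0. r t)"
  have B: "B \<ge> 0" unfolding B_def by (intro sum_nonneg r)
  have Sr: "(\<Sum>t<n. r t) \<le> B + L * real n" for n
  proof (cases "n \<ge> N0")
    case True
    have "ennreal (\<Sum>t<n. r t) \<le> ennreal (L * real n)"
      using S[OF True] by (simp add: r)
    then show ?thesis using B L0 by (subst (asm) ennreal_le_iff) auto
  next
    case False
    then have "(\<Sum>t<n. r t) \<le> B"
      unfolding B_def by (intro sum_mono2 r) auto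
    then show ?thesis using L0 by (simp add: add_increasing2)
  qed
  have "(\<Sum>t. ennreal (\<beta> ^ t) * c t) \<le> ennreal (B + L / (1 - \<beta>))" if \<beta>: "0 \<le> \<beta>" "\<beta> < 1" for \<beta>
  proof (rule suminf_le_const[OF summableI])
    fix n
    have "(\<Sum>t<n. \<beta> ^ t * (r t - L)) \<le> B"
      using \<beta> Sr by (intro sum_power_le) (auto simp: sum_subtractf algebra_simps)
    then have "(\<Sum>t<n. \<beta> ^ t * r t) \<le> B + L * (\<Sum>t<n. \<beta> ^ t)"
      by (simp add: algebra_simps sum_subtractf sum_distrib_left)
    also have "\<dots> \<le> B + L * (1 / (1 - \<beta>))"
    proof -
      have "(\<Sum>t<n. \<beta> ^ t) \<le> (\<Sum>t. \<beta> ^ t)"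
        using \<beta> by (intro sum_le_suminf summable_geometric) auto
      then have "(\<Sum>t<n. \<beta> ^ t) \<le> 1 / (1 - \<beta>)"
        using \<beta> by (simp add: suminf_geometric)
      then have "L * (\<Sum>t<n. \<beta> ^ t) \<le> L * (1 / (1 - \<beta>))"
        using L0 by (intro mult_left_mono) auto
      then show ?thesis by simp
    qed
    finally have "ennreal (\<Sum>t<n. \<beta> ^ t * r t) \<le> ennreal (B + L / (1 - \<beta>))"
      by (intro ennreal_leI) simp
    then show "(\<Sum>t<n. ennreal (\<beta> ^ t) * c t) \<le> ennreal (B + L / (1 - \<beta>))"
      using \<beta> r by (simp add: ennreal_mult[symmetric])
  qed
  then show ?thesis using B that by blast
qed

section \<open>Markov policies: expectations along trajectories and one-step equations\<close>

context inventory_model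
begin

lemma nn_integral_step_kernel_markov:
  assumes f: "\<And>t. f t \<in> stationary_policies I" and x0: "x0 \<in> states I"
    and F[measurable]: "F \<in> borel_measurable (step_space I)"
    and \<eta>: "\<eta> \<in> space (PiM {0..<t} (\<lambda>_. step_space I))"
  shows "(\<integral>\<^sup>+p. F p \<partial>step_kernel I (markov f) x0 t \<eta>) = (\<integral>\<^sup>+x. F (x, f t x) \<partial>next_state I x0 t \<eta>)"
proof -
  let ?N = "next_state I x0 t \<eta>"
  have sets_N: "sets ?N = sets (state_space I)" "?N \<in> space (prob_algebra (state_space I))"
    using measurable_space[OF next_state_measurable[OF x0] \<eta>] by (simp_all add: space_prob_algebra)
  have sp: "space ?N = states I"
    using sets_eq_imp_space_eq[OF sets_N(1)] by (simp add: space_state_action)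
  have g: "(\<lambda>x. return (step_space I) (x, f t x)) \<in> ?N \<rightarrow>\<^sub>M subprob_algebra (step_space I)"
    using measurable_compose[OF graph_measurable[OF f] return_measurable] sets_N(1)
    by (subst measurable_cong_sets[OF sets_N(1) refl]) simp
  have "markov f t \<eta> x \<bind> (\<lambda>a. return (step_space I) (x, a)) = return (step_space I) (x, f t x)"
    if x: "x \<in> states I" for x
  proof -
    have "f t x \<in> space (action_space I)"
      using action_measurable_state(3)[OF f x] by (simp add: space_state_action)
    moreover have "(\<lambda>a. return (step_space I) (x, a)) \<in> action_space I \<rightarrow>\<^sub>M subprob_algebra (step_space I)"
      using x unfolding step_space_def
      by (intro measurable_compose[OF measurable_Pair1' return_measurable]) (simp add: space_state_action)
    ultimately show ?thesis
      unfolding markov_def by (intro bind_return)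
  qed
  then have "step_kernel I (markov f) x0 t \<eta> = ?N \<bind> (\<lambda>x. return (step_space I) (x, f t x))"
    unfolding step_kernel_def by (intro bind_cong refl) (simp add: sp)
  then have "(\<integral>\<^sup>+p. F p \<partial>step_kernel I (markov f) x0 t \<eta>)
      = (\<integral>\<^sup>+x. \<integral>\<^sup>+p. F p \<partial>return (step_space I) (x, f t x) \<partial>?N)"
    using nn_integral_bind[OF F g] by simp
  also have "\<dots> = (\<integral>\<^sup>+x. F (x, f t x) \<partial>?N)"
    by (intro nn_integral_cong nn_integral_return F)
      (auto simp: sp space_step action_measurable_state(3)[OF f])
  finally show ?thesis .
qed

lemma nn_integral_trajectory_markov:
  assumes f: "\<And>t. f t \<in> stationary_policies I" and x0: "x0 \<in> states I"
    and F: "F \<in> borel_measurable (step_space I)"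
  shows "(\<integral>\<^sup>+\<eta>. F (\<eta> 0) \<partial>trajectory I (markov f) x0) = F (x0, f 0 x0)"
    and "(\<integral>\<^sup>+\<eta>. F (\<eta> (Suc t)) \<partial>trajectory I (markov f) x0)
      = (\<integral>\<^sup>+\<eta>. after (\<lambda>y. F (y, f (Suc t) y)) (fst (\<eta> t) + snd (\<eta> t)) \<partial>trajectory I (markov f) x0)"
proof -
  note \<pi> = markov_in_policies[of f, OF f]
  interpret IT: Ionescu_Tulcea "step_kernel I (markov f) x0" "\<lambda>_. step_space I"
    by (rule step_kernel_Ionescu_Tulcea[OF x0 \<pi>])
  interpret T: prob_space "trajectory I (markov f) x0"
    by (rule prob_space_trajectory[OF x0 \<pi>])
  have m: "(\<lambda>x. F (x, f t x)) \<in> borel_measurable (state_space I)" for t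
    using measurable_compose[OF graph_measurable[OF f] F] .
  have "(\<integral>\<^sup>+\<eta>. F (\<eta> t) \<partial>trajectory I (markov f) x0)
      = (\<integral>\<^sup>+\<eta>. \<integral>\<^sup>+x. F (x, f t x) \<partial>next_state I x0 t (restrict \<eta> {0..<t}) \<partial>trajectory I (markov f) x0)" for t
    unfolding trajectory_def
    by (subst IT.nn_integral_lim_step[OF F], intro nn_integral_cong nn_integral_step_kernel_markov[OF f x0 F])
      (auto simp: space_PiM PiE_iff)
  note step = this
  have "(\<integral>\<^sup>+x. F (x, f 0 x) \<partial>next_state I x0 0 \<eta>) = F (x0, f 0 x0)" for \<eta>
    unfolding next_state_def using m x0 by (simp add: nn_integral_return space_state_action)
  then show "(\<integral>\<^sup>+\<eta>. F (\<eta> 0) \<partial>trajectory I (markov f) x0) = F (x0, f 0 x0)"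
    unfolding step by (simp add: T.emeasure_space_1)
  have "(\<integral>\<^sup>+x. F (x, f (Suc t) x) \<partial>next_state I x0 (Suc t) (restrict \<eta> {0..<Suc t}))
      = after (\<lambda>y. F (y, f (Suc t) y)) (fst (\<eta> t) + snd (\<eta> t))"
    if "\<eta> \<in> space (trajectory I (markov f) x0)" for \<eta>
  proof -
    have y: "fst (\<eta> t) + snd (\<eta> t) \<in> states I"
      using space_trajectory[OF x0 \<pi> that, of t] by (auto simp: actions_def intro!: states_add)
    have "next_state I x0 (Suc t) (restrict \<eta> {0..<Suc t})
        = distr (omega I) (state_space I) (\<lambda>\<omega>. fst (\<eta> t) + snd (\<eta> t) - demand I 1 \<omega>)"
      unfolding next_state_def using demand_distr_state[OF y] by simp
    then show ?thesis
      using minus_demand1_measurable[OF y] m[of "Suc t"] unfolding after_def by (simp add: nn_integral_distr)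
  qed
  then show "(\<integral>\<^sup>+\<eta>. F (\<eta> (Suc t)) \<partial>trajectory I (markov f) x0)
      = (\<integral>\<^sup>+\<eta>. after (\<lambda>y. F (y, f (Suc t) y)) (fst (\<eta> t) + snd (\<eta> t)) \<partial>trajectory I (markov f) x0)"
    unfolding step[of "Suc t"] by (intro nn_integral_cong) simp
qed

definition step :: "(real \<Rightarrow> real) \<Rightarrow> (real \<Rightarrow> ennreal) \<Rightarrow> real \<Rightarrow> ennreal" where
  "step \<phi> \<psi> x = after \<psi> (x + \<phi> x)"

definition policy_cost :: "(real \<Rightarrow> real) \<Rightarrow> real \<Rightarrow> ennreal" where
  "policy_cost \<phi> x = ennreal (cost I x (\<phi> x))"

text \<open>The expectation of \<psi> at the state of time t, as a function of the initial state.
  The recursion peels off the last transition, since the trajectory is described by the law of each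
  step given its past.\<close>

primrec state_expectation ::
    "(nat \<Rightarrow> real \<Rightarrow> real) \<Rightarrow> nat \<Rightarrow> (real \<Rightarrow> ennreal) \<Rightarrow> real \<Rightarrow> ennreal" where
  "state_expectation f 0 \<psi> = \<psi>"
| "state_expectation f (Suc t) \<psi> = state_expectation f t (step (f t) \<psi>)"

lemma nn_integral_trajectory_eq:
  assumes f: "\<And>t. f t \<in> stationary_policies I" and x0: "x0 \<in> states I"
    and F: "F \<in> borel_measurable (step_space I)"
  shows "(\<integral>\<^sup>+\<eta>. F (\<eta> t) \<partial>trajectory I (markov f) x0) = state_expectation f t (\<lambda>y. F (y, f t y)) x0"
  using F
proof (induction t arbitrary: F)
  case 0
  then show ?case using nn_integral_trajectory_markov(1)[OF f x0] by simp
next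
  case (Suc t)
  have "(\<lambda>p. after (\<lambda>y. F (y, f (Suc t) y)) (fst p + snd p)) \<in> borel_measurable (step_space I)"
    by (intro measurable_compose[OF add_step_measurable after_measurable]
        measurable_compose[OF graph_measurable[OF f] Suc.prems])
  from Suc.IH[OF this] show ?case
    by (simp add: nn_integral_trajectory_markov(2)[OF f x0 Suc.prems] step_def[abs_def])
qed

lemma state_expectation_stationary:
  "state_expectation (\<lambda>_. \<phi>) t \<psi> = (step \<phi> ^^ t) \<psi>"
  by (induction t arbitrary: \<psi>) (simp_all add: funpow_swap1)

text \<open>The recursion removes transitions from the end, whereas a deviation concerns the
  beginning. For one action followed by a stationary policy the first transition can be pulled out
  after all.\<close>

lemma state_expectation_first_action:
  "state_expectation (case_nat (\<lambda>_. a) (\<lambda>_. \<phi>)) (Suc t) \<psi> x = after ((step \<phi> ^^ t) \<psi>) (x + a)"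
proof (induction t arbitrary: \<psi>)
  case 0
  show ?case by (simp add: step_def)
next
  case (Suc t)
  show ?case
    using Suc[of "step \<phi> \<psi>"] by (simp add: funpow_swap1)
qed

lemma cost_ennreal_measurable: "(\<lambda>p. ennreal (cost I (fst p) (snd p))) \<in> borel_measurable (step_space I)"
  using cost_measurable by measurable

lemma expected_cost_stationary:
  assumes "\<phi> \<in> stationary_policies I" "x \<in> states I"
  shows "expected_cost (stationary I \<phi>) x t = (step \<phi> ^^ t) (policy_cost \<phi>) x"
  unfolding expected_cost_def stationary_eq_markov
  using nn_integral_trajectory_eq[of "\<lambda>_. \<phi>", OF assms cost_ennreal_measurable]
  by (simp add: state_expectation_stationary policy_cost_def[abs_def])

lemma const_stationary: "a \<in> actions I \<Longrightarrow> (\<lambda>_. a) \<in> stationary_policies I"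
  unfolding stationary_policies_def by (rule measurable_const) (simp add: space_state_action)

lemma first_action_policy:
  assumes "\<phi> \<in> stationary_policies I" "a \<in> actions I"
  shows "case_nat (\<lambda>_. a) (\<lambda>_. \<phi>) t \<in> stationary_policies I"
  using assms const_stationary by (cases t) auto

lemma expected_cost_first_action:
  assumes "\<phi> \<in> stationary_policies I" "a \<in> actions I" "x \<in> states I"
  shows "expected_cost (markov (case_nat (\<lambda>_. a) (\<lambda>_. \<phi>))) x 0 = ennreal (cost I x a)"
    and "expected_cost (markov (case_nat (\<lambda>_. a) (\<lambda>_. \<phi>))) x (Suc t)
      = after ((step \<phi> ^^ t) (policy_cost \<phi>)) (x + a)"
  unfolding expected_cost_def
  using nn_integral_trajectory_eq[OF first_action_policy[OF assms(1,2)] assms(3) cost_ennreal_measurable]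
  by (simp_all add: state_expectation_first_action policy_cost_def[abs_def] del: state_expectation.simps(2))

lemma policy_cost_measurable:
  assumes "\<phi> \<in> stationary_policies I"
  shows "policy_cost \<phi> \<in> borel_measurable (state_space I)"
  using measurable_compose[OF graph_measurable[OF assms] cost_ennreal_measurable]
  by (simp add: policy_cost_def[abs_def])

lemma step_measurable:
  assumes "\<phi> \<in> stationary_policies I" "\<psi> \<in> borel_measurable (state_space I)"
  shows "step \<phi> \<psi> \<in> borel_measurable (state_space I)"
  using measurable_compose[OF action_measurable_state(1)[OF assms(1)] after_measurable[OF assms(2)]]
  by (simp add: step_def[abs_def])

lemma step_iterate_measurable:
  assumes "\<phi> \<in> stationary_policies I" "\<psi> \<in> borel_measurable (state_space I)"
  shows "(step \<phi> ^^ t) \<psi> \<in> borel_measurable (state_space I)"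
  by (induction t) (simp_all add: assms step_measurable)

lemma after_cong:
  assumes "y \<in> states I" "\<And>x. x \<in> states I \<Longrightarrow> x \<le> y \<Longrightarrow> \<psi> x = \<psi>' x"
  shows "after \<psi> y = after \<psi>' y"
  unfolding after_def using assms demand_states[of 1] demand_nonneg[of 1]
  by (intro nn_integral_cong assms) (auto intro: states_diff)

lemma after_mono:
  assumes "y \<in> states I" "\<And>x. x \<in> states I \<Longrightarrow> x \<le> y \<Longrightarrow> \<psi> x \<le> \<psi>' x"
  shows "after \<psi> y \<le> after \<psi>' y"
  unfolding after_def using assms demand_states[of 1] demand_nonneg[of 1]
  by (intro nn_integral_mono assms) (auto intro: states_diff)

lemma after_const: "after (\<lambda>_. c) y = c"
  by (simp add: after_def emeasure_space_1)

lemma after_measurable_omega: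
  assumes "\<psi> \<in> borel_measurable (state_space I)" "y \<in> states I"
  shows "(\<lambda>\<omega>. \<psi> (y - demand I 1 \<omega>)) \<in> borel_measurable (omega I)"
  using measurable_compose[OF minus_demand1_measurable[OF assms(2)] assms(1)] .

lemma after_disc_cost:
  assumes \<phi>: "\<phi> \<in> stationary_policies I" and y: "y \<in> states I" and \<alpha>: "0 \<le> \<alpha>"
  shows "(\<Sum>t. ennreal (\<alpha> ^ t) * after ((step \<phi> ^^ t) (policy_cost \<phi>)) y)
    = after (disc_cost I \<alpha> (stationary I \<phi>)) y"
proof -
  note m = step_iterate_measurable[OF \<phi> policy_cost_measurable[OF \<phi>]]
  have "after (disc_cost I \<alpha> (stationary I \<phi>)) y
      = after (\<lambda>x. \<Sum>t. ennreal (\<alpha> ^ t) * (step \<phi> ^^ t) (policy_cost \<phi>) x) y"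
    using stationary_in_policies[OF \<phi>] \<phi> \<alpha> y
    by (intro after_cong) (simp_all add: disc_cost_eq_suminf expected_cost_stationary)
  also have "\<dots> = (\<Sum>t. ennreal (\<alpha> ^ t) * after ((step \<phi> ^^ t) (policy_cost \<phi>)) y)"
    unfolding after_def using after_measurable_omega[OF m y]
    by (subst nn_integral_suminf) (simp_all add: nn_integral_cmult)
  finally show ?thesis ..
qed

text \<open>The hypotheses say that from the second period on the costs are those of \<phi> started
  from y minus a demand. This covers \<phi> itself as well as a deviation from \<phi> in the first
  period only.\<close>

lemma disc_cost_decompose:
  assumes \<phi>: "\<phi> \<in> stationary_policies I" and x: "x \<in> states I" and y: "y \<in> states I"
    and \<pi>: "\<pi> \<in> policies I" and \<alpha>: "0 \<le> \<alpha>"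
    and first: "expected_cost \<pi> x 0 = c"
    and later: "\<And>t. expected_cost \<pi> x (Suc t) = after ((step \<phi> ^^ t) (policy_cost \<phi>)) y"
  shows "disc_cost I \<alpha> \<pi> x = c + ennreal \<alpha> * after (disc_cost I \<alpha> (stationary I \<phi>)) y"
proof -
  let ?f = "\<lambda>t. ennreal (\<alpha> ^ t) * expected_cost \<pi> x t"
  let ?a = "\<lambda>t. ennreal (\<alpha> ^ t) * after ((step \<phi> ^^ t) (policy_cost \<phi>)) y"
  have "?f sums (suminf (\<lambda>t. ?f (Suc t)) + ?f 0)"
    by (intro sums_Suc summable_sums summableI)
  then have "suminf ?f = suminf (\<lambda>t. ?f (Suc t)) + ?f 0"
    by (rule sums_unique[symmetric])
  also have "(\<lambda>t. ?f (Suc t)) = (\<lambda>t. ennreal \<alpha> * ?a t)"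
    using \<alpha> by (simp add: later ennreal_mult mult.assoc)
  also have "suminf \<dots> = ennreal \<alpha> * suminf ?a"
    by (rule ennreal_suminf_cmult)
  finally show ?thesis
    using first by (simp add: disc_cost_eq_suminf[OF x \<pi> \<alpha>] after_disc_cost[OF \<phi> y \<alpha>] add.commute)
qed

lemma disc_cost_stationary:
  assumes "\<phi> \<in> stationary_policies I" "x \<in> states I" "0 \<le> \<alpha>"
  shows "disc_cost I \<alpha> (stationary I \<phi>) x
    = ennreal (cost I x (\<phi> x)) + ennreal \<alpha> * after (disc_cost I \<alpha> (stationary I \<phi>)) (x + \<phi> x)"
  using assms action_measurable_state(4)[OF assms(1,2)]
  by (intro disc_cost_decompose stationary_in_policies)
    (simp_all add: expected_cost_stationary policy_cost_def step_def)

lemma disc_value_le_disc_cost: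
  "\<pi> \<in> policies I \<Longrightarrow> disc_value I \<alpha> x \<le> disc_cost I \<alpha> \<pi> x"
  unfolding disc_value_def by (rule INF_lower)

lemma disc_optimalD:
  assumes "disc_optimal I \<alpha> \<phi>"
  shows "\<phi> \<in> stationary_policies I"
    and "x \<in> states I \<Longrightarrow> disc_cost I \<alpha> (stationary I \<phi>) x = disc_value I \<alpha> x"
  using assms by (auto simp: disc_optimal_def)

text \<open>The value function is the cost of the optimal stationary policy, so the recursion for
  that cost is the optimality equation with the optimal action inserted.\<close>

lemma disc_value_eq:
  assumes opt: "disc_optimal I \<alpha> \<phi>" and x: "x \<in> states I" and \<alpha>: "0 \<le> \<alpha>"
  shows "disc_value I \<alpha> x
    = ennreal (cost I x (\<phi> x)) + ennreal \<alpha> * after (disc_value I \<alpha>) (x + \<phi> x)"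
proof -
  note \<phi> = disc_optimalD(1)[OF opt]
  have "after (disc_cost I \<alpha> (stationary I \<phi>)) (x + \<phi> x) = after (disc_value I \<alpha>) (x + \<phi> x)"
    using disc_optimalD(2)[OF opt] action_measurable_state(4)[OF \<phi> x] by (intro after_cong)
  then show ?thesis
    using disc_cost_stationary[OF \<phi> x \<alpha>] disc_optimalD(2)[OF opt x] by simp
qed

text \<open>Taking \<open>a\<close> once and following the optimal policy afterwards is itself a
  policy, and its cost is the right-hand side.\<close>

lemma disc_value_le_first_action:
  assumes opt: "disc_optimal I \<alpha> \<phi>" and x: "x \<in> states I" and a: "a \<in> actions I" and \<alpha>: "0 \<le> \<alpha>"
  shows "disc_value I \<alpha> x \<le> ennreal (cost I x a) + ennreal \<alpha> * after (disc_value I \<alpha>) (x + a)"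
proof -
  note \<phi> = disc_optimalD(1)[OF opt]
  note \<pi> = markov_in_policies[of "case_nat (\<lambda>_. a) (\<lambda>_. \<phi>)", OF first_action_policy[OF \<phi> a]]
  have y: "x + a \<in> states I" using x a by (auto simp: actions_def intro: states_add)
  have "after (disc_cost I \<alpha> (stationary I \<phi>)) (x + a) = after (disc_value I \<alpha>) (x + a)"
    using disc_optimalD(2)[OF opt] y by (intro after_cong)
  then have "disc_cost I \<alpha> (markov (case_nat (\<lambda>_. a) (\<lambda>_. \<phi>))) x
      = ennreal (cost I x a) + ennreal \<alpha> * after (disc_value I \<alpha>) (x + a)"
    using disc_cost_decompose[OF \<phi> x y \<pi> \<alpha> expected_cost_first_action[OF \<phi> a x]] by simp
  then show ?thesis
    using disc_value_le_disc_cost[OF \<pi>, of \<alpha> x] by simp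
qed

text \<open>An infimum over all policies need not be measurable; the optimal stationary policy
  identifies it with a series of measurable functions.\<close>

lemma disc_value_measurable:
  assumes opt: "disc_optimal I \<alpha> \<phi>" and \<alpha>: "0 \<le> \<alpha>"
  shows "disc_value I \<alpha> \<in> borel_measurable (state_space I)"
proof -
  note \<phi> = disc_optimalD(1)[OF opt]
  have "(\<lambda>x. \<Sum>t. ennreal (\<alpha> ^ t) * (step \<phi> ^^ t) (policy_cost \<phi>) x) \<in> borel_measurable (state_space I)"
    using step_iterate_measurable[OF \<phi> policy_cost_measurable[OF \<phi>]] by measurable
  moreover have "disc_value I \<alpha> x = (\<Sum>t. ennreal (\<alpha> ^ t) * (step \<phi> ^^ t) (policy_cost \<phi>) x)"
    if "x \<in> space (state_space I)" for x
    using that disc_optimalD(2)[OF opt] stationary_in_policies[OF \<phi>] \<phi> \<alpha>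
    by (simp add: space_state_action disc_cost_eq_suminf[symmetric] expected_cost_stationary[symmetric])
  ultimately show ?thesis by (subst measurable_cong)
qed

subsection \<open>Bounds on discounted and average costs\<close>

abbreviation (input) "c \<equiv> unit_cost I"
abbreviation (input) "K \<equiv> setup_cost I"
abbreviation (input) "G \<equiv> mean_after I (holding I)"
abbreviation (input) "\<mu> \<equiv> mean_demand I"
abbreviation (input) "X \<equiv> states I"
abbreviation (input) "D \<equiv> demand I 1"

lemma demand1_nonneg: "\<omega> \<in> space (omega I) \<Longrightarrow> D \<omega> \<ge> 0"
  using demand_nonneg[of 1] by simp

lemma minus_demand1_state: "\<omega> \<in> space (omega I) \<Longrightarrow> y \<in> X \<Longrightarrow> y - D \<omega> \<in> X"
  using demand_states[of 1] by (auto intro: states_diff)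

lemma closed_states: "closed X"
  using states by (elim disjE) simp_all

lemma state_below: "\<exists>x\<in>X. x < y"
  using states
proof (elim disjE)
  assume "X = \<int>"
  moreover have "real_of_int (\<lfloor>y\<rfloor> - 1) < y" by linarith
  ultimately show ?thesis by (metis Ints_of_int)
qed (auto intro: lt_ex)

lemma mean_demand_nonneg: "\<mu> \<ge> 0"
  unfolding mean_demand_def by (intro integral_nonneg_AE AE_I2 demand1_nonneg)

lemma compact_states: "compact (X \<inter> {a..b})"
  using closed_states by (simp add: closed_Int_compact)

lemma holding_bounded: "\<exists>B. \<forall>x\<in>X. a \<le> x \<longrightarrow> x \<le> b \<longrightarrow> G x \<le> B"
proof -
  have "compact (G ` (X \<inter> {a..b}))"
    by (intro compact_continuous_image continuous_on_subset[OF holding_continuous] compact_states) auto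
  then have "bdd_above (G ` (X \<inter> {a..b}))"
    by (intro bounded_imp_bdd_above compact_imp_bounded)
  then obtain B where "\<And>x. x \<in> X \<inter> {a..b} \<Longrightarrow> G x \<le> B"
    unfolding bdd_above_def by blast
  then show ?thesis by auto
qed

lemma holding_large: "\<exists>B\<ge>0. \<forall>x\<in>X. \<bar>x\<bar> > B \<longrightarrow> G x > L"
proof -
  have "\<forall>\<^sub>F x in inf at_infinity (principal X). G x > L"
    using holding_coercive by (simp add: filterlim_at_top_dense)
  then obtain B where B: "\<And>x. B \<le> norm x \<Longrightarrow> x \<in> X \<Longrightarrow> G x > L"
    by (auto simp: eventually_inf_principal eventually_at_infinity)
  then show ?thesis by (intro exI[of _ "max 0 B"]) auto
qed

lemma after_ennreal:
  assumes "\<And>x. x \<in> X \<Longrightarrow> x \<le> y \<Longrightarrow> u x \<ge> 0" "y \<in> X" "integrable (omega I) (\<lambda>\<omega>. u (y - D \<omega>))"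
  shows "after (\<lambda>x. ennreal (u x)) y = ennreal (mean_after I u y)"
  unfolding after_def mean_after_def
  using assms minus_demand1_state demand1_nonneg
  by (intro nn_integral_eq_integral AE_I2) auto

lemma sS_policy_stationary:
  assumes "s \<in> X" "S \<in> X" "s \<le> S"
  shows "sS_policy s S \<in> stationary_policies I"
  unfolding stationary_policies_def action_space_def
proof (rule measurable_restrict_space2)
  show "sS_policy s S \<in> space (state_space I) \<rightarrow> actions I"
    using assms zero_state by (auto simp: sS_policy_def space_state_action actions_def intro: states_diff)
  have "(\<lambda>x. x) \<in> borel_measurable (state_space I)"
    unfolding state_space_def by (rule measurable_restrict_space1) simp
  note [measurable] = this
  show "sS_policy s S \<in> borel_measurable (state_space I)"
    unfolding sS_policy_def by measurable
qed

text \<open>Ordering up to \<open>0\<close> in every period costs a bounded amount per period.\<close>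

lemma disc_value_bound:
  "\<exists>b\<ge>0. \<forall>\<alpha>\<in>{0..<1}. \<forall>x\<in>X. x \<le> R \<longrightarrow>
     disc_value I \<alpha> x \<le> ennreal (b / (1 - \<alpha>) + c * max 0 (- x))"
proof -
  define R' where "R' = max R 0"
  let ?\<phi> = "sS_policy 0 0"
  have \<phi>: "?\<phi> \<in> stationary_policies I"
    using zero_state by (intro sS_policy_stationary) auto
  obtain B where B: "\<And>x. x \<in> X \<Longrightarrow> 0 \<le> x \<Longrightarrow> x \<le> R' \<Longrightarrow> G x \<le> B"
    using holding_bounded[of 0 R'] by auto
  have "B \<ge> 0"
    using B[OF zero_state] holding_nonneg[OF zero_state] by (simp add: R'_def)
  \<comment> \<open>After the first period the state is a level in \<open>[0, R']\<close> minus a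
    demand, so the order is at most that demand and has mean at most \<open>\<mu>\<close>; the
    holding cost is paid at a level in \<open>[0, R']\<close>, where B bounds it.\<close>
  define b where "b = K + B + c * \<mu>"
  have b: "b \<ge> 0" "K + B \<ge> 0" "K + B \<le> b"
    using \<open>B \<ge> 0\<close> setup_cost_pos unit_cost_pos mean_demand_nonneg by (simp_all add: b_def)
  have y: "x + ?\<phi> x = max x 0" for x by (simp add: sS_policy_def)
  have y_state: "max x 0 \<in> X" if "x \<in> X" for x
    using that zero_state by (simp add: max_def)
  have cost: "policy_cost ?\<phi> x \<le> ennreal (K + B + c * max 0 (- x))" if "x \<in> X" "x \<le> R'" for x
    unfolding policy_cost_def cost_def y
    using B[OF y_state[OF that(1)]] that setup_cost_pos unit_cost_pos
    by (intro ennreal_leI) (auto simp: sS_policy_def R'_def max_def)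
  have step1: "step ?\<phi> (policy_cost ?\<phi>) x \<le> ennreal b" if x: "x \<in> X" "x \<le> R'" for x
  proof -
    have "step ?\<phi> (policy_cost ?\<phi>) x \<le> after (\<lambda>z. ennreal (K + B + c * max 0 (- z))) (max x 0)"
      unfolding step_def y using x by (intro after_mono cost y_state) (auto simp: R'_def)
    also have "\<dots> \<le> (\<integral>\<^sup>+\<omega>. ennreal (K + B + c * D \<omega>) \<partial>omega I)"
      unfolding after_def using unit_cost_pos demand1_nonneg
      by (intro nn_integral_mono ennreal_leI add_left_mono mult_left_mono) (auto simp: max_def)
    also have "\<dots> = ennreal (\<integral>\<omega>. K + B + c * D \<omega> \<partial>omega I)"
      using demand_integrable demand1_nonneg b unit_cost_pos
      by (intro nn_integral_eq_integral) auto
    also have "(\<integral>\<omega>. K + B + c * D \<omega> \<partial>omega I) = b"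
      using demand_integrable by (simp add: b_def mean_demand_def prob_space)
    finally show ?thesis .
  qed
  have iter: "(step ?\<phi> ^^ Suc t) (policy_cost ?\<phi>) x \<le> ennreal b" if x: "x \<in> X" "x \<le> R'" for x t
    using x
  proof (induction t arbitrary: x)
    case 0 then show ?case using step1 by simp
  next
    case (Suc t)
    have "(step ?\<phi> ^^ Suc (Suc t)) (policy_cost ?\<phi>) x
        = after ((step ?\<phi> ^^ Suc t) (policy_cost ?\<phi>)) (max x 0)"
      by (simp add: step_def y)
    also have "\<dots> \<le> after (\<lambda>_. ennreal b) (max x 0)"
      using Suc.prems by (intro after_mono y_state Suc.IH) (auto simp: R'_def)
    finally show ?case by (simp add: after_const)
  qed
  have "disc_value I \<alpha> x \<le> ennreal ((K + B + b) / (1 - \<alpha>) + c * max 0 (- x))"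
    if \<alpha>: "\<alpha> \<in> {0..<1}" and x: "x \<in> X" "x \<le> R" for \<alpha> x
  proof -
    have xR: "x \<le> R'" using x by (simp add: R'_def)
    have nn: "0 \<le> K + B + c * max 0 (- x)" using b unit_cost_pos by simp
    have "disc_value I \<alpha> x \<le> disc_cost I \<alpha> (stationary I ?\<phi>) x"
      by (intro disc_value_le_disc_cost stationary_in_policies \<phi>)
    also have "\<dots> = (\<Sum>t. ennreal (\<alpha> ^ t) * (step ?\<phi> ^^ t) (policy_cost ?\<phi>) x)"
      using \<alpha> x \<phi> by (simp add: disc_cost_eq_suminf stationary_in_policies expected_cost_stationary)
    also have "\<dots> \<le> ennreal ((K + B + b) / (1 - \<alpha>) + c * max 0 (- x))"
    proof (rule suminf_le_const[OF summableI])
      fix n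
      have "(\<Sum>t<n. ennreal (\<alpha> ^ t) * (step ?\<phi> ^^ t) (policy_cost ?\<phi>) x)
          \<le> ennreal ((K + B + c * max 0 (- x)) + (\<Sum>t<n. \<alpha> ^ t) * b)"
      proof (induction n)
        case 0 then show ?case by simp
      next
        case (Suc n)
        show ?case
        proof (cases n)
          case 0
          then show ?thesis
            using cost[OF x(1) xR] b
            by simp (rule order_trans, assumption, rule ennreal_leI, simp)
        next
          case (Suc m)
          have "ennreal (\<alpha> ^ n) * (step ?\<phi> ^^ n) (policy_cost ?\<phi>) x \<le> ennreal (\<alpha> ^ n) * ennreal b"
            unfolding Suc by (intro mult_left_mono iter x xR) simp
          also have "\<dots> = ennreal (\<alpha> ^ n * b)"
            using \<alpha> by (simp add: ennreal_mult')
          finally have "(\<Sum>t<Suc n. ennreal (\<alpha> ^ t) * (step ?\<phi> ^^ t) (policy_cost ?\<phi>) x)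
              \<le> ennreal ((K + B + c * max 0 (- x)) + (\<Sum>t<n. \<alpha> ^ t) * b) + ennreal (\<alpha> ^ n * b)"
            using Suc.IH by (simp add: add_mono)
          also have "\<dots> = ennreal ((K + B + c * max 0 (- x)) + (\<Sum>t<n. \<alpha> ^ t) * b + \<alpha> ^ n * b)"
            using \<alpha> b(1) nn by (intro ennreal_plus[symmetric] add_nonneg_nonneg[OF nn] mult_nonneg_nonneg sum_nonneg) auto
          finally show ?thesis by (simp add: algebra_simps)
        qed
      qed
      also have "\<dots> \<le> ennreal ((K + B + b) / (1 - \<alpha>) + c * max 0 (- x))"
      proof (rule ennreal_leI)
        have "(\<Sum>t<n. \<alpha> ^ t) \<le> (\<Sum>t. \<alpha> ^ t)"
          using \<alpha> by (intro sum_le_suminf summable_geometric) auto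
        then have "(\<Sum>t<n. \<alpha> ^ t) * b \<le> 1 / (1 - \<alpha>) * b"
          using \<alpha> b by (intro mult_right_mono) (auto simp: suminf_geometric)
        moreover have "(K + B) * 1 \<le> (K + B) * (1 / (1 - \<alpha>))"
          using b \<alpha> by (intro mult_left_mono) auto
        ultimately show "K + B + c * max 0 (- x) + (\<Sum>t<n. \<alpha> ^ t) * b \<le> (K + B + b) / (1 - \<alpha>) + c * max 0 (- x)"
          by (simp add: add_divide_distrib)
      qed
      finally show "(\<Sum>t<n. ennreal (\<alpha> ^ t) * (step ?\<phi> ^^ t) (policy_cost ?\<phi>) x) \<le> \<dots>" .
    qed
    finally show ?thesis .
  qed
  moreover have "K + B + b \<ge> 0" using b by simp
  ultimately show ?thesis by blast
qed

text \<open>Iterating the equation telescopes: the costs of N periods plus the expected value of u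
  at time N equal \<open>N * w + u x\<close>. The term with u at time N is nonnegative and may be
  dropped. Computing in \<open>ennreal\<close> avoids any question of integrability for the
  iterates.\<close>

lemma avg_cost_le:
  assumes \<phi>: "\<phi> \<in> stationary_policies I" and w: "w \<ge> 0"
    and u: "u \<in> borel_measurable (state_space I)" "\<And>x. x \<in> X \<Longrightarrow> u x \<ge> 0"
      "\<And>x. x \<in> X \<Longrightarrow> integrable (omega I) (\<lambda>\<omega>. u (x - D \<omega>))"
    and eq: "\<And>x. x \<in> X \<Longrightarrow> cost I x (\<phi> x) + mean_after I u (x + \<phi> x) = w + u x"
    and x: "x \<in> X"
  shows "avg_cost I (stationary I \<phi>) x \<le> ennreal w"
proof -
  let ?U = "\<lambda>x. ennreal (u x)"
  have mean: "mean_after I u y \<ge> 0" if "y \<in> X" for y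
    unfolding mean_after_def by (intro integral_nonneg_AE AE_I2 u(2) minus_demand1_state that)
  have one: "policy_cost \<phi> y + step \<phi> ?U y = ennreal w + ?U y" if y: "y \<in> X" for y
  proof -
    note y' = action_measurable_state(4)[OF \<phi> y]
    have "step \<phi> ?U y = ennreal (mean_after I u (y + \<phi> y))"
      unfolding step_def using u y' by (intro after_ennreal) auto
    then show ?thesis
      using eq[OF y] cost_nonneg[OF y action_measurable_state(3)[OF \<phi> y]] mean[OF y'] w u(2)[OF y]
      unfolding policy_cost_def by (simp add: ennreal_plus[symmetric] del: ennreal_plus)
  qed
  have U: "?U \<in> borel_measurable (state_space I)" using u(1) by measurable
  have add: "(step \<phi> ^^ t) (\<lambda>x. \<psi> x + \<psi>' x) y = (step \<phi> ^^ t) \<psi> y + (step \<phi> ^^ t) \<psi>' y"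
    if "\<psi> \<in> borel_measurable (state_space I)" "\<psi>' \<in> borel_measurable (state_space I)" "y \<in> X" for \<psi> \<psi>' t y
    using that
  proof (induction t arbitrary: y)
    case (Suc t)
    note y' = action_measurable_state(4)[OF \<phi> Suc.prems(3)]
    have "(step \<phi> ^^ Suc t) (\<lambda>x. \<psi> x + \<psi>' x) y
        = after (\<lambda>x. (step \<phi> ^^ t) \<psi> x + (step \<phi> ^^ t) \<psi>' x) (y + \<phi> y)"
      unfolding funpow.simps o_apply step_def[of \<phi> "(step \<phi> ^^ t) \<psi>" for \<psi>]
      using Suc.IH[OF Suc.prems(1,2)] y' by (intro after_cong) auto
    also have "\<dots> = (step \<phi> ^^ Suc t) \<psi> y + (step \<phi> ^^ Suc t) \<psi>' y"
      using after_measurable_omega[OF step_iterate_measurable[OF \<phi> Suc.prems(1)] y']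
        after_measurable_omega[OF step_iterate_measurable[OF \<phi> Suc.prems(2)] y']
      by (simp add: step_def after_def nn_integral_add)
    finally show ?case .
  qed simp
  have cong: "(step \<phi> ^^ t) \<psi> y = (step \<phi> ^^ t) \<psi>' y" if "\<And>z. z \<in> X \<Longrightarrow> \<psi> z = \<psi>' z" "y \<in> X" for \<psi> \<psi>' t y
    using that(2)
  proof (induction t arbitrary: y)
    case (Suc t)
    then show ?case
      unfolding funpow.simps o_apply step_def[of \<phi> "(step \<phi> ^^ t) \<psi>" for \<psi>]
      using action_measurable_state(4)[OF \<phi>] by (intro after_cong) auto
  qed (use that in simp)
  have const: "(step \<phi> ^^ t) (\<lambda>_. a) = (\<lambda>_. a)" for t a
    by (induction t) (simp_all add: step_def[abs_def] after_const)
  have rec: "(step \<phi> ^^ t) (policy_cost \<phi>) x + (step \<phi> ^^ Suc t) ?U x = ennreal w + (step \<phi> ^^ t) ?U x" for t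
  proof -
    have "(step \<phi> ^^ t) (policy_cost \<phi>) x + (step \<phi> ^^ Suc t) ?U x
        = (step \<phi> ^^ t) (\<lambda>y. policy_cost \<phi> y + step \<phi> ?U y) x"
      by (subst add[OF policy_cost_measurable[OF \<phi>] step_measurable[OF \<phi> U] x]) (simp add: funpow_swap1)
    also have "\<dots> = (step \<phi> ^^ t) (\<lambda>y. ennreal w + ?U y) x"
      by (intro cong one x)
    also have "\<dots> = ennreal w + (step \<phi> ^^ t) ?U x"
      by (subst add[OF _ U x]) (simp_all add: const)
    finally show ?thesis .
  qed
  have sum: "(\<Sum>t<N. (step \<phi> ^^ t) (policy_cost \<phi>) x) + (step \<phi> ^^ N) ?U x = of_nat N * ennreal w + ?U x" for N
  proof (induction N)
    case (Suc N)
    have "(\<Sum>t<Suc N. (step \<phi> ^^ t) (policy_cost \<phi>) x) + (step \<phi> ^^ Suc N) ?U x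
        = (\<Sum>t<N. (step \<phi> ^^ t) (policy_cost \<phi>) x) + ((step \<phi> ^^ N) (policy_cost \<phi>) x + (step \<phi> ^^ Suc N) ?U x)"
      by (simp add: add.assoc)
    also have "\<dots> = ennreal w + ((\<Sum>t<N. (step \<phi> ^^ t) (policy_cost \<phi>) x) + (step \<phi> ^^ N) ?U x)"
      unfolding rec by (simp add: add_ac)
    also have "\<dots> = of_nat (Suc N) * ennreal w + ?U x"
      unfolding Suc.IH by (simp add: algebra_simps)
    finally show ?case .
  qed simp
  have le: "(\<Sum>t<N. expected_cost (stationary I \<phi>) x t) / of_nat N \<le> ennreal (w + u x / real N)" if "N > 0" for N
  proof -
    have "(\<Sum>t<N. expected_cost (stationary I \<phi>) x t) = (\<Sum>t<N. (step \<phi> ^^ t) (policy_cost \<phi>) x)"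
      by (simp add: expected_cost_stationary[OF \<phi> x])
    also have "\<dots> \<le> (\<Sum>t<N. (step \<phi> ^^ t) (policy_cost \<phi>) x) + (step \<phi> ^^ N) ?U x"
      by simp
    also have "\<dots> = of_nat N * ennreal w + ?U x"
      by (rule sum)
    also have "\<dots> = ennreal (real N * w + u x)"
      using w u(2)[OF x] by (simp add: ennreal_mult ennreal_of_nat_eq_real_of_nat)
    finally have "(\<Sum>t<N. expected_cost (stationary I \<phi>) x t) / of_nat N \<le> ennreal (real N * w + u x) / of_nat N"
      by (rule divide_right_mono_ennreal)
    also have "\<dots> = ennreal ((real N * w + u x) / real N)"
      using that w u(2)[OF x]
      by (simp add: ennreal_of_nat_eq_real_of_nat divide_ennreal del: ennreal_plus)
    also have "(real N * w + u x) / real N = w + u x / real N"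
      using that by (simp add: field_simps)
    finally show ?thesis .
  qed
  have "avg_cost I (stationary I \<phi>) x = limsup (\<lambda>N. (\<Sum>t<N. expected_cost (stationary I \<phi>) x t) / of_nat N)"
    by (rule avg_cost_eq[OF x stationary_in_policies[OF \<phi>]])
  also have "\<dots> \<le> limsup (\<lambda>N. ennreal (w + u x / real N))"
    using le by (intro Limsup_mono) (auto simp: eventually_sequentially intro!: exI[of _ 1])
  also have "\<dots> = ennreal w"
  proof (intro lim_imp_Limsup tendsto_ennrealI)
    have "(\<lambda>N. w + u x / real N) \<longlonglongrightarrow> w + 0"
      by (intro tendsto_intros lim_const_over_n)
    then show "(\<lambda>N. w + u x / real N) \<longlonglongrightarrow> w" by simp
  qed simp
  finally show ?thesis .
qed

text \<open>The Abelian half of the comparison: by definition no discounted cost lies below the minimal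
  discounted value, whatever the policy.\<close>

lemma avg_cost_ge:
  assumes \<pi>: "\<pi> \<in> policies I" and x: "x \<in> X"
    and \<beta>: "\<And>n. 0 \<le> \<beta> n" "\<And>n. \<beta> n < 1" "\<beta> \<longlonglongrightarrow> 1"
    and m: "\<And>n. min_value I (\<beta> n) = ennreal (m n)" "\<And>n. 0 \<le> m n"
    and w: "(\<lambda>n. (1 - \<beta> n) * m n) \<longlonglongrightarrow> w"
  shows "ennreal w \<le> avg_cost I \<pi> x"
proof (rule ccontr)
  assume "\<not> ennreal w \<le> avg_cost I \<pi> x"
  then obtain l where l: "avg_cost I \<pi> x < l" "l < ennreal w"
    using dense by (metis not_le)
  then obtain L where L: "l = ennreal L" "L \<ge> 0"
    by (cases l) auto
  have Lw: "L < w"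
    using l L by (metis ennreal_leI not_le)
  obtain B where B: "B \<ge> 0" "\<And>\<beta>. 0 \<le> \<beta> \<Longrightarrow> \<beta> < 1 \<Longrightarrow>
      (\<Sum>t. ennreal (\<beta> ^ t) * expected_cost \<pi> x t) \<le> ennreal (B + L / (1 - \<beta>))"
    using disc_sum_le_of_limsup_avg[of "expected_cost \<pi> x" L] l(1) avg_cost_eq[OF x \<pi>] L by auto
  \<comment> \<open>B is the same for all n, so its contribution tends to zero and the limit of the
    left side is at most L.\<close>
  have "(1 - \<beta> n) * m n \<le> (1 - \<beta> n) * B + L" for n
  proof -
    have "ennreal (m n) \<le> disc_value I (\<beta> n) x"
      unfolding m(1)[symmetric] min_value_def using x by (rule INF_lower)
    also have "\<dots> \<le> disc_cost I (\<beta> n) \<pi> x"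
      by (rule disc_value_le_disc_cost[OF \<pi>])
    also have "\<dots> \<le> ennreal (B + L / (1 - \<beta> n))"
      using disc_cost_eq_suminf[OF x \<pi> \<beta>(1)] B(2)[OF \<beta>(1) \<beta>(2)] by simp
    finally have "m n \<le> B + L / (1 - \<beta> n)"
      using B(1) L(2) \<beta>(2)[of n] by (subst (asm) ennreal_le_iff) (auto intro!: add_nonneg_nonneg)
    then have "(1 - \<beta> n) * m n \<le> (1 - \<beta> n) * (B + L / (1 - \<beta> n))"
      using \<beta>(2)[of n] by (intro mult_left_mono) auto
    also have "\<dots> = (1 - \<beta> n) * B + L"
      using \<beta>(2)[of n] by (simp add: distrib_left)
    finally show ?thesis .
  qed
  moreover have "(\<lambda>n. (1 - \<beta> n) * B + L) \<longlonglongrightarrow> (1 - 1) * B + L"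
    by (intro tendsto_intros \<beta>(3))
  ultimately have "w \<le> (1 - 1) * B + L"
    using w by (intro LIMSEQ_le) auto
  then show False using Lw by simp
qed

subsection \<open>The discounted problem with an optimal (s, S) policy\<close>

definition real_value :: "real \<Rightarrow> real \<Rightarrow> real" where
  "real_value \<alpha> x = enn2real (disc_value I \<alpha> x)"

text \<open>Adding \<open>c x\<close> to the value function removes the unit cost: the remaining problem has only the
  set-up cost and the one-period cost \<open>base\<close>, which is \<open>E[h\<^sub>\<alpha>(y - D)]\<close>. The functions below are
  taken relative to the optimal value \<open>level\<close> of this problem, attained at \<open>S\<close>.\<close>

definition level :: "real \<Rightarrow> real \<Rightarrow> real" where
  "level \<alpha> S = real_value \<alpha> S + c * S"

definition excess :: "real \<Rightarrow> real \<Rightarrow> real \<Rightarrow> real" where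
  "excess \<alpha> S x = real_value \<alpha> x + c * x - level \<alpha> S"

definition base :: "real \<Rightarrow> real \<Rightarrow> real" where
  "base \<alpha> y = G y + (1 - \<alpha>) * c * y + \<alpha> * c * \<mu>"

definition bottom :: "real \<Rightarrow> real" where
  "bottom \<alpha> = enn2real (min_value I \<alpha>)"

definition net :: "real \<Rightarrow> real \<Rightarrow> real \<Rightarrow> real" where
  "net \<alpha> S y = base \<alpha> y - (1 - \<alpha>) * level \<alpha> S"

text \<open>The cost of holding stock y without ordering, relative to \<open>level\<close>. A part
  \<alpha> of \<open>level\<close> is subtracted inside the expectation, which leaves the factor
  \<open>1 - \<alpha>\<close> in \<open>net\<close>.\<close>

definition order_excess :: "real \<Rightarrow> real \<Rightarrow> real \<Rightarrow> real" where
  "order_excess \<alpha> S y = net \<alpha> S y + \<alpha> * mean_after I (excess \<alpha> S) y"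

text \<open>One period leads from y only to states below y, and the demand has a finite mean, so
  linear growth towards minus infinity is integrable.\<close>

lemma integrable_le_demand:
  assumes "u \<in> borel_measurable (state_space I)" "y \<in> X"
    and "\<And>x. x \<in> X \<Longrightarrow> x \<le> y \<Longrightarrow> \<bar>u x\<bar> \<le> a + b * \<bar>x\<bar>" "b \<ge> 0"
  shows "integrable (omega I) (\<lambda>\<omega>. u (y - D \<omega>))"
proof (rule Bochner_Integration.integrable_bound)
  show "integrable (omega I) (\<lambda>\<omega>. a + b * (\<bar>y\<bar> + D \<omega>))"
    using demand_integrable by simp
  show "(\<lambda>\<omega>. u (y - D \<omega>)) \<in> borel_measurable (omega I)"
    by (rule after_measurable_omega) fact+
  show "AE \<omega> in omega I. norm (u (y - D \<omega>)) \<le> norm (a + b * (\<bar>y\<bar> + D \<omega>))"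
  proof (rule AE_I2)
    fix \<omega> assume \<omega>: "\<omega> \<in> space (omega I)"
    have "\<bar>u (y - D \<omega>)\<bar> \<le> a + b * \<bar>y - D \<omega>\<bar>"
      using assms(2,3) minus_demand1_state[OF \<omega>] demand1_nonneg[OF \<omega>] by simp
    also have "\<dots> \<le> a + b * (\<bar>y\<bar> + D \<omega>)"
      using demand1_nonneg[OF \<omega>] assms(4) by (intro add_left_mono mult_left_mono) auto
    finally show "norm (u (y - D \<omega>)) \<le> norm (a + b * (\<bar>y\<bar> + D \<omega>))"
      by simp
  qed
qed

end

locale discounted_sS = inventory_model +
  fixes \<alpha> s S :: real
  assumes discount: "0 < \<alpha>" "\<alpha> < 1"
    and levels: "s \<in> states I" "S \<in> states I" "s \<le> S"
    and opt: "disc_optimal I \<alpha> (sS_policy s S)"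
begin

abbreviation "v \<equiv> real_value \<alpha>"
abbreviation "M \<equiv> level \<alpha> S"
abbreviation "e \<equiv> excess \<alpha> S"
abbreviation "g \<equiv> base \<alpha>"
abbreviation "f \<equiv> net \<alpha> S"
abbreviation "Q \<equiv> order_excess \<alpha> S"

lemma value_bound:
  assumes b: "b \<ge> 0" "\<forall>\<alpha>\<in>{0..<1}. \<forall>x\<in>X. x \<le> R \<longrightarrow>
     disc_value I \<alpha> x \<le> ennreal (b / (1 - \<alpha>) + c * max 0 (- x))"
    and x: "x \<in> X" "x \<le> R"
  shows "v x \<le> b / (1 - \<alpha>) + c * max 0 (- x)"
    and "disc_value I \<alpha> x = ennreal (v x)"
proof -
  have le: "disc_value I \<alpha> x \<le> ennreal (b / (1 - \<alpha>) + c * max 0 (- x))"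
    using b(2) x discount by auto
  then show eq: "disc_value I \<alpha> x = ennreal (v x)"
    unfolding real_value_def by (auto simp: ennreal_enn2real_if top_unique)
  have "b / (1 - \<alpha>) + c * max 0 (- x) \<ge> 0"
    using b(1) discount unit_cost_pos by simp
  then show "v x \<le> b / (1 - \<alpha>) + c * max 0 (- x)"
    using le unfolding eq by (subst (asm) ennreal_le_iff)
qed

lemma disc_value_ennreal: "x \<in> X \<Longrightarrow> disc_value I \<alpha> x = ennreal (v x)"
  using disc_value_bound[of x] value_bound(2) by blast

lemma value_nonneg: "v x \<ge> 0"
  by (simp add: real_value_def)

lemma value_measurable: "v \<in> borel_measurable (state_space I)"
  unfolding real_value_def[abs_def]
  using borel_measurable_enn2real[OF disc_value_measurable[OF opt]] discount by simp

lemma value_integrable: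
  assumes y: "y \<in> X"
  shows "integrable (omega I) (\<lambda>\<omega>. v (y - D \<omega>))"
proof -
  obtain b where b: "b \<ge> 0" "\<forall>\<alpha>\<in>{0..<1}. \<forall>x\<in>X. x \<le> y \<longrightarrow>
     disc_value I \<alpha> x \<le> ennreal (b / (1 - \<alpha>) + c * max 0 (- x))"
    using disc_value_bound by blast
  show ?thesis
  proof (rule integrable_le_demand[OF value_measurable y])
    fix x assume x: "x \<in> X" "x \<le> y"
    have "c * max 0 (- x) \<le> c * \<bar>x\<bar>"
      using unit_cost_pos by (intro mult_left_mono) auto
    then show "\<bar>v x\<bar> \<le> b / (1 - \<alpha>) + c * \<bar>x\<bar>"
      using value_bound(1)[OF b x] value_nonneg[of x] by simp
  qed (use unit_cost_pos in simp)
qed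

lemma after_value: "y \<in> X \<Longrightarrow> after (disc_value I \<alpha>) y = ennreal (mean_after I v y)"
  using after_ennreal[of y v] value_nonneg value_integrable[of y]
  by (subst after_cong[of y _ "\<lambda>x. ennreal (v x)"]) (auto simp: disc_value_ennreal)

lemma mean_value_nonneg: "mean_after I v y \<ge> 0"
  unfolding mean_after_def by (intro integral_nonneg_AE AE_I2 value_nonneg)

lemma cost_plus_value:
  assumes "x \<in> X" "a \<in> actions I"
  shows "ennreal (cost I x a) + ennreal \<alpha> * after (disc_value I \<alpha>) (x + a)
    = ennreal (cost I x a + \<alpha> * mean_after I v (x + a))"
proof -
  have "x + a \<in> X" using assms by (auto simp: actions_def intro: states_add)
  then show ?thesis
    using discount mean_value_nonneg[of "x + a"] cost_nonneg[OF assms]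
    by (simp add: after_value ennreal_mult)
qed

lemma value_le:
  assumes "x \<in> X" "a \<in> actions I"
  shows "v x \<le> cost I x a + \<alpha> * mean_after I v (x + a)"
proof -
  have "ennreal (v x) \<le> ennreal (cost I x a + \<alpha> * mean_after I v (x + a))"
    using disc_value_le_first_action[OF opt assms] discount cost_plus_value[OF assms]
    by (simp add: disc_value_ennreal[OF assms(1)])
  then show ?thesis
    using cost_nonneg[OF assms] mean_value_nonneg[of "x + a"] discount
    by (subst (asm) ennreal_le_iff) auto
qed

lemma sS_stationary: "sS_policy s S \<in> stationary_policies I"
  using levels by (rule sS_policy_stationary)

lemma value_eq:
  assumes "x \<in> X"
  shows "v x = cost I x (sS_policy s S x) + \<alpha> * mean_after I v (x + sS_policy s S x)"
proof -
  note a = action_measurable_state(3)[OF sS_stationary assms]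
  have "ennreal (v x) = ennreal (cost I x (sS_policy s S x) + \<alpha> * mean_after I v (x + sS_policy s S x))"
    using disc_value_eq[OF opt assms] discount cost_plus_value[OF assms a]
    by (simp add: disc_value_ennreal[OF assms])
  then show ?thesis
    using cost_nonneg[OF assms a] mean_value_nonneg[of "x + sS_policy s S x"] discount value_nonneg[of x]
    by (subst (asm) ennreal_inj) auto
qed

lemma excess_measurable: "e \<in> borel_measurable (state_space I)"
proof -
  have [measurable]: "(\<lambda>x. x) \<in> borel_measurable (state_space I)"
    unfolding state_space_def by (rule measurable_restrict_space1) simp
  note value_measurable[measurable]
  show ?thesis unfolding excess_def[abs_def] by measurable
qed

lemma excess_integrable:
  assumes "y \<in> X"
  shows "integrable (omega I) (\<lambda>\<omega>. e (y - D \<omega>))"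
  unfolding excess_def using value_integrable[OF assms] demand_integrable by (simp add: right_diff_distrib)

lemma mean_excess:
  assumes "y \<in> X"
  shows "mean_after I e y = mean_after I v y + c * (y - \<mu>) - M"
  unfolding mean_after_def mean_demand_def excess_def
  using value_integrable[OF assms] demand_integrable
  by (simp add: right_diff_distrib prob_space)

lemma order_excess_eq:
  assumes "y \<in> X"
  shows "Q y = c * y + G y + \<alpha> * mean_after I v y - M"
  unfolding order_excess_def net_def base_def mean_excess[OF assms] by (simp add: algebra_simps)

lemma excess_le_order_excess: "x \<in> X \<Longrightarrow> e x \<le> Q x"
  using value_le[of x 0] zero_state
  by (simp add: order_excess_eq excess_def cost_def actions_def)

text \<open>Ordering from x up to y is a first-period deviation; its unit cost cancels against the
  added linear term, so that only the set-up cost remains.\<close>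

lemma excess_le_setup:
  assumes "x \<in> X" "y \<in> X" "x \<le> y"
  shows "e x \<le> K + Q y"
proof (cases "x = y")
  case True
  then show ?thesis using excess_le_order_excess[OF assms(2)] setup_cost_pos by simp
next
  case False
  then show ?thesis
    using value_le[of x "y - x"] assms states_diff[of y x]
    by (simp add: order_excess_eq excess_def cost_def actions_def algebra_simps)
qed

lemma excess_ge: "x \<in> X \<Longrightarrow> s \<le> x \<Longrightarrow> e x = Q x"
  using value_eq[of x] by (simp add: order_excess_eq excess_def cost_def sS_policy_def)

lemma excess_S: "e S = 0" "Q S = 0"
  using excess_ge[of S] levels by (simp_all add: excess_def level_def)

lemma excess_less: "x \<in> X \<Longrightarrow> x < s \<Longrightarrow> e x = K"
  using value_eq[of x] excess_S(2) levels
  by (simp add: order_excess_eq excess_def cost_def sS_policy_def algebra_simps)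

lemma excess_le_K: "x \<in> X \<Longrightarrow> x \<le> S \<Longrightarrow> e x \<le> K"
  using excess_le_setup[of x S] levels excess_S by simp

text \<open>From a state below both s and y the optimal policy orders and has excess exactly K,
  while ordering up to y instead would give \<open>K + Q y\<close>. Hence S minimizes
  \<open>Q\<close> over all states, without any convexity.\<close>

lemma order_excess_nonneg:
  assumes "y \<in> X"
  shows "Q y \<ge> 0"
proof -
  obtain x where x: "x \<in> X" "x < min s y" using state_below by blast
  then show ?thesis using excess_le_setup[of x y] excess_less[of x] assms by simp
qed

lemma excess_nonneg: "x \<in> X \<Longrightarrow> e x \<ge> 0"
  using excess_ge[of x] order_excess_nonneg[of x] excess_less[of x] setup_cost_pos
  by (cases "s \<le> x") auto

lemma mean_excess_nonneg:
  assumes "y \<in> X"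
  shows "mean_after I e y \<ge> 0"
  unfolding mean_after_def
  by (intro integral_nonneg_AE AE_I2 excess_nonneg minus_demand1_state assms)

lemma mean_excess_le:
  assumes "y \<in> X" "\<And>x. x \<in> X \<Longrightarrow> x \<le> y \<Longrightarrow> e x \<le> B"
  shows "mean_after I e y \<le> B"
  unfolding mean_after_def
  using assms excess_integrable[OF assms(1)] minus_demand1_state demand1_nonneg
  by (intro integral_le_const AE_I2) auto

lemma mean_excess_ge:
  assumes "y \<in> X" "\<And>x. x \<in> X \<Longrightarrow> x \<le> y \<Longrightarrow> B \<le> e x"
  shows "B \<le> mean_after I e y"
  unfolding mean_after_def
  using assms excess_integrable[OF assms(1)] minus_demand1_state demand1_nonneg
  by (intro integral_ge_const AE_I2) auto

text \<open>States below y have excess at most \<open>K + Q y\<close>. Inserting this into the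
  renewal equation for \<open>Q y\<close> leaves \<open>(1 - \<alpha>) * Q y \<ge> 0\<close> on the
  left. The choice y = 0 later bounds the normalized level uniformly in \<alpha>.\<close>

lemma level_le:
  assumes "y \<in> X"
  shows "(1 - \<alpha>) * M \<le> K + g y"
proof -
  have "mean_after I e y \<le> K + Q y"
    using excess_le_setup assms by (intro mean_excess_le) auto
  then have "Q y \<le> g y - (1 - \<alpha>) * M + \<alpha> * (K + Q y)"
    using discount by (simp add: order_excess_def net_def)
  then have "(1 - \<alpha>) * Q y \<le> g y - (1 - \<alpha>) * M + \<alpha> * K"
    by (simp add: algebra_simps)
  moreover have "(1 - \<alpha>) * Q y \<ge> 0" "\<alpha> * K \<le> 1 * K"
    using discount order_excess_nonneg[OF assms] setup_cost_pos
    by (auto intro!: mult_nonneg_nonneg mult_right_mono simp del: mult_1)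
  ultimately show ?thesis by simp
qed

text \<open>The renewal equation at S has left side 0 and a nonnegative expectation. Together with
  \<open>level_le\<close> and coercivity this prevents S from escaping to the right.\<close>

lemma base_S_le: "g S \<le> (1 - \<alpha>) * M"
proof -
  have "\<alpha> * mean_after I e S \<ge> 0"
    using discount mean_excess_nonneg levels by simp
  then show ?thesis using excess_S(2) by (simp add: order_excess_def net_def)
qed

text \<open>To the left of s the excess equals K, its largest value on the states up to S, so a
  demand at s cannot lower it.\<close>

lemma mean_excess_s_ge: "e s \<le> mean_after I e s"
  using excess_less excess_le_K[of s] levels by (intro mean_excess_ge) (auto simp: order_le_less)

text \<open>This is the bound that quasiconvexity contradicts when s lies too far to the
  left.\<close>

lemma base_s_le: "g s \<le> (1 - \<alpha>) * M + K"
proof -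
  have "e s = g s - (1 - \<alpha>) * M + \<alpha> * mean_after I e s"
    using excess_ge[of s] levels by (simp add: order_excess_def net_def)
  moreover have "\<alpha> * mean_after I e s \<ge> 0"
    using discount mean_excess_nonneg levels by simp
  ultimately show ?thesis using excess_le_K[of s] levels by simp
qed

lemma isCont_base: "X = UNIV \<Longrightarrow> isCont g x"
proof -
  assume "X = UNIV"
  then have "isCont G x"
    using holding_continuous by (auto simp: continuous_on_eq_continuous_at)
  then show "isCont g x"
    unfolding base_def[abs_def] by (intro continuous_intros)
qed

text \<open>Just below \<open>s\<close> ordering is optimal, at \<open>s\<close> it is not ordering: by continuity both are.\<close>

lemma excess_s:
  assumes "X = UNIV"
  shows "e s = K"
proof -
  have below: "f x \<ge> (1 - \<alpha>) * K" if "x < s" for x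
  proof -
    have "mean_after I e x \<le> K"
      using that assms excess_less by (intro mean_excess_le) auto
    then have "\<alpha> * mean_after I e x \<le> \<alpha> * K"
      using discount by simp
    moreover have "K \<le> f x + \<alpha> * mean_after I e x"
      using excess_le_order_excess[of x] excess_less[of x] that assms by (simp add: order_excess_def)
    ultimately show ?thesis by (simp add: algebra_simps)
  qed
  have "(f \<longlongrightarrow> f s) (at_left s)"
    using isCont_base[OF assms, of s] unfolding net_def[abs_def]
    by (intro tendsto_intros) (auto simp: isCont_def filterlim_at_split)
  then have "f s \<ge> (1 - \<alpha>) * K"
    by (rule tendsto_lowerbound) (auto simp: eventually_at_left[of "s - 1"] below intro!: exI[of _ "s - 1"])
  moreover have "e s = f s + \<alpha> * mean_after I e s"
    using excess_ge[of s] levels by (simp add: order_excess_def)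
  \<comment> \<open>Only \<open>f\<close> is passed to the left limit. The expectation is instead
    bounded below at s itself, which avoids any continuity of the excess.\<close>
  moreover have "\<alpha> * e s \<le> \<alpha> * mean_after I e s"
    using mean_excess_s_ge discount by simp
  ultimately have "(1 - \<alpha>) * K \<le> (1 - \<alpha>) * e s"
    by (simp add: algebra_simps)
  then show ?thesis
    using discount excess_le_K[of s] levels by simp
qed

text \<open>The bound depends on \<alpha> and is useless in the limit. It serves as the finite a
  priori bound from which the iteration in \<open>renewal_bound\<close> can start; it does not enter
  the conclusion there.\<close>

lemma excess_bounded: "\<exists>B. \<forall>x\<in>X. x \<le> R \<longrightarrow> e x \<le> B"
proof -
  obtain b where b: "b \<ge> 0" "\<forall>\<alpha>\<in>{0..<1}. \<forall>x\<in>X. x \<le> R \<longrightarrow>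
     disc_value I \<alpha> x \<le> ennreal (b / (1 - \<alpha>) + c * max 0 (- x))"
    using disc_value_bound by blast
  have "e x \<le> max K (b / (1 - \<alpha>) + c * max 0 (- s) + c * R - M)" if x: "x \<in> X" "x \<le> R" for x
  proof (cases "x < s")
    case True then show ?thesis using excess_less x by simp
  next
    case False
    then have "c * max 0 (- x) \<le> c * max 0 (- s)" "c * x \<le> c * R"
      using unit_cost_pos x by (auto intro!: mult_left_mono)
    then show ?thesis
      using value_bound(1)[OF b x] unfolding excess_def by simp
  qed
  then show ?thesis by blast
qed

end

text \<open>The renewal argument behind all uniform estimates: an index sits at position \<open>pos i\<close>, and with
  probability at least \<open>p\<close> a single demand moves it down by \<open>\<delta>\<close>, so that it leaves the bounded
  region after finitely many periods in the mean.\<close>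

lemma renewal_bound:
  fixes a pos :: "'i \<Rightarrow> real"
  assumes "\<delta> > 0" and p: "0 < p" "p \<le> 1" and F: "F \<ge> 0"
    and bound: "\<And>i. i \<in> A \<Longrightarrow> a i \<le> B"
    and start: "\<And>i. i \<in> A \<Longrightarrow> pos i \<le> x1 \<Longrightarrow> a i \<le> C0"
    and step: "\<And>i C C'. i \<in> A \<Longrightarrow> (\<And>j. j \<in> A \<Longrightarrow> pos j \<le> pos i \<Longrightarrow> a j \<le> C) \<Longrightarrow>
      (\<And>j. j \<in> A \<Longrightarrow> pos j \<le> pos i - \<delta> \<Longrightarrow> a j \<le> C') \<Longrightarrow> C0 \<le> C' \<Longrightarrow> C' \<le> C \<Longrightarrow>
      a i \<le> C0 \<or> a i \<le> F + (1 - p) * C + p * C'"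
    and i: "i \<in> A" "pos i \<le> x1 + real n * \<delta>"
  shows "a i \<le> C0 + real n * F / p"
  using i
proof (induction n arbitrary: i)
  case 0
  then show ?case using start by simp
next
  case (Suc n)
  note IH = Suc.IH
  define T where "T = C0 + real (Suc n) * F / p"
  define C' where "C' = C0 + real n * F / p"
  define B' where "B' = max 0 (B - T)"
  have C': "C0 \<le> C'" "C' \<le> T"
    using F p by (auto simp: C'_def T_def field_simps)
  \<comment> \<open>T is the fixed point of the map taking C to
    \<open>F + (1 - p) * C + p * C'\<close>, where \<open>C'\<close> is the bound from the induction
    hypothesis one \<delta>-step lower.\<close>
  have pT: "p * T = p * C' + F"
    using p by (simp add: T_def C'_def field_simps)
  \<comment> \<open>Each application of the step inequality multiplies the overshoot above T by
    \<open>1 - p\<close>; letting k tend to infinity removes the a priori bound.\<close>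
  have iter: "a j \<le> T + (1 - p) ^ k * B'" if "j \<in> A" "pos j \<le> x1 + real (Suc n) * \<delta>" for j k
    using that
  proof (induction k arbitrary: j)
    case 0
    then show ?case using bound[of j] by (simp add: B'_def)
  next
    case (Suc k)
    let ?C = "T + (1 - p) ^ k * B'"
    have nonneg: "(1 - p) ^ k * B' \<ge> 0" for k using p by (simp add: B'_def)
    have "a j \<le> C0 \<or> a j \<le> F + (1 - p) * ?C + p * C'"
    proof (rule step[OF Suc.prems(1)])
      fix l assume "l \<in> A" "pos l \<le> pos j"
      then show "a l \<le> ?C" using Suc.prems by (intro Suc.IH) auto
    next
      fix l assume "l \<in> A" "pos l \<le> pos j - \<delta>"
      then show "a l \<le> C'"
        unfolding C'_def using Suc.prems by (intro IH) (auto simp: algebra_simps)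
    qed (use C' nonneg[of k] in auto)
    moreover have "F + (1 - p) * ?C + p * C' = T + (1 - p) ^ Suc k * B'"
      using pT by (simp add: algebra_simps)
    ultimately show ?case using C' nonneg[of "Suc k"] by linarith
  qed
  have "(\<lambda>k. T + (1 - p) ^ k * B') \<longlonglongrightarrow> T + 0 * B'"
    using p by (intro tendsto_intros LIMSEQ_realpow_zero) auto
  then have "a i \<le> T + 0 * B'"
    using iter[OF Suc.prems] by (intro LIMSEQ_le_const) auto
  then show ?case by (simp add: T_def)
qed

section \<open>Demands that exceed a fixed amount with positive probability\<close>

context inventory_model
begin

text \<open>The event of a positive demand is the countable union of the events that the demand
  exceeds \<open>1 / (n + 1)\<close>, and these cannot all be null.\<close>

lemma demand_large_prob: "\<exists>\<delta>>0. prob {\<omega> \<in> space (omega I). D \<omega> > \<delta>} > 0"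
proof (rule ccontr)
  assume "\<not> ?thesis"
  then have "prob {\<omega> \<in> space (omega I). D \<omega> > 1 / real (Suc n)} = 0" for n
    by (metis measure_nonneg order_le_less of_nat_0_less_iff zero_less_Suc zero_less_divide_1_iff)
  moreover have "{\<omega> \<in> space (omega I). D \<omega> > 1 / real (Suc n)} \<in> sets (omega I)" for n
    by measurable
  ultimately have "{\<omega> \<in> space (omega I). D \<omega> > 1 / real (Suc n)} \<in> null_sets (omega I)" for n
    by (intro null_setsI) (auto simp: emeasure_eq_measure simp del: of_nat_Suc)
  then have "(\<Union>n. {\<omega> \<in> space (omega I). D \<omega> > 1 / real (Suc n)}) \<in> null_sets (omega I)"
    by (rule null_sets_UN)
  then have "prob (\<Union>n. {\<omega> \<in> space (omega I). D \<omega> > 1 / real (Suc n)}) = 0"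
    by (simp add: null_sets_def measure_def)
  moreover have "{\<omega> \<in> space (omega I). D \<omega> > 0} = (\<Union>n. {\<omega> \<in> space (omega I). D \<omega> > 1 / real (Suc n)})"
  proof (intro equalityI subsetI)
    fix \<omega> assume "\<omega> \<in> {\<omega> \<in> space (omega I). D \<omega> > 0}"
    moreover from this obtain n where "1 / real (Suc n) < D \<omega>"
      using nat_approx_posE by auto
    ultimately show "\<omega> \<in> (\<Union>n. {\<omega> \<in> space (omega I). D \<omega> > 1 / real (Suc n)})" by auto
  next
    fix \<omega> assume "\<omega> \<in> (\<Union>n. {\<omega> \<in> space (omega I). D \<omega> > 1 / real (Suc n)})"
    then obtain n where "\<omega> \<in> space (omega I)" "1 / real (Suc n) < D \<omega>" by auto
    moreover have "0 < 1 / real (Suc n)" by simp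
    ultimately show "\<omega> \<in> {\<omega> \<in> space (omega I). D \<omega> > 0}"
      by (metis (mono_tags, lifting) mem_Collect_eq order.strict_trans)
  qed
  ultimately show False using demand_nontrivial by simp
qed

lemma integral_split_le:
  assumes "integrable (omega I) \<psi>" "\<And>\<omega>. \<omega> \<in> space (omega I) \<Longrightarrow> \<psi> \<omega> \<le> C"
    and "\<And>\<omega>. \<omega> \<in> space (omega I) \<Longrightarrow> D \<omega> > \<delta> \<Longrightarrow> \<psi> \<omega> \<le> C'"
    and p: "p = prob {\<omega> \<in> space (omega I). D \<omega> > \<delta>}"
  shows "(\<integral>\<omega>. \<psi> \<omega> \<partial>omega I) \<le> (1 - p) * C + p * C'"
proof -
  let ?E = "{\<omega> \<in> space (omega I). D \<omega> > \<delta>}"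
  have E: "?E \<in> sets (omega I)" by measurable
  have "(\<integral>\<omega>. \<psi> \<omega> \<partial>omega I) \<le> (\<integral>\<omega>. C + (C' - C) * indicator ?E \<omega> \<partial>omega I)"
  proof (rule integral_mono[OF assms(1)])
    show "integrable (omega I) (\<lambda>\<omega>. C + (C' - C) * indicator ?E \<omega>)"
      using E by (simp add: less_top[symmetric])
  qed (use assms(2,3) in \<open>auto simp: indicator_def\<close>)
  also have "\<dots> = C + (C' - C) * p"
    using E p by (simp add: prob_space less_top[symmetric])
  finally show ?thesis by (simp add: algebra_simps)
qed

end

section \<open>Local bounds and moduli of continuity with explicit dependence on the data\<close>

context discounted_sS
begin

text \<open>\<open>renewal_bound\<close> with states as indices. The expectation is nonnegative, so
  the factor \<alpha> can be replaced by 1; afterwards \<alpha> influences the bound only through F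
  and the requirement \<open>x1 < s\<close>.\<close>

lemma excess_le_uniform:
  assumes F: "F \<ge> 0" "\<And>y. y \<in> X \<Longrightarrow> s \<le> y \<Longrightarrow> y \<le> R \<Longrightarrow> f y \<le> F"
    and \<delta>: "\<delta> > 0" and p: "p = prob {\<omega> \<in> space (omega I). D \<omega> > \<delta>}" "p > 0"
    and x1: "x1 < s" and x: "x \<in> X" "x \<le> R" "x \<le> x1 + real n * \<delta>"
  shows "e x \<le> K + real n * F / p"
proof -
  obtain B where B: "\<And>x. x \<in> X \<Longrightarrow> x \<le> R \<Longrightarrow> e x \<le> B"
    using excess_bounded by blast
  show ?thesis
  proof (rule renewal_bound[where A = "{x \<in> X. x \<le> R}" and pos = "\<lambda>x. x" and a = e and ?x1.0 = x1 and \<delta> = \<delta> and B = B])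
    fix y C C'
    assume y: "y \<in> {x \<in> X. x \<le> R}"
      and C: "\<And>j. j \<in> {x \<in> X. x \<le> R} \<Longrightarrow> j \<le> y \<Longrightarrow> e j \<le> C"
      and C': "\<And>j. j \<in> {x \<in> X. x \<le> R} \<Longrightarrow> j \<le> y - \<delta> \<Longrightarrow> e j \<le> C'"
    show "e y \<le> K \<or> e y \<le> F + (1 - p) * C + p * C'"
    proof (cases "y < s")
      case True
      then show ?thesis using y excess_less by simp
    next
      case False
      have "mean_after I e y \<le> (1 - p) * C + p * C'"
        unfolding mean_after_def
        using y minus_demand1_state[of _ y]
        by (intro integral_split_le[where \<delta> = \<delta>] p excess_integrable C C') (auto dest: demand1_nonneg)
      moreover have "\<alpha> * mean_after I e y \<le> 1 * mean_after I e y"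
        using y discount mean_excess_nonneg[of y] by (intro mult_right_mono) auto
      moreover have "e y = f y + \<alpha> * mean_after I e y"
        using excess_ge[of y] y False by (simp add: order_excess_def)
      ultimately show ?thesis
        using F(2)[of y] y False by simp
    qed
  qed (use assms B excess_less prob_le_1 in \<open>auto\<close>)
qed

text \<open>\<open>renewal_bound\<close> with pairs of states as indices, positioned at the larger
  state. A common demand shifts both states and keeps their distance; once both lie below s the
  difference is 0, hence the starting constant 0.\<close>

lemma excess_equicontinuous:
  assumes UNIV: "X = UNIV"
    and F: "F \<ge> 0" "\<And>x y. s \<le> x \<Longrightarrow> x \<le> y \<Longrightarrow> y \<le> R \<Longrightarrow> y - x \<le> d \<Longrightarrow> \<bar>f x - f y\<bar> \<le> F"
    and \<delta>: "\<delta> > 0" and p: "p = prob {\<omega> \<in> space (omega I). D \<omega> > \<delta>}" "p > 0"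
    and x1: "x1 < s" and x: "x \<le> y" "y \<le> R" "y - x \<le> d" "y \<le> x1 + real n * \<delta>"
  shows "\<bar>e x - e y\<bar> \<le> real n * F / p"
proof -
  obtain B where B: "\<And>x. x \<in> X \<Longrightarrow> x \<le> R \<Longrightarrow> e x \<le> B"
    using excess_bounded by blast
  let ?A = "{(x, y). x \<le> y \<and> y \<le> R \<and> y - x \<le> d}"
  have "(\<lambda>(x, y). \<bar>e x - e y\<bar>) (x, y) \<le> 0 + real n * F / p"
  proof (rule renewal_bound[where A = ?A and pos = snd and ?x1.0 = x1 and \<delta> = \<delta> and B = B])
    fix q C C'
    assume q: "q \<in> ?A"
      and C: "\<And>j. j \<in> ?A \<Longrightarrow> snd j \<le> snd q \<Longrightarrow> (\<lambda>(x, y). \<bar>e x - e y\<bar>) j \<le> C"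
      and C': "\<And>j. j \<in> ?A \<Longrightarrow> snd j \<le> snd q - \<delta> \<Longrightarrow> (\<lambda>(x, y). \<bar>e x - e y\<bar>) j \<le> C'"
    obtain x0 y where xy: "q = (x0, y)" by (cases q)
    \<comment> \<open>For a pair that straddles s, the lower state is moved up to s. Nothing
      changes, since \<open>excess_s\<close> makes the excess at s agree with its value K below s;
      afterwards the renewal equation holds at both states.\<close>
    define x where "x = max x0 (min s y)"
    have x: "x \<le> y" "y \<le> R" "y - x \<le> d"
      using q xy by (auto simp: x_def)
    have same: "\<bar>e x0 - e y\<bar> = \<bar>e x - e y\<bar>"
      using excess_s[OF UNIV] excess_less[of x0] excess_less[of y] UNIV q xy by (cases "x0 < s") (auto simp: x_def max_def min_def)
    show "(\<lambda>(x, y). \<bar>e x - e y\<bar>) q \<le> 0 \<or> (\<lambda>(x, y). \<bar>e x - e y\<bar>) q \<le> F + (1 - p) * C + p * C'"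
    proof (cases "s \<le> x")
      case False
      then have "y < s" using x by (auto simp: x_def)
      then show ?thesis
        using xy same excess_less[of x] excess_less[of y] x UNIV by simp
    next
      case True
      have int: "integrable (omega I) (\<lambda>\<omega>. e (x - D \<omega>))" "integrable (omega I) (\<lambda>\<omega>. e (y - D \<omega>))"
        using excess_integrable[of x] excess_integrable[of y] UNIV by simp_all
      have "\<bar>mean_after I e x - mean_after I e y\<bar> \<le> (\<integral>\<omega>. \<bar>e (x - D \<omega>) - e (y - D \<omega>)\<bar> \<partial>omega I)"
        unfolding mean_after_def Bochner_Integration.integral_diff[OF int, symmetric]
        by (rule integral_abs_bound)
      also have "\<dots> \<le> (1 - p) * C + p * C'"
      proof (rule integral_split_le[OF _ _ _ p(1)])
        fix \<omega> assume \<omega>: "\<omega> \<in> space (omega I)"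
        show "\<bar>e (x - D \<omega>) - e (y - D \<omega>)\<bar> \<le> C"
          using C[of "(x - D \<omega>, y - D \<omega>)"] x xy demand1_nonneg[OF \<omega>] by simp
        assume "\<delta> < D \<omega>"
        then show "\<bar>e (x - D \<omega>) - e (y - D \<omega>)\<bar> \<le> C'"
          using C'[of "(x - D \<omega>, y - D \<omega>)"] x xy demand1_nonneg[OF \<omega>] by simp
      qed (use int in simp)
      finally have mean: "\<bar>mean_after I e x - mean_after I e y\<bar> \<le> (1 - p) * C + p * C'" .
      have "e x - e y = (f x - f y) + \<alpha> * (mean_after I e x - mean_after I e y)"
        using excess_ge[of x] excess_ge[of y] True x UNIV by (simp add: order_excess_def algebra_simps)
      also have "\<bar>\<dots>\<bar> \<le> \<bar>f x - f y\<bar> + \<bar>\<alpha> * (mean_after I e x - mean_after I e y)\<bar>"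
        by (rule abs_triangle_ineq)
      also have "\<bar>\<alpha> * (mean_after I e x - mean_after I e y)\<bar> \<le> 1 * \<bar>mean_after I e x - mean_after I e y\<bar>"
        unfolding abs_mult using discount by (intro mult_right_mono) auto
      finally show ?thesis
        using F(2)[OF True x] mean xy same by simp
    qed
  next
    fix q assume "q \<in> ?A"
    then show "(\<lambda>(x, y). \<bar>e x - e y\<bar>) q \<le> B"
      using B[of "fst q"] B[of "snd q"] excess_nonneg[of "fst q"] excess_nonneg[of "snd q"] UNIV by auto
  next
    fix q assume "q \<in> ?A" "snd q \<le> x1"
    then show "(\<lambda>(x, y). \<bar>e x - e y\<bar>) q \<le> 0"
      using excess_less[of "fst q"] excess_less[of "snd q"] UNIV x1 by auto
  qed (use assms prob_le_1 in \<open>auto\<close>)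
  then show ?thesis by simp
qed

abbreviation "low \<equiv> bottom \<alpha>"

lemma min_value_eq: "min_value I \<alpha> = ennreal low"
proof -
  have "min_value I \<alpha> \<le> disc_value I \<alpha> 0"
    unfolding min_value_def using zero_state by (rule INF_lower)
  then have "min_value I \<alpha> \<noteq> \<top>"
    using disc_value_ennreal[OF zero_state] by (auto simp: top_unique)
  then show ?thesis by (simp add: bottom_def ennreal_enn2real_if)
qed

lemma bottom_le: "x \<in> X \<Longrightarrow> low \<le> v x"
proof -
  assume x: "x \<in> X"
  have "ennreal low \<le> ennreal (v x)"
    unfolding min_value_eq[symmetric] disc_value_ennreal[OF x, symmetric] min_value_def
    using x by (rule INF_lower)
  then show ?thesis by (simp add: value_nonneg)
qed

lemma bottom_nonneg: "low \<ge> 0"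
  by (simp add: bottom_def)

lemma rel_value_eq: "x \<in> X \<Longrightarrow> rel_value I \<alpha> x = ereal (e x - c * x - (low - M))"
  unfolding rel_value_def excess_def
  by (simp add: disc_value_ennreal min_value_eq enn2ereal_ennreal value_nonneg bottom_nonneg)

lemma bottom_less:
  assumes "low < r"
  shows "\<exists>x\<in>X. v x < r"
proof -
  have "min_value I \<alpha> < ennreal r"
    using assms bottom_nonneg by (simp add: min_value_eq ennreal_lessI)
  then obtain x where x: "x \<in> X" "disc_value I \<alpha> x < ennreal r"
    unfolding min_value_def by (auto simp: INF_less_iff)
  then have "v x < r"
    using disc_value_ennreal[of x] value_nonneg[of x] by (simp add: ennreal_less_iff)
  then show ?thesis using x by blast
qed

text \<open>At or above s nothing is ordered, and from the next period on the cost is at least the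
  minimal value.\<close>

lemma value_ge_holding:
  assumes "y \<in> X" "s \<le> y"
  shows "v y \<ge> G y + \<alpha> * low"
proof -
  have "low \<le> mean_after I v y"
    unfolding mean_after_def
    using assms value_integrable[OF assms(1)] minus_demand1_state
    by (intro integral_ge_const AE_I2 bottom_le) auto
  then have "\<alpha> * low \<le> \<alpha> * mean_after I v y"
    using discount by simp
  moreover have "v y = G y + \<alpha> * mean_after I v y"
    using value_eq[OF assms(1)] assms(2) by (simp add: sS_policy_def cost_def)
  ultimately show ?thesis by simp
qed

text \<open>To the right of B the value exceeds the minimum by at least 1, so near-minimal states
  lie at or below B, and there nonnegativity of the excess gives \<open>v y \<ge> M - c * B\<close>.
  No minimizer of the value function has to exist.\<close>

lemma bottom_ge:
  assumes "s \<le> B" "\<And>y. y \<in> X \<Longrightarrow> B < y \<Longrightarrow> G y \<ge> (1 - \<alpha>) * low + 1"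
  shows "M - c * B \<le> low"
proof (rule ccontr)
  assume "\<not> ?thesis"
  then obtain y where y: "y \<in> X" "v y < min (low + 1) (M - c * B)"
    using bottom_less[of "min (low + 1) (M - c * B)"] by auto
  show False
  proof (cases "y \<le> B")
    case True
    then have "c * y \<le> c * B" using unit_cost_pos by simp
    then show False using y excess_nonneg[OF y(1)] by (simp add: excess_def)
  next
    case False
    then show False
      using value_ge_holding[of y] assms y by (simp add: algebra_simps not_le) (smt (verit))
  qed
qed

end

subsection \<open>Uniformity near discount factor one\<close>

locale inventory_sS = inventory_model +
  fixes \<alpha>0 :: real and s' S' :: "real \<Rightarrow> real"
  assumes threshold: "0 \<le> \<alpha>0" "\<alpha>0 < 1"
    and quasiconvex: "\<And>\<alpha>. \<alpha> \<in> {\<alpha>0<..1} \<Longrightarrow>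
      quasiconvex_on (states I) (mean_after I (disc_holding I \<alpha>))"
    and sS_levels: "\<And>\<alpha>. \<alpha> \<in> {\<alpha>0<..<1} \<Longrightarrow> s' \<alpha> \<in> states I \<and> S' \<alpha> \<in> states I \<and> s' \<alpha> \<le> S' \<alpha>"
    and sS_optimal: "\<And>\<alpha>. \<alpha> \<in> {\<alpha>0<..<1} \<Longrightarrow> disc_optimal I \<alpha> (sS_policy (s' \<alpha>) (S' \<alpha>))"
begin

abbreviation "lv \<alpha> \<equiv> level \<alpha> (S' \<alpha>)"
abbreviation "ex \<alpha> \<equiv> excess \<alpha> (S' \<alpha>)"

lemma discounted: "\<alpha> \<in> {\<alpha>0<..<1} \<Longrightarrow> discounted_sS I \<alpha> (s' \<alpha>) (S' \<alpha>)"
  using threshold sS_levels[of \<alpha>] sS_optimal[of \<alpha>] inventory_model_axioms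
  by (auto simp: discounted_sS_def discounted_sS_axioms_def)

lemma mean_disc_holding:
  assumes "y \<in> X"
  shows "mean_after I (disc_holding I \<alpha>) y = base \<alpha> y"
proof -
  have "mean_after I (disc_holding I \<alpha>) y
      = (\<integral>\<omega>. holding I (y - D \<omega>) + ((1 - \<alpha>) * c * y + c * \<mu> - (1 - \<alpha>) * c * D \<omega>) \<partial>omega I)"
    unfolding mean_after_def disc_holding_def by (simp add: algebra_simps)
  also have "\<dots> = G y + ((1 - \<alpha>) * c * y + c * \<mu> - (1 - \<alpha>) * c * \<mu>)"
    using holding_integrable[OF assms] demand_integrable
    by (simp add: mean_after_def mean_demand_def prob_space)
  finally show ?thesis by (simp add: base_def algebra_simps)
qed

lemma base_quasiconvex:
  assumes "\<alpha> \<in> {\<alpha>0<..1}" "x \<in> X" "y \<in> X" "z \<in> X" "x \<le> y" "y \<le> z"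
  shows "base \<alpha> y \<le> max (base \<alpha> x) (base \<alpha> z)"
proof (cases "x = z")
  case True
  then show ?thesis using assms by simp
next
  case False
  then have xz: "x < z" using assms by simp
  let ?l = "(z - y) / (z - x)"
  have y: "?l * x + (1 - ?l) * z = y"
  proof -
    have "?l * (z - x) = z - y" using xz by simp
    moreover have "?l * x + (1 - ?l) * z = z - ?l * (z - x)"
      by (simp only: algebra_simps)
    ultimately show ?thesis by simp
  qed
  have "?l \<in> {0..1}" using xz assms by (simp add: field_simps)
  then show ?thesis
    using quasiconvex[OF assms(1)] assms(2-4) y unfolding quasiconvex_on_def
    by (metis mean_disc_holding)
qed

text \<open>If s were at most \<open>x1\<close>, then \<open>x1\<close> would lie between s and 0.
  The quasiconvex \<open>base\<close> is at most \<open>W1 + K\<close> at both of these states but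
  larger at \<open>x1\<close>. The bound on S uses coercivity to the right, where the linear term of
  \<open>base\<close> is nonnegative.\<close>

lemma uniform_levels:
  obtains \<alpha>1 B W x1 where "\<alpha>0 \<le> \<alpha>1" "\<alpha>1 < 1" "B \<ge> 0" "W \<ge> 0"
    "\<And>\<alpha>. \<alpha> \<in> {\<alpha>1<..<1} \<Longrightarrow> x1 < s' \<alpha>"
    "\<And>\<alpha>. \<alpha> \<in> {\<alpha>1<..<1} \<Longrightarrow> S' \<alpha> \<le> B"
    "\<And>\<alpha>. \<alpha> \<in> {\<alpha>1<..<1} \<Longrightarrow> \<bar>(1 - \<alpha>) * lv \<alpha>\<bar> \<le> W"
proof -
  define W1 where "W1 = K + G 0 + c * \<mu>"
  have base0: "K + base \<alpha> 0 \<le> W1" if "\<alpha> \<in> {\<alpha>0<..<1}" for \<alpha>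
  proof -
    have "\<alpha> * (c * \<mu>) \<le> 1 * (c * \<mu>)"
      using that unit_cost_pos mean_demand_nonneg by (intro mult_right_mono) auto
    then show ?thesis by (simp add: base_def W1_def)
  qed
  obtain B where B: "B \<ge> 0" "\<And>x. x \<in> X \<Longrightarrow> \<bar>x\<bar> > B \<Longrightarrow> G x > W1"
    using holding_large by blast
  obtain B1 where B1: "B1 \<ge> 0" "\<And>x. x \<in> X \<Longrightarrow> \<bar>x\<bar> > B1 \<Longrightarrow> G x > W1 + K + 1"
    using holding_large by blast
  obtain x1 where x1: "x1 \<in> X" "x1 < - B1" using state_below by blast
  have x1_neg: "x1 < 0" using x1 B1 by simp
  \<comment> \<open>Beyond \<open>\<alpha>1\<close> the linear term
    \<open>(1 - \<alpha>) * c * x1\<close> stays above -1 at the fixed state \<open>x1\<close>; the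
    summand 1 in the choice of \<open>B1\<close> absorbs it.\<close>
  define \<alpha>1 where "\<alpha>1 = max \<alpha>0 (1 - 1 / (c * \<bar>x1\<bar>))"
  have pos: "c * \<bar>x1\<bar> > 0" using x1_neg unit_cost_pos by (intro mult_pos_pos) auto
  have lv_le: "(1 - \<alpha>) * lv \<alpha> \<le> W1" if "\<alpha> \<in> {\<alpha>0<..<1}" for \<alpha>
    using discounted_sS.level_le[OF discounted[OF that] zero_state] base0[OF that] by simp
  have s: "x1 < s' \<alpha>" if \<alpha>: "\<alpha> \<in> {\<alpha>1<..<1}" for \<alpha>
  proof (rule ccontr)
    assume s: "\<not> x1 < s' \<alpha>"
    have \<alpha>': "\<alpha> \<in> {\<alpha>0<..<1}" "\<alpha> \<in> {\<alpha>0<..1}" using \<alpha> by (auto simp: \<alpha>1_def)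
    interpret discounted_sS I \<alpha> "s' \<alpha>" "S' \<alpha>" by (rule discounted[OF \<alpha>'(1)])
    have "1 - \<alpha> < 1 / (c * \<bar>x1\<bar>)" using \<alpha> by (auto simp: \<alpha>1_def)
    then have "(1 - \<alpha>) * (c * \<bar>x1\<bar>) < 1" using pos by (simp add: pos_less_divide_eq)
    then have "(1 - \<alpha>) * c * x1 > - 1" using x1_neg by (simp add: algebra_simps)
    moreover have "\<alpha> * c * \<mu> \<ge> 0" using discount unit_cost_pos mean_demand_nonneg by simp
    ultimately have "base \<alpha> x1 > W1 + K"
      using B1(2)[OF x1(1)] x1 B1(1) by (simp add: base_def)
    moreover have "base \<alpha> x1 \<le> max (base \<alpha> (s' \<alpha>)) (base \<alpha> 0)"
      using s x1 x1_neg levels zero_state by (intro base_quasiconvex[OF \<alpha>'(2)]) auto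
    moreover have "base \<alpha> (s' \<alpha>) \<le> W1 + K"
      using base_s_le lv_le[OF \<alpha>'(1)] by simp
    moreover have "base \<alpha> 0 \<le> W1 + K"
      using base0[OF \<alpha>'(1)] setup_cost_pos by simp
    ultimately show False by simp
  qed
  have S: "S' \<alpha> \<le> B" if \<alpha>: "\<alpha> \<in> {\<alpha>1<..<1}" for \<alpha>
  proof (rule ccontr)
    assume "\<not> S' \<alpha> \<le> B"
    then have S: "S' \<alpha> > B" by simp
    have \<alpha>': "\<alpha> \<in> {\<alpha>0<..<1}" using \<alpha> by (auto simp: \<alpha>1_def)
    interpret discounted_sS I \<alpha> "s' \<alpha>" "S' \<alpha>" by (rule discounted[OF \<alpha>'])
    have "(1 - \<alpha>) * c * S' \<alpha> \<ge> 0" "\<alpha> * c * \<mu> \<ge> 0"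
      using S B(1) discount unit_cost_pos mean_demand_nonneg by auto
    then show False
      using base_S_le lv_le[OF \<alpha>'] B(2)[of "S' \<alpha>"] S B(1) levels by (simp add: base_def)
  qed
  have W: "\<bar>(1 - \<alpha>) * lv \<alpha>\<bar> \<le> max \<bar>W1\<bar> (c * \<bar>x1\<bar>)" if \<alpha>: "\<alpha> \<in> {\<alpha>1<..<1}" for \<alpha>
  proof -
    have \<alpha>': "\<alpha> \<in> {\<alpha>0<..<1}" using \<alpha> by (auto simp: \<alpha>1_def)
    interpret discounted_sS I \<alpha> "s' \<alpha>" "S' \<alpha>" by (rule discounted[OF \<alpha>'])
    have "x1 \<le> S' \<alpha>" using s[OF \<alpha>] levels by simp
    then have "c * x1 \<le> c * S' \<alpha>" using unit_cost_pos by simp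
    \<comment> \<open>The lower bound on the level needs only that the value is nonnegative and that
      S lies to the right of \<open>x1\<close>.\<close>
    then have "c * x1 \<le> lv \<alpha>" using value_nonneg[of "S' \<alpha>"] by (simp add: level_def)
    then have "(1 - \<alpha>) * (c * x1) \<le> (1 - \<alpha>) * lv \<alpha>"
      using discount by (intro mult_left_mono) auto
    moreover have "(1 - \<alpha>) * (c * \<bar>x1\<bar>) \<le> 1 * (c * \<bar>x1\<bar>)"
      using discount pos by (intro mult_right_mono) auto
    moreover have "c * \<bar>x1\<bar> = - (c * x1)" using x1_neg by simp
    ultimately show ?thesis
      using lv_le[OF \<alpha>'] max.cobounded1[of "\<bar>W1\<bar>" "c * \<bar>x1\<bar>"] max.cobounded2[of "c * \<bar>x1\<bar>" "\<bar>W1\<bar>"]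
      by (simp only: abs_le_iff) linarith
  qed
  show ?thesis
    by (rule that[of \<alpha>1 B "max \<bar>W1\<bar> (c * \<bar>x1\<bar>)" x1, OF _ _ B(1) _ s S W])
      (use threshold pos in \<open>auto simp: \<alpha>1_def\<close>)
qed

end

locale near_one = inventory_sS +
  fixes \<alpha>1 x1 B W :: real
  assumes \<alpha>1: "\<alpha>0 \<le> \<alpha>1" "\<alpha>1 < 1" and B_nonneg: "B \<ge> 0" and W_nonneg: "W \<ge> 0"
    and s_ge: "\<And>\<alpha>. \<alpha> \<in> {\<alpha>1<..<1} \<Longrightarrow> x1 < s' \<alpha>"
    and S_le: "\<And>\<alpha>. \<alpha> \<in> {\<alpha>1<..<1} \<Longrightarrow> S' \<alpha> \<le> B"
    and level_bound: "\<And>\<alpha>. \<alpha> \<in> {\<alpha>1<..<1} \<Longrightarrow> \<bar>(1 - \<alpha>) * lv \<alpha>\<bar> \<le> W"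
begin

lemma near_discounted: "\<alpha> \<in> {\<alpha>1<..<1} \<Longrightarrow> discounted_sS I \<alpha> (s' \<alpha>) (S' \<alpha>)"
  using \<alpha>1 by (intro discounted) auto

lemma excess_locally_bounded:
  "\<exists>E. \<forall>\<alpha>\<in>{\<alpha>1<..<1}. \<forall>x\<in>X. x \<le> R \<longrightarrow> ex \<alpha> x \<le> E"
proof -
  obtain \<delta> where \<delta>: "\<delta> > 0" "prob {\<omega> \<in> space (omega I). D \<omega> > \<delta>} > 0"
    using demand_large_prob by blast
  define p where "p = prob {\<omega> \<in> space (omega I). D \<omega> > \<delta>}"
  obtain n :: nat where "(R - x1) / \<delta> \<le> real n" using real_arch_simple by blast
  then have n: "R \<le> x1 + real n * \<delta>" using \<delta> by (simp add: field_simps)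
  obtain A where A: "\<And>x. x \<in> X \<Longrightarrow> x1 \<le> x \<Longrightarrow> x \<le> R \<Longrightarrow> G x \<le> A"
    using holding_bounded[of x1 R] by blast
  \<comment> \<open>An upper bound for \<open>net\<close> on \<open>[x1, R]\<close> that is free of
    \<alpha>: holding cost, linear term, mean demand cost and normalized level.\<close>
  define F where "F = max 0 A + c * max \<bar>x1\<bar> \<bar>R\<bar> + c * \<mu> + W"
  show ?thesis
  proof (intro exI ballI impI)
    fix \<alpha> x assume \<alpha>: "\<alpha> \<in> {\<alpha>1<..<1}" and x: "x \<in> X" "x \<le> R"
    interpret discounted_sS I \<alpha> "s' \<alpha>" "S' \<alpha>" by (rule near_discounted[OF \<alpha>])
    show "ex \<alpha> x \<le> K + real n * F / p"
    proof (rule excess_le_uniform[OF _ _ \<delta>(1) p_def _ s_ge[OF \<alpha>] x])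
      show "F \<ge> 0"
        unfolding F_def using unit_cost_pos mean_demand_nonneg W_nonneg by simp
      fix y assume y: "y \<in> X" "s' \<alpha> \<le> y" "y \<le> R"
      have y1: "x1 \<le> y" using s_ge[OF \<alpha>] y by simp
      have "(1 - \<alpha>) * (c * y) \<le> \<bar>(1 - \<alpha>) * (c * y)\<bar>" by simp
      also have "\<dots> = (1 - \<alpha>) * (c * \<bar>y\<bar>)"
        using discount unit_cost_pos by (simp add: abs_mult)
      also have "\<dots> \<le> 1 * (c * max \<bar>x1\<bar> \<bar>R\<bar>)"
        using discount unit_cost_pos y y1 by (intro mult_mono mult_left_mono) auto
      finally have "(1 - \<alpha>) * (c * y) \<le> c * max \<bar>x1\<bar> \<bar>R\<bar>" by simp
      moreover have "\<alpha> * (c * \<mu>) \<le> 1 * (c * \<mu>)"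
        using discount unit_cost_pos mean_demand_nonneg by (intro mult_right_mono) auto
      ultimately show "net \<alpha> (S' \<alpha>) y \<le> F"
        using A[OF y(1) y1 y(3)] level_bound[OF \<alpha>] max.cobounded2[of A 0]
        unfolding net_def base_def F_def mult.assoc by linarith
    qed (use \<delta> n x p_def in auto)
  qed
qed

lemma excess_equicontinuous_near:
  assumes "\<epsilon> > 0"
  shows "\<exists>d>0. \<forall>\<alpha>\<in>{\<alpha>1<..<1}. \<forall>x\<in>X. \<forall>y\<in>X. x \<le> R \<longrightarrow> y \<le> R \<longrightarrow>
    \<bar>x - y\<bar> \<le> d \<longrightarrow> \<bar>ex \<alpha> x - ex \<alpha> y\<bar> \<le> \<epsilon>"
  using states
proof (elim disjE)
  assume X: "X = \<int>"
  have "x = y" if xy: "x \<in> X" "y \<in> X" "\<bar>x - y\<bar> \<le> 1 / 2" for x y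
  proof -
    obtain i j where ij: "x = of_int i" "y = of_int j" using xy X by (auto elim!: Ints_cases)
    then have "real_of_int \<bar>i - j\<bar> < 1" using xy(3) by simp
    then have "i = j" by linarith
    then show ?thesis using ij by simp
  qed
  note eq = this
  show ?thesis
  proof (intro exI[of _ "1 / 2"] conjI ballI impI)
    fix \<alpha> x y assume "x \<in> X" "y \<in> X" "\<bar>x - y\<bar> \<le> 1 / 2"
    then show "\<bar>ex \<alpha> x - ex \<alpha> y\<bar> \<le> \<epsilon>" using eq[of x y] assms by simp
  qed simp
next
  assume X: "X = UNIV"
  obtain \<delta> where \<delta>: "\<delta> > 0" "prob {\<omega> \<in> space (omega I). D \<omega> > \<delta>} > 0"
    using demand_large_prob by blast
  define p where "p = prob {\<omega> \<in> space (omega I). D \<omega> > \<delta>}"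
  obtain n :: nat where "(R - x1) / \<delta> \<le> real n" using real_arch_simple by blast
  then have n: "R \<le> x1 + real n * \<delta>" using \<delta> by (simp add: field_simps)
  \<comment> \<open>Chosen so that the loss factor \<open>n / p\<close> of the renewal estimate
    leaves at most \<epsilon>; the added 1 covers n = 0.\<close>
  define F where "F = \<epsilon> * p / (real n + 1)"
  have F: "F > 0" using assms \<delta> by (simp add: F_def p_def)
  have "uniformly_continuous_on {x1..R} G"
    using holding_continuous X by (intro compact_uniformly_continuous) (auto intro: continuous_on_subset)
  then obtain d1 where d1: "d1 > 0"
    "\<And>x y. x \<in> {x1..R} \<Longrightarrow> y \<in> {x1..R} \<Longrightarrow> dist x y < d1 \<Longrightarrow> dist (G x) (G y) < F / 2"
    using F unfolding uniformly_continuous_on_def by (metis half_gt_zero)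
  \<comment> \<open>Half of F is reserved for the holding cost and half for the linear term; the
    quotient \<open>d1 / 2\<close> turns the strict modulus into one valid for distances up to
    d.\<close>
  define d where "d = min (d1 / 2) (F / (2 * c))"
  have d: "d > 0" using d1 F unit_cost_pos by (simp add: d_def)
  have main: "\<bar>ex \<alpha> x - ex \<alpha> y\<bar> \<le> \<epsilon>"
    if \<alpha>: "\<alpha> \<in> {\<alpha>1<..<1}" and xy: "x \<le> y" "y \<le> R" "y - x \<le> d" for \<alpha> x y
  proof -
    interpret discounted_sS I \<alpha> "s' \<alpha>" "S' \<alpha>" by (rule near_discounted[OF \<alpha>])
    have "\<bar>ex \<alpha> x - ex \<alpha> y\<bar> \<le> real n * F / p"
    proof (rule excess_equicontinuous[OF X _ _ \<delta>(1) p_def _ s_ge[OF \<alpha>] xy])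
      fix x y assume xy: "s' \<alpha> \<le> x" "x \<le> y" "y \<le> R" "y - x \<le> d"
      have "\<bar>G x - G y\<bar> \<le> F / 2"
        using d1(2)[of x y] d1(1) xy s_ge[OF \<alpha>] by (simp add: dist_real_def d_def)
      moreover have "\<bar>(1 - \<alpha>) * c * (x - y)\<bar> \<le> F / 2"
      proof -
        have "\<bar>(1 - \<alpha>) * c * (x - y)\<bar> = (1 - \<alpha>) * (c * (y - x))"
          using discount unit_cost_pos xy by (simp add: abs_mult)
        also have "\<dots> \<le> 1 * (c * (F / (2 * c)))"
          using discount unit_cost_pos xy by (intro mult_mono mult_left_mono) (auto simp: d_def)
        finally show ?thesis using unit_cost_pos by simp
      qed
      moreover have "net \<alpha> (S' \<alpha>) x - net \<alpha> (S' \<alpha>) y = (G x - G y) + (1 - \<alpha>) * c * (x - y)"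
        by (simp add: net_def base_def algebra_simps)
      ultimately show "\<bar>net \<alpha> (S' \<alpha>) x - net \<alpha> (S' \<alpha>) y\<bar> \<le> F" by linarith
    qed (use F \<delta> n xy p_def in auto)
    also have "\<dots> = \<epsilon> * (real n / (real n + 1))"
      using \<delta> by (simp add: F_def p_def)
    also have "\<dots> \<le> \<epsilon> * 1"
      using assms by (intro mult_left_mono) auto
    also have "\<dots> = \<epsilon>" by simp
    finally show ?thesis .
  qed
  show ?thesis
  proof (intro exI[of _ d] conjI ballI impI d)
    fix \<alpha> x y assume "\<alpha> \<in> {\<alpha>1<..<1}" "x \<le> R" "y \<le> R" "\<bar>x - y\<bar> \<le> d"
    then show "\<bar>ex \<alpha> x - ex \<alpha> y\<bar> \<le> \<epsilon>"
      using main[of \<alpha> x y] main[of \<alpha> y x] by (cases "x \<le> y") (auto simp: abs_minus_commute)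
  qed
qed

lemma bottom_bound:
  assumes \<alpha>: "\<alpha> \<in> {\<alpha>1<..<1}"
  shows "(1 - \<alpha>) * bottom \<alpha> \<le> W + c * \<bar>x1\<bar>" and "bottom \<alpha> - lv \<alpha> \<le> c * \<bar>x1\<bar>"
proof -
  interpret discounted_sS I \<alpha> "s' \<alpha>" "S' \<alpha>" by (rule near_discounted[OF \<alpha>])
  have "bottom \<alpha> \<le> lv \<alpha> - c * S' \<alpha>"
    using bottom_le[of "S' \<alpha>"] levels by (simp add: level_def)
  moreover have "- (c * S' \<alpha>) \<le> c * \<bar>x1\<bar>"
    using s_ge[OF \<alpha>] levels unit_cost_pos mult_left_mono[of "- S' \<alpha>" "\<bar>x1\<bar>" c] by simp
  ultimately show *: "bottom \<alpha> - lv \<alpha> \<le> c * \<bar>x1\<bar>" by simp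
  have "(1 - \<alpha>) * (bottom \<alpha> - lv \<alpha>) \<le> (1 - \<alpha>) * (c * \<bar>x1\<bar>)"
    using * discount by (intro mult_left_mono) auto
  also have "\<dots> \<le> 1 * (c * \<bar>x1\<bar>)"
    using discount unit_cost_pos by (intro mult_right_mono) auto
  finally show "(1 - \<alpha>) * bottom \<alpha> \<le> W + c * \<bar>x1\<bar>"
    using level_bound[OF \<alpha>] by (simp add: right_diff_distrib abs_le_iff)
qed

text \<open>Comparison with the state S gives one side. For the other, \<open>bottom_ge\<close>
  applies beyond a state where the holding cost exceeds the uniform bound on
  \<open>(1 - \<alpha>) * bottom \<alpha>\<close> by 1.\<close>

lemma bottom_level_bounded:
  obtains C where "\<And>\<alpha>. \<alpha> \<in> {\<alpha>1<..<1} \<Longrightarrow> \<bar>bottom \<alpha> - lv \<alpha>\<bar> \<le> C"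
proof -
  obtain B1 where B1: "B1 \<ge> 0" "\<And>x. x \<in> X \<Longrightarrow> \<bar>x\<bar> > B1 \<Longrightarrow> G x > W + c * \<bar>x1\<bar> + 1"
    using holding_large by blast
  let ?B = "max B B1"
  have "\<bar>bottom \<alpha> - lv \<alpha>\<bar> \<le> max (c * \<bar>x1\<bar>) (c * ?B)" if \<alpha>: "\<alpha> \<in> {\<alpha>1<..<1}" for \<alpha>
  proof -
    interpret discounted_sS I \<alpha> "s' \<alpha>" "S' \<alpha>" by (rule near_discounted[OF \<alpha>])
    have "lv \<alpha> - c * ?B \<le> bottom \<alpha>"
    proof (rule bottom_ge)
      show "s' \<alpha> \<le> ?B" using S_le[OF \<alpha>] levels by simp
      fix y assume "y \<in> X" "?B < y"
      then show "(1 - \<alpha>) * bottom \<alpha> + 1 \<le> G y"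
        using B1(2)[of y] B1(1) bottom_bound(1)[OF \<alpha>] by simp
    qed
    then show ?thesis
      using bottom_bound(2)[OF \<alpha>] max.cobounded1[of "c * \<bar>x1\<bar>" "c * ?B"]
        max.cobounded2[of "c * ?B" "c * \<bar>x1\<bar>"] by linarith
  qed
  then show ?thesis by (rule that)
qed

text \<open>The left side is the relative value. This bound later makes its limit coercive to the
  right, while the term \<open>- c * y\<close> does so to the left.\<close>

lemma rel_value_ge:
  assumes \<alpha>: "\<alpha> \<in> {\<alpha>1<..<1}" and y: "y \<in> X" "s' \<alpha> \<le> y"
  shows "ex \<alpha> y - c * y - (bottom \<alpha> - lv \<alpha>) \<ge> G y - (W + c * \<bar>x1\<bar>)"
proof -
  interpret discounted_sS I \<alpha> "s' \<alpha>" "S' \<alpha>" by (rule near_discounted[OF \<alpha>])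
  show ?thesis
    using value_ge_holding[OF y] bottom_bound(1)[OF \<alpha>] by (simp add: excess_def algebra_simps)
qed

end

subsection \<open>The limit of a convergent subsequence\<close>

text \<open>Here w is the limit of the constant that \<open>net\<close> subtracts in the renewal
  equation, and k the limiting gap between the two normalizations. Pointwise convergence of the
  excess is enough, since the moduli in \<open>near_one\<close> are uniform.\<close>

locale limit_sS = near_one +
  fixes \<beta> :: "nat \<Rightarrow> real" and w s S k :: real and e :: "real \<Rightarrow> real"
  assumes \<beta>_near: "\<And>n. \<beta> n \<in> {\<alpha>1<..<1}" and \<beta>_lim: "\<beta> \<longlonglongrightarrow> 1"
    and s_lim: "(\<lambda>n. s' (\<beta> n)) \<longlonglongrightarrow> s" and S_lim: "(\<lambda>n. S' (\<beta> n)) \<longlonglongrightarrow> S"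
    and level_lim: "(\<lambda>n. (1 - \<beta> n) * level (\<beta> n) (S' (\<beta> n))) \<longlonglongrightarrow> w"
    and bottom_lim: "(\<lambda>n. bottom (\<beta> n) - level (\<beta> n) (S' (\<beta> n))) \<longlonglongrightarrow> k"
    and excess_lim: "\<And>x. x \<in> states I \<Longrightarrow> (\<lambda>n. excess (\<beta> n) (S' (\<beta> n)) x) \<longlonglongrightarrow> e x"
begin

lemma disc: "discounted_sS I (\<beta> n) (s' (\<beta> n)) (S' (\<beta> n))"
  by (rule near_discounted[OF \<beta>_near])

lemma e_nonneg: "x \<in> X \<Longrightarrow> e x \<ge> 0"
  using discounted_sS.excess_nonneg[OF disc] by (intro LIMSEQ_le_const[OF excess_lim]) auto

lemma e_bounded: "\<exists>E. \<forall>x\<in>X. x \<le> R \<longrightarrow> e x \<le> E \<and> (\<forall>n. ex (\<beta> n) x \<le> E)"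
proof -
  obtain E where E: "\<And>\<alpha> x. \<alpha> \<in> {\<alpha>1<..<1} \<Longrightarrow> x \<in> X \<Longrightarrow> x \<le> R \<Longrightarrow> ex \<alpha> x \<le> E"
    using excess_locally_bounded[of R] by blast
  have "e x \<le> E" if "x \<in> X" "x \<le> R" for x
    using E[OF \<beta>_near that] by (intro LIMSEQ_le_const2[OF excess_lim[OF that(1)]]) auto
  then show ?thesis using E[OF \<beta>_near] by blast
qed

lemma e_modulus:
  assumes "\<epsilon> > 0"
  shows "\<exists>d>0. \<forall>x\<in>X. \<forall>y\<in>X. x \<le> R \<longrightarrow> y \<le> R \<longrightarrow> \<bar>x - y\<bar> \<le> d \<longrightarrow>
    \<bar>e x - e y\<bar> \<le> \<epsilon> \<and> (\<forall>n. \<bar>ex (\<beta> n) x - ex (\<beta> n) y\<bar> \<le> \<epsilon>)"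
proof -
  obtain d where d: "d > 0" "\<And>\<alpha> x y. \<alpha> \<in> {\<alpha>1<..<1} \<Longrightarrow> x \<in> X \<Longrightarrow> y \<in> X \<Longrightarrow> x \<le> R \<Longrightarrow> y \<le> R \<Longrightarrow>
    \<bar>x - y\<bar> \<le> d \<Longrightarrow> \<bar>ex \<alpha> x - ex \<alpha> y\<bar> \<le> \<epsilon>"
    using excess_equicontinuous_near[OF assms, of R] by blast
  show ?thesis
  proof (intro exI[of _ d] conjI ballI impI allI d(1))
    fix x y assume xy: "x \<in> X" "y \<in> X" "x \<le> R" "y \<le> R" "\<bar>x - y\<bar> \<le> d"
    show le: "\<bar>ex (\<beta> n) x - ex (\<beta> n) y\<bar> \<le> \<epsilon>" for n
      by (rule d(2)[OF \<beta>_near xy])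
    show "\<bar>e x - e y\<bar> \<le> \<epsilon>"
      using le by (intro LIMSEQ_le_const2[OF tendsto_rabs[OF tendsto_diff[OF excess_lim[OF xy(1)] excess_lim[OF xy(2)]]]]) auto
  qed
qed

lemma continuous_e: "continuous_on X e"
  unfolding continuous_on_iff
proof (intro ballI allI impI)
  fix x \<epsilon> :: real assume x: "x \<in> X" and \<epsilon>: "\<epsilon> > 0"
  obtain d where d: "d > 0" "\<And>y z. y \<in> X \<Longrightarrow> z \<in> X \<Longrightarrow> y \<le> x + 1 \<Longrightarrow> z \<le> x + 1 \<Longrightarrow> \<bar>y - z\<bar> \<le> d \<Longrightarrow> \<bar>e y - e z\<bar> \<le> \<epsilon> / 2"
    using e_modulus[of "\<epsilon> / 2" "x + 1"] half_gt_zero[OF \<epsilon>] by blast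
  have "dist (e y) (e x) < \<epsilon>" if "y \<in> X" "dist y x < min d 1" for y
  proof -
    have "y \<le> x + 1" "\<bar>y - x\<bar> \<le> d" using that(2) by (auto simp: dist_real_def)
    then show ?thesis using d(2)[of y x] that(1) x \<epsilon> by (auto simp: dist_real_def)
  qed
  then show "\<exists>d>0. \<forall>y\<in>X. dist y x < d \<longrightarrow> dist (e y) (e x) < \<epsilon>"
    using d(1) by (intro exI[of _ "min d 1"]) auto
qed

lemma e_measurable: "e \<in> borel_measurable (state_space I)"
  unfolding state_space_def by (rule borel_measurable_continuous_on_restrict[OF continuous_e])

lemma e_integrable:
  assumes "y \<in> X"
  shows "integrable (omega I) (\<lambda>\<omega>. e (y - D \<omega>))"
proof -
  obtain E where "\<And>x. x \<in> X \<Longrightarrow> x \<le> y \<Longrightarrow> e x \<le> E" using e_bounded[of y] by blast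
  then show ?thesis
    using e_nonneg by (intro integrable_le_demand[OF e_measurable assms, of E 0]) auto
qed

text \<open>The uniform modulus upgrades pointwise convergence to convergence along moving
  arguments, as needed for the joint lower limit and for the moving levels
  \<open>S' (\<beta> n)\<close>.\<close>

lemma excess_joint_lim:
  assumes y: "\<And>n. y n \<in> X" "y \<longlonglongrightarrow> x" and x: "x \<in> X"
  shows "(\<lambda>n. ex (\<beta> n) (y n)) \<longlonglongrightarrow> e x"
proof (rule LIMSEQ_I)
  fix \<epsilon> :: real assume \<epsilon>: "\<epsilon> > 0"
  obtain d where d: "d > 0" "\<And>n z z'. z \<in> X \<Longrightarrow> z' \<in> X \<Longrightarrow> z \<le> x + 1 \<Longrightarrow> z' \<le> x + 1 \<Longrightarrow> \<bar>z - z'\<bar> \<le> d \<Longrightarrow>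
      \<bar>ex (\<beta> n) z - ex (\<beta> n) z'\<bar> \<le> \<epsilon> / 2"
    using e_modulus[of "\<epsilon> / 2" "x + 1"] half_gt_zero[OF \<epsilon>] by blast
  have "\<forall>\<^sub>F n in sequentially. dist (y n) x < min d 1"
    using y(2) d(1) by (intro tendstoD) auto
  moreover have "\<forall>\<^sub>F n in sequentially. dist (ex (\<beta> n) x) (e x) < \<epsilon> / 2"
    using excess_lim[OF x] \<epsilon> by (intro tendstoD) auto
  ultimately have "\<forall>\<^sub>F n in sequentially. norm (ex (\<beta> n) (y n) - e x) < \<epsilon>"
  proof eventually_elim
    case (elim n)
    then have "\<bar>ex (\<beta> n) (y n) - ex (\<beta> n) x\<bar> \<le> \<epsilon> / 2"
      using y(1) x by (intro d(2)) (auto simp: dist_real_def)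
    then show ?case
      using elim(2) abs_triangle_ineq[of "ex (\<beta> n) (y n) - ex (\<beta> n) x" "ex (\<beta> n) x - e x"]
      by (simp add: dist_real_def)
  qed
  then show "\<exists>n0. \<forall>n\<ge>n0. norm (ex (\<beta> n) (y n) - e x) < \<epsilon>"
    by (simp add: eventually_sequentially)
qed

lemma mean_excess_lim:
  assumes y: "y \<in> X"
  shows "(\<lambda>n. mean_after I (ex (\<beta> n)) y) \<longlonglongrightarrow> mean_after I e y"
proof -
  obtain E where E: "\<And>n x. x \<in> X \<Longrightarrow> x \<le> y \<Longrightarrow> ex (\<beta> n) x \<le> E"
    using e_bounded[of y] by blast
  show ?thesis
    unfolding mean_after_def
  proof (rule integral_dominated_convergence[where w = "\<lambda>_. E"])
    show "(\<lambda>\<omega>. e (y - D \<omega>)) \<in> borel_measurable (omega I)"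
      by (rule after_measurable_omega[OF e_measurable y])
    show "(\<lambda>\<omega>. ex (\<beta> n) (y - D \<omega>)) \<in> borel_measurable (omega I)" for n
      by (rule after_measurable_omega[OF discounted_sS.excess_measurable[OF disc] y])
    show "AE \<omega> in omega I. (\<lambda>n. ex (\<beta> n) (y - D \<omega>)) \<longlonglongrightarrow> e (y - D \<omega>)"
      using y by (intro AE_I2 excess_lim minus_demand1_state)
    show "AE \<omega> in omega I. norm (ex (\<beta> n) (y - D \<omega>)) \<le> E" for n
    proof (rule AE_I2)
      fix \<omega> assume \<omega>: "\<omega> \<in> space (omega I)"
      show "norm (ex (\<beta> n) (y - D \<omega>)) \<le> E"
        using E[of "y - D \<omega>" n] discounted_sS.excess_nonneg[OF disc, of "y - D \<omega>" n]
          minus_demand1_state[OF \<omega> y] demand1_nonneg[OF \<omega>] by simp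
    qed
  qed simp
qed

text \<open>The limit of \<open>order_excess\<close>; it is the function H of the optimality
  equation up to the constant \<open>w - k\<close>.\<close>

definition h :: "real \<Rightarrow> real" where
  "h y = base 1 y - w + mean_after I e y"

lemma order_excess_lim:
  assumes y: "y \<in> X"
  shows "(\<lambda>n. order_excess (\<beta> n) (S' (\<beta> n)) y) \<longlonglongrightarrow> h y"
proof -
  have "(\<lambda>n. (G y + (1 - \<beta> n) * c * y + \<beta> n * c * \<mu>) - (1 - \<beta> n) * lv (\<beta> n) + \<beta> n * mean_after I (ex (\<beta> n)) y)
      \<longlonglongrightarrow> (G y + (1 - 1) * c * y + 1 * c * \<mu>) - w + 1 * mean_after I e y"
    by (intro tendsto_intros \<beta>_lim level_lim mean_excess_lim[OF y])
  then show ?thesis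
    by (simp add: order_excess_def[abs_def] net_def[abs_def] base_def h_def)
qed

lemma mean_e_le:
  assumes "y \<in> X" "\<And>x. x \<in> X \<Longrightarrow> x \<le> y \<Longrightarrow> e x \<le> b"
  shows "mean_after I e y \<le> b"
  unfolding mean_after_def
  using assms e_integrable[OF assms(1)] minus_demand1_state demand1_nonneg
  by (intro integral_le_const AE_I2) auto

lemma mean_e_ge:
  assumes "y \<in> X" "\<And>x. x \<in> X \<Longrightarrow> x \<le> y \<Longrightarrow> b \<le> e x"
  shows "b \<le> mean_after I e y"
  unfolding mean_after_def
  using assms e_integrable[OF assms(1)] minus_demand1_state demand1_nonneg
  by (intro integral_ge_const AE_I2) auto

lemma continuous_mean_e: "continuous_on X (mean_after I e)"
  unfolding continuous_on_iff
proof (intro ballI allI impI)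
  fix x \<epsilon> :: real assume x: "x \<in> X" and \<epsilon>: "\<epsilon> > 0"
  obtain d where d: "d > 0" "\<And>y z. y \<in> X \<Longrightarrow> z \<in> X \<Longrightarrow> y \<le> x + 1 \<Longrightarrow> z \<le> x + 1 \<Longrightarrow> \<bar>y - z\<bar> \<le> d \<Longrightarrow> \<bar>e y - e z\<bar> \<le> \<epsilon> / 2"
    using e_modulus[of "\<epsilon> / 2" "x + 1"] half_gt_zero[OF \<epsilon>] by blast
  have "dist (mean_after I e y) (mean_after I e x) < \<epsilon>" if y: "y \<in> X" "dist y x < min d 1" for y
  proof -
    have le: "y \<le> x + 1" "\<bar>y - x\<bar> \<le> d" using y by (auto simp: dist_real_def)
    note int = e_integrable[OF y(1)] e_integrable[OF x]
    have "\<bar>mean_after I e y - mean_after I e x\<bar> \<le> (\<integral>\<omega>. \<bar>e (y - D \<omega>) - e (x - D \<omega>)\<bar> \<partial>omega I)"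
      unfolding mean_after_def Bochner_Integration.integral_diff[OF int, symmetric]
      by (rule integral_abs_bound)
    also have "\<dots> \<le> \<epsilon> / 2"
    proof (intro integral_le_const AE_I2)
      fix \<omega> assume \<omega>: "\<omega> \<in> space (omega I)"
      show "\<bar>e (y - D \<omega>) - e (x - D \<omega>)\<bar> \<le> \<epsilon> / 2"
        using minus_demand1_state[OF \<omega>] demand1_nonneg[OF \<omega>] x y(1) le by (intro d(2)) auto
    qed (use int in simp)
    finally show ?thesis using \<epsilon> by (simp add: dist_real_def)
  qed
  then show "\<exists>d>0. \<forall>y\<in>X. dist y x < d \<longrightarrow> dist (mean_after I e y) (mean_after I e x) < \<epsilon>"
    using d(1) by (intro exI[of _ "min d 1"]) auto
qed

lemma continuous_h: "continuous_on X h"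
  unfolding h_def[abs_def] base_def
  by (intro continuous_intros holding_continuous continuous_mean_e)

lemma e_le_h: "x \<in> X \<Longrightarrow> e x \<le> h x"
  using discounted_sS.excess_le_order_excess[OF disc]
  by (intro LIMSEQ_le[OF excess_lim order_excess_lim]) auto

lemma h_nonneg: "x \<in> X \<Longrightarrow> h x \<ge> 0"
  using e_le_h e_nonneg by force

lemma e_le_setup:
  assumes "x \<in> X" "y \<in> X" "x \<le> y"
  shows "e x \<le> K + h y"
  using discounted_sS.excess_le_setup[OF disc assms]
  by (intro LIMSEQ_le[OF excess_lim tendsto_add[OF tendsto_const order_excess_lim]] assms) auto

lemma levels_state: "s \<in> X" "S \<in> X" "s \<le> S"
proof -
  show "s \<in> X" "S \<in> X"
    using discounted_sS.levels[OF disc]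
    by (auto intro: closed_sequentially[OF closed_states _ s_lim] closed_sequentially[OF closed_states _ S_lim])
  show "s \<le> S"
    using discounted_sS.levels(3)[OF disc] by (intro LIMSEQ_le[OF s_lim S_lim]) auto
qed

lemma e_less: "x \<in> X \<Longrightarrow> x < s \<Longrightarrow> e x = K"
proof -
  assume x: "x \<in> X" "x < s"
  have "\<forall>\<^sub>F n in sequentially. x < s' (\<beta> n)" using s_lim x(2) by (rule order_tendstoD)
  then have "\<forall>\<^sub>F n in sequentially. ex (\<beta> n) x = K"
    by eventually_elim (use discounted_sS.excess_less[OF disc] x in auto)
  then have "(\<lambda>n. ex (\<beta> n) x) \<longlonglongrightarrow> K" by (rule tendsto_eventually)
  then show ?thesis using excess_lim[OF x(1)] LIMSEQ_unique by blast
qed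

lemma e_eq_h_eventually:
  assumes x: "x \<in> X" and ev: "\<forall>\<^sub>F n in sequentially. s' (\<beta> n) \<le> x"
  shows "e x = h x"
proof -
  have "\<forall>\<^sub>F n in sequentially. ex (\<beta> n) x = order_excess (\<beta> n) (S' (\<beta> n)) x"
    using ev by eventually_elim (use discounted_sS.excess_ge[OF disc] x in auto)
  from tendsto_cong[OF this] show ?thesis
    using excess_lim[OF x] order_excess_lim[OF x] LIMSEQ_unique by blast
qed

text \<open>At x = s the identity does not pass to the limit directly, because
  \<open>s' (\<beta> n)\<close> may approach s from above. On the integers it eventually equals s;
  on the reals the identity is extended from the right by continuity.\<close>

lemma e_ge:
  assumes x: "x \<in> X" "s \<le> x"
  shows "e x = h x"
proof -
  have greater: "e y = h y" if "y \<in> X" "s < y" for y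
    using order_tendstoD(2)[OF s_lim that(2)] that(1)
    by (intro e_eq_h_eventually) (auto elim: eventually_mono)
  show ?thesis
    using states
  proof (elim disjE)
    assume X: "X = \<int>"
    have "\<forall>\<^sub>F n in sequentially. dist (s' (\<beta> n)) s < 1"
      using s_lim by (intro tendstoD) auto
    then have "\<forall>\<^sub>F n in sequentially. s' (\<beta> n) \<le> x"
    proof eventually_elim
      case (elim n)
      obtain i j where ij: "s' (\<beta> n) = of_int i" "s = of_int j"
        using discounted_sS.levels(1)[OF disc, of n] levels_state(1) X by (auto elim!: Ints_cases)
      then have "real_of_int \<bar>i - j\<bar> < 1" using elim by (simp add: dist_real_def)
      then have "i = j" by linarith
      then show ?case using ij x by simp
    qed
    then show ?thesis by (rule e_eq_h_eventually[OF x(1)])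
  next
    assume X: "X = UNIV"
    have lim: "(\<lambda>n. x + 1 / real (Suc n)) \<longlonglongrightarrow> x"
      using tendsto_add[OF tendsto_const LIMSEQ_inverse_real_of_nat, of x] by (simp add: inverse_eq_divide)
    have "(\<lambda>n. e (x + 1 / real (Suc n))) \<longlonglongrightarrow> e x" "(\<lambda>n. h (x + 1 / real (Suc n))) \<longlonglongrightarrow> h x"
      using continuous_on_tendsto_compose[OF continuous_e lim] continuous_on_tendsto_compose[OF continuous_h lim] X by auto
    moreover have "e (x + 1 / real (Suc n)) = h (x + 1 / real (Suc n))" for n
    proof (rule greater)
      have "0 < 1 / real (Suc n)" by simp
      then show "s < x + 1 / real (Suc n)" using x by linarith
    qed (simp add: X)
    ultimately show ?thesis using LIMSEQ_unique by simp
  qed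
qed

lemma e_S: "e S = 0" "h S = 0"
proof -
  have "(\<lambda>n. ex (\<beta> n) (S' (\<beta> n))) \<longlonglongrightarrow> e S"
    using discounted_sS.levels(2)[OF disc] S_lim levels_state by (intro excess_joint_lim) auto
  then have "(\<lambda>n. 0) \<longlonglongrightarrow> e S"
    by (simp add: discounted_sS.excess_S(1)[OF disc])
  then show "e S = 0" using LIMSEQ_unique tendsto_const by blast
  then show "h S = 0" using e_ge levels_state by simp
qed

lemma e_le_K: "x \<in> X \<Longrightarrow> x \<le> S \<Longrightarrow> e x \<le> K"
  using e_le_setup[of x S] levels_state e_S by simp

definition u :: "real \<Rightarrow> real" where
  "u x = e x - c * x - k"

lemma rel_value_lim:
  assumes y: "\<And>n. y n \<in> X" "y \<longlonglongrightarrow> x" and x: "x \<in> X"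
  shows "(\<lambda>n. rel_value I (\<beta> n) (y n)) \<longlonglongrightarrow> ereal (u x)"
proof -
  have "rel_value I (\<beta> n) (y n) = ereal (ex (\<beta> n) (y n) - c * y n - (bottom (\<beta> n) - lv (\<beta> n)))" for n
    by (rule discounted_sS.rel_value_eq[OF disc y(1)])
  then show ?thesis
    unfolding u_def using excess_joint_lim[OF y x] y(2) bottom_lim
    by (simp, intro tendsto_intros)
qed

lemma joint_liminf_eq:
  assumes x: "x \<in> X"
  shows "joint_liminf X (\<lambda>n. rel_value I (\<beta> n)) x = ereal (u x)"
proof -
  have "liminf (\<lambda>n. rel_value I (\<beta> n) (y n)) = ereal (u x)" if "\<And>n. y n \<in> X" "y \<longlonglongrightarrow> x" for y
    using rel_value_lim[OF that x] by (intro lim_imp_Liminf) auto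
  moreover have "(\<lambda>_. x) \<in> {y. (\<forall>n. y n \<in> X) \<and> y \<longlonglongrightarrow> x}" using x by simp
  ultimately show ?thesis
    unfolding joint_liminf_def by (intro INF_eq_const) auto
qed

lemma u_nonneg:
  assumes x: "x \<in> X"
  shows "u x \<ge> 0"
proof -
  have "(\<lambda>n. ex (\<beta> n) x - c * x - (bottom (\<beta> n) - lv (\<beta> n))) \<longlonglongrightarrow> u x"
    unfolding u_def by (intro tendsto_intros excess_lim x bottom_lim)
  moreover have "ex (\<beta> n) x - c * x - (bottom (\<beta> n) - lv (\<beta> n)) \<ge> 0" for n
    using discounted_sS.bottom_le[OF disc x, of n] by (simp add: excess_def)
  ultimately show ?thesis by (intro LIMSEQ_le_const) auto
qed

lemma u_ge:
  assumes x: "x \<in> X" "s < x"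
  shows "u x \<ge> G x - (W + c * \<bar>x1\<bar>)"
proof -
  have "(\<lambda>n. ex (\<beta> n) x - c * x - (bottom (\<beta> n) - lv (\<beta> n))) \<longlonglongrightarrow> u x"
    unfolding u_def by (intro tendsto_intros excess_lim x bottom_lim)
  moreover have "\<forall>\<^sub>F n in sequentially. G x - (W + c * \<bar>x1\<bar>) \<le> ex (\<beta> n) x - c * x - (bottom (\<beta> n) - lv (\<beta> n))"
    using order_tendstoD(2)[OF s_lim x(2)]
    by eventually_elim (use rel_value_ge[OF \<beta>_near x(1)] in auto)
  ultimately show ?thesis by (rule tendsto_lowerbound) simp
qed

lemma continuous_u: "continuous_on X u"
  unfolding u_def[abs_def] by (intro continuous_intros continuous_e)

lemma u_measurable: "u \<in> borel_measurable (state_space I)"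
  unfolding state_space_def by (rule borel_measurable_continuous_on_restrict[OF continuous_u])

lemma inf_compact_onI:
  assumes "continuous_on X f" "\<And>l. \<exists>a b. \<forall>x\<in>X. f x \<le> l \<longrightarrow> a \<le> x \<and> x \<le> b"
  shows "inf_compact_on X f"
  unfolding inf_compact_on_def
proof
  fix l
  obtain a b where ab: "\<forall>x\<in>X. f x \<le> l \<longrightarrow> a \<le> x \<and> x \<le> b" using assms(2) by blast
  have "closed (X \<inter> f -` {..l})"
    using assms(1) closed_states by (rule continuous_closed_preimage) simp
  moreover have "X \<inter> f -` {..l} = {x \<in> X. f x \<le> l}" by auto
  moreover have "bounded {x \<in> X. f x \<le> l}"
    by (rule bounded_subset[OF bounded_closed_interval[of a b]]) (use ab in auto)
  ultimately show "compact {x \<in> X. f x \<le> l}" by (simp add: compact_eq_bounded_closed)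
qed

text \<open>To the left the linear term forces growth because the excess is nonnegative; to the
  right the holding cost does.\<close>

lemma inf_compact_u: "inf_compact_on X u"
proof (rule inf_compact_onI[OF continuous_u])
  fix l
  obtain B1 where B1: "B1 \<ge> 0" "\<And>x. x \<in> X \<Longrightarrow> \<bar>x\<bar> > B1 \<Longrightarrow> G x > l + (W + c * \<bar>x1\<bar>)"
    using holding_large by blast
  have "- (l + k) / c \<le> x \<and> x \<le> max \<bar>s\<bar> B1" if x: "x \<in> X" "u x \<le> l" for x
  proof
    have "- (l + k) \<le> c * x" using x e_nonneg[OF x(1)] by (simp add: u_def)
    then show "- (l + k) / c \<le> x" using unit_cost_pos by (simp add: field_simps)
    show "x \<le> max \<bar>s\<bar> B1"
    proof (rule ccontr)
      assume "\<not> ?thesis"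
      then have "s < x" "\<bar>x\<bar> > B1" by auto
      then show False using u_ge[OF x(1)] B1(2)[OF x(1)] x(2) by simp
    qed
  qed
  then show "\<exists>a b. \<forall>x\<in>X. u x \<le> l \<longrightarrow> a \<le> x \<and> x \<le> b" by blast
qed

lemma h_sublevel: "\<exists>a b. \<forall>x\<in>X. h x \<le> l \<longrightarrow> a \<le> x \<and> x \<le> b"
proof -
  obtain B1 where B1: "B1 \<ge> 0" "\<And>x. x \<in> X \<Longrightarrow> \<bar>x\<bar> > B1 \<Longrightarrow> G x > l + w"
    using holding_large by blast
  have "- B1 \<le> x \<and> x \<le> B1" if x: "x \<in> X" "h x \<le> l" for x
  proof -
    have "mean_after I e x \<ge> 0" using x e_nonneg by (intro mean_e_ge) auto
    moreover have "c * \<mu> \<ge> 0" using unit_cost_pos mean_demand_nonneg by simp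
    ultimately have "G x \<le> l + w" using x by (simp add: h_def base_def)
    then have "\<not> \<bar>x\<bar> > B1" using B1(2)[OF x(1)] by auto
    then show ?thesis by auto
  qed
  then show ?thesis by blast
qed

lemma u_integrable:
  assumes "x \<in> X"
  shows "integrable (omega I) (\<lambda>\<omega>. u (x - D \<omega>))"
  unfolding u_def using e_integrable[OF assms] demand_integrable by (simp add: right_diff_distrib)

lemma mean_u:
  assumes "x \<in> X"
  shows "mean_after I u x = mean_after I e x - c * (x - \<mu>) - k"
  unfolding mean_after_def mean_demand_def u_def
  using e_integrable[OF assms] demand_integrable by (simp add: right_diff_distrib prob_space)

lemma order_fun_eq: "x \<in> X \<Longrightarrow> order_fun I u x = h x + (w - k)"
  by (simp add: order_fun_def mean_u h_def base_def algebra_simps)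

lemma continuous_order_fun: "continuous_on X (order_fun I u)"
  using continuous_on_add[OF continuous_h continuous_on_const, of "w - k"]
  by (rule continuous_on_eq) (simp add: order_fun_eq)

lemma inf_compact_order_fun: "inf_compact_on X (order_fun I u)"
proof (rule inf_compact_onI[OF continuous_order_fun])
  fix l
  obtain a b where "\<forall>x\<in>X. h x \<le> l - (w - k) \<longrightarrow> a \<le> x \<and> x \<le> b" using h_sublevel by blast
  then show "\<exists>a b. \<forall>x\<in>X. order_fun I u x \<le> l \<longrightarrow> a \<le> x \<and> x \<le> b"
    by (intro exI[of _ a] exI[of _ b]) (auto simp: order_fun_eq)
qed

lemma h_attains_min_above:
  assumes x: "x \<in> X"
  obtains y where "y \<in> X" "x \<le> y" "\<And>z. z \<in> X \<Longrightarrow> x \<le> z \<Longrightarrow> h y \<le> h z"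
proof -
  have "inf_compact_on X h"
    using continuous_h h_sublevel by (rule inf_compact_onI)
  then have cpt: "compact ({y \<in> X. h y \<le> h x} \<inter> {x..})"
    unfolding inf_compact_on_def by (intro compact_Int_closed) auto
  have ne: "{y \<in> X. h y \<le> h x} \<inter> {x..} \<noteq> {}" using x by auto
  have "continuous_on ({y \<in> X. h y \<le> h x} \<inter> {x..}) h"
    by (rule continuous_on_subset[OF continuous_h]) auto
  from continuous_attains_inf[OF cpt ne this] obtain y where y: "y \<in> {y \<in> X. h y \<le> h x} \<inter> {x..}"
    "\<And>z. z \<in> {y \<in> X. h y \<le> h x} \<inter> {x..} \<Longrightarrow> h y \<le> h z"
    by blast
  show ?thesis
  proof (rule that[of y])
    fix z assume z: "z \<in> X" "x \<le> z"
    show "h y \<le> h z" using y z by (cases "h z \<le> h x") auto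
  qed (use y in auto)
qed

text \<open>Isolates what a policy must satisfy, since the minimum equation does not involve it.
  Both the limiting policy and the one with the threshold defined by an infimum are checked against
  this criterion.\<close>

lemma avg_optimality_eqI:
  assumes "\<And>x. x \<in> X \<Longrightarrow> \<phi> x = 0 \<and> e x = h x \<or> \<phi> x > 0 \<and> x + \<phi> x = S \<and> e x = K"
  shows "avg_optimality_eq I w u \<phi>"
  unfolding avg_optimality_eq_def
proof (intro ballI conjI)
  fix x assume x: "x \<in> X"
  show "w + u x = K * of_bool (\<phi> x > 0) + order_fun I u (x + \<phi> x) - c * x"
    using assms[OF x] x levels_state e_S by (auto simp: order_fun_eq u_def)
  obtain y where y: "y \<in> X" "x \<le> y" "\<And>z. z \<in> X \<Longrightarrow> x \<le> z \<Longrightarrow> h y \<le> h z"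
    using h_attains_min_above[OF x] by blast
  have a: "y - x \<in> actions I" using y x by (auto simp: actions_def intro: states_diff)
  have "is_arg_min (\<lambda>a. K + order_fun I u (x + a)) (\<lambda>a. a \<in> actions I) (y - x)"
    unfolding is_arg_min_linorder
  proof (intro conjI a allI impI)
    fix a assume "a \<in> actions I"
    then have "x + a \<in> X" "x \<le> x + a" using x by (auto simp: actions_def intro: states_add)
    then show "K + order_fun I u (x + (y - x)) \<le> K + order_fun I u (x + a)"
      using y by (simp add: order_fun_eq)
  qed
  \<comment> \<open>Below s the minimum above x is at most \<open>h S = 0\<close>, and
    \<open>e x = K \<le> K + h y\<close> forces equality. From s on, \<open>e x = h x\<close> is
    already at most \<open>K + h y\<close>.\<close>
  moreover have "e x = min (K + h y) (h x)"
  proof (cases "x < s")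
    case True
    then have "h y \<le> 0" using y(3)[of S] levels_state e_S by simp
    then show ?thesis using e_less[OF x True] e_le_setup[OF x y(1,2)] e_le_h[OF x] by simp
  next
    case False
    then show ?thesis using e_ge[OF x] e_le_setup[OF x y(1,2)] by simp
  qed
  then have "w + u x = min (K + order_fun I u (x + (y - x))) (order_fun I u x) - c * x"
    using x y(1) by (simp add: order_fun_eq u_def min_def)
  ultimately show "\<exists>a. is_arg_min (\<lambda>a. K + order_fun I u (x + a)) (\<lambda>a. a \<in> actions I) a \<and>
      w + u x = min (K + order_fun I u (x + a)) (order_fun I u x) - c * x"
    by blast
qed

lemma limit_sS_policy: "avg_optimality_eq I w u (sS_policy s S)"
  by (rule avg_optimality_eqI) (use levels_state e_less e_ge in \<open>auto simp: sS_policy_def\<close>)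

text \<open>The gap between minimal value and level converges, so it disappears after multiplication
  by \<open>1 - \<beta> n\<close>.\<close>

lemma bottom_disc_lim: "(\<lambda>n. (1 - \<beta> n) * bottom (\<beta> n)) \<longlonglongrightarrow> w"
proof -
  have "(\<lambda>n. (1 - \<beta> n) * (bottom (\<beta> n) - lv (\<beta> n)) + (1 - \<beta> n) * lv (\<beta> n)) \<longlonglongrightarrow> (1 - 1) * k + w"
    by (intro tendsto_intros \<beta>_lim bottom_lim level_lim)
  then show ?thesis by (simp add: algebra_simps)
qed

lemma w_nonneg: "w \<ge> 0"
proof (rule LIMSEQ_le_const[OF bottom_disc_lim])
  have "0 \<le> (1 - \<beta> n) * bottom (\<beta> n)" for n
    using discounted_sS.bottom_nonneg[OF disc] discounted_sS.discount[OF disc, of n] by simp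
  then show "\<exists>N. \<forall>n\<ge>N. 0 \<le> (1 - \<beta> n) * bottom (\<beta> n)" by blast
qed

lemma avg_cost_le_w:
  assumes \<phi>: "\<phi> \<in> stationary_policies I" and eq: "avg_optimality_eq I w u \<phi>" and x: "x \<in> X"
  shows "avg_cost I (stationary I \<phi>) x \<le> ennreal w"
proof (rule avg_cost_le[OF \<phi> w_nonneg u_measurable u_nonneg u_integrable _ x])
  fix y assume y: "y \<in> X"
  then show "cost I y (\<phi> y) + mean_after I u (y + \<phi> y) = w + u y"
    using eq by (simp add: avg_optimality_eq_def cost_def order_fun_def algebra_simps)
qed

lemma avg_cost_ge_w:
  assumes "\<pi> \<in> policies I" "x \<in> X"
  shows "ennreal w \<le> avg_cost I \<pi> x"
  using discounted_sS.discount[OF disc] discounted_sS.min_value_eq[OF disc] discounted_sS.bottom_nonneg[OF disc]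
  by (intro avg_cost_ge[OF assms _ _ \<beta>_lim _ _ bottom_disc_lim]) (auto intro: less_imp_le)

lemma avg_optimalI:
  assumes \<phi>: "\<phi> \<in> stationary_policies I" and eq: "avg_optimality_eq I w u \<phi>"
  shows "avg_optimal I \<phi>"
  unfolding avg_optimal_def
proof (intro conjI ballI \<phi> antisym)
  fix x assume x: "x \<in> X"
  show "avg_cost I (stationary I \<phi>) x \<le> (INF \<pi>\<in>policies I. avg_cost I \<pi> x)"
    using avg_cost_le_w[OF \<phi> eq x] avg_cost_ge_w[OF _ x] by (intro INF_greatest) (rule order_trans)
  show "(INF \<pi>\<in>policies I. avg_cost I \<pi> x) \<le> avg_cost I (stationary I \<phi>) x"
    by (intro INF_lower stationary_in_policies \<phi>)
qed

text \<open>Below \<open>s\<close> the function \<open>h\<close> differs from the quasiconvex function \<open>base 1\<close> by a constant, so its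
  sublevel set between \<open>t\<close> and \<open>s\<close> has no gaps.\<close>

lemma second_sS_policy:
  defines "t \<equiv> Inf {x \<in> X. x \<le> S \<and> h x \<le> K}"
  shows "t \<in> X" "t \<le> S" "avg_optimality_eq I w u (sS_policy t S)"
proof -
  let ?A = "{x \<in> X. x \<le> S \<and> h x \<le> K}"
  obtain a b where ab: "\<forall>x\<in>X. h x \<le> K \<longrightarrow> a \<le> x \<and> x \<le> b" using h_sublevel by blast
  have S: "S \<in> ?A" using levels_state e_S setup_cost_pos by simp
  have bdd: "bdd_below ?A" using ab by (intro bdd_belowI[of _ a]) auto
  have "closed (X \<inter> h -` {..K})"
    using continuous_h closed_states by (rule continuous_closed_preimage) simp
  then have "closed (X \<inter> h -` {..K} \<inter> {..S})" by (rule closed_Int) simp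
  moreover have "X \<inter> h -` {..K} \<inter> {..S} = ?A" by auto
  ultimately have "t \<in> ?A"
    unfolding t_def using S bdd by (intro closed_contains_Inf) auto
  then have t: "t \<in> X" "t \<le> S" and ht: "h t \<le> K" by auto
  then show "t \<in> X" "t \<le> S" by simp_all
  have below: "x \<in> X \<Longrightarrow> x < t \<Longrightarrow> h x > K" for x
    using cInf_lower[OF _ bdd, of x] t by (fastforce simp: t_def[symmetric])
  have h_below_s: "h x = base 1 x - w + K" if x: "x \<in> X" "x < s" for x
  proof -
    have "mean_after I e x = K"
      using x by (intro antisym mean_e_le mean_e_ge) (auto simp: e_less)
    then show ?thesis by (simp add: h_def)
  qed
  \<comment> \<open>By \<open>e s = h s\<close> the difference \<open>base 1 s - w\<close> equals
    the excess at s minus its mean after one demand, and that mean is at least the excess.\<close>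
  have base_s: "base 1 s \<le> w"
  proof -
    have "e s \<le> mean_after I e s"
      using levels_state e_le_K[of s] e_less by (intro mean_e_ge) (auto simp: order_le_less)
    then show ?thesis using e_ge[of s] levels_state by (simp add: h_def)
  qed
  show "avg_optimality_eq I w u (sS_policy t S)"
  proof (rule avg_optimality_eqI)
    fix x assume x: "x \<in> X"
    show "sS_policy t S x = 0 \<and> e x = h x \<or> sS_policy t S x > 0 \<and> x + sS_policy t S x = S \<and> e x = K"
    proof (cases "x < t")
      case True
      \<comment> \<open>From s up to S one has \<open>h = e \<le> K\<close>, whereas left of t the
        value of h exceeds K; thus ordering happens only where the excess is K.\<close>
      then have "\<not> s \<le> x" using below[OF x] e_ge[OF x] e_le_K[OF x] t by fastforce
      then show ?thesis using True t e_less[OF x] by (simp add: sS_policy_def)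
    next
      case False
      have "e x = h x"
      proof (cases "s \<le> x")
        case True then show ?thesis by (rule e_ge[OF x])
      next
        case F: False
        have "base 1 t \<le> w" using h_below_s[of t] t ht F False by simp
        \<comment> \<open>Quasiconvexity at discount factor 1, applied between t and s: it gives
          \<open>h x \<le> K = e x \<le> h x\<close>, so not ordering is optimal at x too.\<close>
        then have "base 1 x \<le> w"
          using base_quasiconvex[of 1 t x s] base_s t x levels_state F False threshold by simp
        then show ?thesis using h_below_s[OF x] e_less[OF x] e_le_h[OF x] F by simp
      qed
      then show ?thesis using False by (simp add: sS_policy_def)
    qed
  qed
qed

end

section \<open>Compactness of the family and convergence of the normalized minimal values\<close>

context near_one
begin

lemma rational_state_near:
  assumes "x \<in> X" "d > 0"
  obtains q where "q \<in> X \<inter> \<rat>" "\<bar>x - q\<bar> \<le> d"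
  using states
proof (elim disjE)
  assume "X = \<int>"
  then show ?thesis using that[of x] assms Ints_subset_Rats by auto
next
  assume X: "X = UNIV"
  obtain q where "q \<in> \<rat>" "x < q" "q < x + d"
    using Rats_dense_in_real[of x "x + d"] assms by auto
  then show ?thesis using that[of q] X by auto
qed

text \<open>An Arzela-Ascoli argument: the four scalars converge along a subsequence by boundedness,
  diagonal extraction gives convergence of the excess at the rational states, and equicontinuity
  extends it to all states.\<close>

lemma convergent_subsequence:
  assumes \<beta>: "\<And>n. \<beta> n \<in> {\<alpha>1<..<1}" "\<beta> \<longlonglongrightarrow> 1"
  shows "\<exists>r w s S k e. strict_mono (r :: nat \<Rightarrow> nat) \<and>
    limit_sS I \<alpha>0 s' S' \<alpha>1 x1 B W (\<beta> \<circ> r) w s S k e"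
proof -
  obtain C where C: "\<And>\<alpha>. \<alpha> \<in> {\<alpha>1<..<1} \<Longrightarrow> \<bar>bottom \<alpha> - lv \<alpha>\<bar> \<le> C"
    using bottom_level_bounded by metis
  define Z where "Z n = (s' (\<beta> n), S' (\<beta> n), (1 - \<beta> n) * lv (\<beta> n), bottom (\<beta> n) - lv (\<beta> n))" for n
  have "Z n \<in> {x1..B} \<times> {x1..B} \<times> {-W..W} \<times> {-C..C}" for n
  proof -
    have "x1 < s' (\<beta> n)" "s' (\<beta> n) \<le> S' (\<beta> n)" "S' (\<beta> n) \<le> B"
      using s_ge[OF \<beta>(1)] S_le[OF \<beta>(1)] discounted_sS.levels(3)[OF near_discounted[OF \<beta>(1)]] by auto
    then show ?thesis
      using level_bound[OF \<beta>(1), of n] C[OF \<beta>(1), of n] by (auto simp: Z_def abs_le_iff)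
  qed
  then have "range Z \<subseteq> {x1..B} \<times> {x1..B} \<times> {-W..W} \<times> {-C..C}" by blast
  then have "bounded (range Z)"
    by (rule bounded_subset[rotated]) (intro bounded_Times bounded_closed_interval)
  then obtain l r1 where r1: "strict_mono r1" "(Z \<circ> r1) \<longlonglongrightarrow> l"
    using bounded_imp_convergent_subsequence by blast
  have "\<exists>E. \<forall>n. \<bar>ex (\<beta> n) x\<bar> \<le> E" if x: "x \<in> X" for x
  proof -
    obtain E where "\<And>\<alpha> y. \<alpha> \<in> {\<alpha>1<..<1} \<Longrightarrow> y \<in> X \<Longrightarrow> y \<le> x \<Longrightarrow> ex \<alpha> y \<le> E"
      using excess_locally_bounded[of x] by blast
    then have "\<bar>ex (\<beta> n) x\<bar> \<le> E" for n
      using \<beta>(1) x discounted_sS.excess_nonneg[OF near_discounted[OF \<beta>(1)] x, of n] by simp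
    then show ?thesis by blast
  qed
  then obtain E where E: "\<And>x n. x \<in> X \<Longrightarrow> \<bar>ex (\<beta> n) x\<bar> \<le> E x" by metis
  \<comment> \<open>The bounds \<open>E x\<close> vary with x, while the diagonal extraction is
    applied with a common bound; dividing by \<open>b x\<close> normalizes it to 1 and is undone
    afterwards.\<close>
  define b where "b x = max 1 (E x)" for x
  have b: "b x > 0" "E x \<le> b x" for x by (auto simp: b_def)
  obtain r2 where r2: "strict_mono r2"
    "\<And>x. x \<in> X \<inter> \<rat> \<Longrightarrow> \<exists>l. (\<lambda>n. ex (\<beta> (r1 (r2 n))) x / b x) \<longlonglongrightarrow> l"
  proof (rule function_convergent_subsequence[of "X \<inter> \<rat>" "\<lambda>n x. ex (\<beta> (r1 n)) x / b x" 1])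
    show "countable (X \<inter> \<rat>)" using countable_rat by (rule countable_subset[rotated]) auto
    fix n x assume "x \<in> X \<inter> \<rat>"
    then have "\<bar>ex (\<beta> (r1 n)) x\<bar> \<le> b x" using E[of x "r1 n"] b(2)[of x] by auto
    then show "norm (ex (\<beta> (r1 n)) x / b x) \<le> 1"
      using b(1)[of x] by (simp add: abs_div_pos[symmetric] field_simps)
  qed blast
  define r where "r = r1 \<circ> r2"
  have r: "strict_mono r" using r1(1) r2(1) by (simp add: r_def strict_mono_o)
  have rat: "\<exists>l. (\<lambda>n. ex (\<beta> (r n)) q) \<longlonglongrightarrow> l" if q: "q \<in> X \<inter> \<rat>" for q
  proof -
    obtain l where "(\<lambda>n. ex (\<beta> (r1 (r2 n))) q / b q) \<longlonglongrightarrow> l" using r2(2)[OF q] by blast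
    then have "(\<lambda>n. ex (\<beta> (r1 (r2 n))) q / b q * b q) \<longlonglongrightarrow> l * b q" by (intro tendsto_intros)
    then show ?thesis using b(1)[of q] by (auto simp: r_def)
  qed
  have "convergent (\<lambda>n. ex (\<beta> (r n)) x)" if x: "x \<in> X" for x
  proof -
    have "Cauchy (\<lambda>n. ex (\<beta> (r n)) x)"
    proof (rule metric_CauchyI)
      fix \<epsilon> :: real assume \<epsilon>: "\<epsilon> > 0"
      then have "\<epsilon> / 4 > 0" by simp
      then obtain d where d: "d > 0" "\<And>\<alpha> y z. \<alpha> \<in> {\<alpha>1<..<1} \<Longrightarrow> y \<in> X \<Longrightarrow> z \<in> X \<Longrightarrow> y \<le> x + 1 \<Longrightarrow> z \<le> x + 1 \<Longrightarrow>
          \<bar>y - z\<bar> \<le> d \<Longrightarrow> \<bar>ex \<alpha> y - ex \<alpha> z\<bar> \<le> \<epsilon> / 4"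
        using excess_equicontinuous_near[of "\<epsilon> / 4" "x + 1"] by blast
      obtain q where q: "q \<in> X \<inter> \<rat>" "\<bar>x - q\<bar> \<le> min d 1"
        using rational_state_near[OF x, of "min d 1"] d(1) by auto
      have near: "\<bar>ex (\<beta> (r n)) x - ex (\<beta> (r n)) q\<bar> \<le> \<epsilon> / 4" for n
        using q x by (intro d(2) \<beta>(1)) auto
      have "Cauchy (\<lambda>n. ex (\<beta> (r n)) q)"
        using rat[OF q(1)] by (auto intro: LIMSEQ_imp_Cauchy)
      then obtain N where N: "\<And>m n. m \<ge> N \<Longrightarrow> n \<ge> N \<Longrightarrow> dist (ex (\<beta> (r m)) q) (ex (\<beta> (r n)) q) < \<epsilon> / 4"
        using metric_CauchyD[OF _ \<open>\<epsilon> / 4 > 0\<close>] by blast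
      show "\<exists>N. \<forall>m\<ge>N. \<forall>n\<ge>N. dist (ex (\<beta> (r m)) x) (ex (\<beta> (r n)) x) < \<epsilon>"
      proof (intro exI[of _ N] allI impI)
        fix m n assume "N \<le> m" "N \<le> n"
        then have "\<bar>ex (\<beta> (r m)) q - ex (\<beta> (r n)) q\<bar> < \<epsilon> / 4"
          using N by (simp add: dist_real_def)
        then show "dist (ex (\<beta> (r m)) x) (ex (\<beta> (r n)) x) < \<epsilon>"
          using near[of m] near[of n] \<epsilon> unfolding dist_real_def by linarith
      qed
    qed
    then show ?thesis by (simp add: Cauchy_convergent_iff)
  qed
  then have "(\<lambda>n. ex (\<beta> (r n)) x) \<longlonglongrightarrow> lim (\<lambda>n. ex (\<beta> (r n)) x)" if "x \<in> X" for x
    using that by (simp add: convergent_LIMSEQ_iff)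
  note e_lim = this
  have Zr: "(\<lambda>n. Z (r n)) \<longlonglongrightarrow> l"
    using LIMSEQ_subseq_LIMSEQ[OF r1(2) r2(1)] by (simp add: r_def comp_def)
  obtain s S w k where l: "l = (s, S, w, k)" by (cases l) auto
  have "(\<lambda>n. s' (\<beta> (r n))) \<longlonglongrightarrow> s" "(\<lambda>n. S' (\<beta> (r n))) \<longlonglongrightarrow> S"
    "(\<lambda>n. (1 - \<beta> (r n)) * lv (\<beta> (r n))) \<longlonglongrightarrow> w" "(\<lambda>n. bottom (\<beta> (r n)) - lv (\<beta> (r n))) \<longlonglongrightarrow> k"
    using tendsto_fst[OF Zr] tendsto_fst[OF tendsto_snd[OF Zr]]
      tendsto_fst[OF tendsto_snd[OF tendsto_snd[OF Zr]]] tendsto_snd[OF tendsto_snd[OF tendsto_snd[OF Zr]]]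
    by (simp_all add: Z_def l)
  then have "limit_sS I \<alpha>0 s' S' \<alpha>1 x1 B W (\<beta> \<circ> r) w s S k (\<lambda>x. lim (\<lambda>n. ex (\<beta> (r n)) x))"
    using \<beta> LIMSEQ_subseq_LIMSEQ[OF \<beta>(2) r] e_lim near_one_axioms
    by (auto simp: limit_sS_def limit_sS_axioms_def)
  then show ?thesis using r by blast
qed

text \<open>The limiting policy of one sequence has average cost at most its own constant, while
  every policy costs at least the constant of the other sequence. Exchanging the roles gives
  equality.\<close>

lemma limit_cost_unique:
  assumes 1: "limit_sS I \<alpha>0 s' S' \<alpha>1 x1 B W \<beta> w s S k e"
    and 2: "limit_sS I \<alpha>0 s' S' \<alpha>1 x1 B W \<gamma> w2 s2 S2 k2 e2"
  shows "w \<le> w2"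
proof -
  interpret L: limit_sS I \<alpha>0 s' S' \<alpha>1 x1 B W \<beta> w s S k e by (rule 1)
  interpret L2: limit_sS I \<alpha>0 s' S' \<alpha>1 x1 B W \<gamma> w2 s2 S2 k2 e2 by (rule 2)
  have \<phi>: "sS_policy s2 S2 \<in> stationary_policies I"
    by (rule sS_policy_stationary[OF L2.levels_state])
  have "ennreal w \<le> avg_cost I (stationary I (sS_policy s2 S2)) 0"
    by (intro L.avg_cost_ge_w stationary_in_policies \<phi> zero_state)
  also have "\<dots> \<le> ennreal w2"
    by (rule L2.avg_cost_le_w[OF \<phi> L2.limit_sS_policy zero_state])
  finally show ?thesis using L2.w_nonneg by simp
qed

lemma min_value_limit:
  obtains w where
    "((\<lambda>\<alpha>. ereal (1 - \<alpha>) * enn2ereal (min_value I \<alpha>)) \<longlongrightarrow> ereal w) (at_left 1)"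
    "\<And>\<beta> w2 s S k e. limit_sS I \<alpha>0 s' S' \<alpha>1 x1 B W \<beta> w2 s S k e \<Longrightarrow> w2 = w"
proof -
  \<comment> \<open>Any sequence in the admissible range that tends to 1 would do; it only serves to
    produce one limiting constant.\<close>
  let ?\<beta> = "\<lambda>n. 1 - (1 - \<alpha>1) * (1 / real (Suc (Suc n)))"
  have frac: "0 < 1 / real (Suc (Suc n))" "1 / real (Suc (Suc n)) < 1" for n by auto
  have "?\<beta> n \<in> {\<alpha>1<..<1}" for n
  proof -
    have "0 < (1 - \<alpha>1) * (1 / real (Suc (Suc n)))" "(1 - \<alpha>1) * (1 / real (Suc (Suc n))) < (1 - \<alpha>1) * 1"
      using frac[of n] \<alpha>1 by (intro mult_pos_pos mult_strict_left_mono; simp)+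
    then show ?thesis by simp
  qed
  moreover have "?\<beta> \<longlonglongrightarrow> 1 - (1 - \<alpha>1) * 0"
    by (intro tendsto_intros LIMSEQ_Suc[OF LIMSEQ_Suc[OF lim_1_over_n]])
  ultimately obtain r w s S k e where first:
    "limit_sS I \<alpha>0 s' S' \<alpha>1 x1 B W (?\<beta> \<circ> r) w s S k e"
    using convergent_subsequence[of ?\<beta>] by auto
  have unique: "w2 = w" if "limit_sS I \<alpha>0 s' S' \<alpha>1 x1 B W \<beta> w2 s S k e" for \<beta> w2 s S k e
    using limit_cost_unique[OF that first] limit_cost_unique[OF first that] by simp
  have "((\<lambda>\<alpha>. (1 - \<alpha>) * bottom \<alpha>) \<longlongrightarrow> w) (at_left 1)"
  proof (rule tendsto_at_left_sequentially[OF \<alpha>1(2)])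
    fix \<beta> :: "nat \<Rightarrow> real" assume \<beta>: "\<And>n. \<beta> n < 1" "\<And>n. \<alpha>1 < \<beta> n" "\<beta> \<longlonglongrightarrow> 1"
    show "(\<lambda>n. (1 - \<beta> n) * bottom (\<beta> n)) \<longlonglongrightarrow> w"
    proof (rule ccontr)
      assume "\<not> ?thesis"
      then obtain \<epsilon> where \<epsilon>: "\<epsilon> > 0" "\<not> (\<forall>\<^sub>F n in sequentially. dist ((1 - \<beta> n) * bottom (\<beta> n)) w < \<epsilon>)"
        by (auto simp: tendsto_iff)
      have "infinite {n. dist ((1 - \<beta> n) * bottom (\<beta> n)) w \<ge> \<epsilon>}"
        using \<epsilon>(2) by (simp add: not_eventually not_less frequently_cofinite[symmetric] cofinite_eq_sequentially)
      then obtain q :: "nat \<Rightarrow> nat" where q: "strict_mono q" "\<And>n. dist ((1 - \<beta> (q n)) * bottom (\<beta> (q n))) w \<ge> \<epsilon>"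
        using infinite_enumerate by blast
      have "(\<beta> \<circ> q) \<longlonglongrightarrow> 1" by (rule LIMSEQ_subseq_LIMSEQ[OF \<beta>(3) q(1)])
      \<comment> \<open>A sequence that stays away from w still has a further subsequence with a
        limit system, whose constant must be w.\<close>
      then obtain r w2 s S k e where L:
        "limit_sS I \<alpha>0 s' S' \<alpha>1 x1 B W (\<beta> \<circ> q \<circ> r) w2 s S k e"
        using convergent_subsequence[of "\<beta> \<circ> q"] \<beta> by auto
      have "(\<lambda>n. (1 - (\<beta> \<circ> q \<circ> r) n) * bottom ((\<beta> \<circ> q \<circ> r) n)) \<longlonglongrightarrow> w"
        using limit_sS.bottom_disc_lim[OF L] unique[OF L] by simp
      then have "\<forall>\<^sub>F n in sequentially. dist ((1 - \<beta> (q (r n))) * bottom (\<beta> (q (r n)))) w < \<epsilon>"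
        using tendstoD[OF _ \<epsilon>(1)] by (simp add: comp_def)
      then show False using q(2) by (auto simp: eventually_sequentially not_less[symmetric])
    qed
  qed
  then have "((\<lambda>\<alpha>. ereal ((1 - \<alpha>) * bottom \<alpha>)) \<longlongrightarrow> ereal w) (at_left 1)" by simp
  moreover have "\<forall>\<^sub>F \<alpha> in at_left 1. ereal ((1 - \<alpha>) * bottom \<alpha>) = ereal (1 - \<alpha>) * enn2ereal (min_value I \<alpha>)"
  proof (rule eventually_at_leftI[OF _ \<alpha>1(2)])
    fix \<alpha> assume "\<alpha> \<in> {\<alpha>1<..<1}"
    then interpret d: discounted_sS I \<alpha> "s' \<alpha>" "S' \<alpha>" by (rule near_discounted)
    show "ereal ((1 - \<alpha>) * bottom \<alpha>) = ereal (1 - \<alpha>) * enn2ereal (min_value I \<alpha>)"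
      by (simp add: d.min_value_eq enn2ereal_ennreal d.bottom_nonneg)
  qed
  ultimately have "((\<lambda>\<alpha>. ereal (1 - \<alpha>) * enn2ereal (min_value I \<alpha>)) \<longlongrightarrow> ereal w) (at_left 1)"
    by (rule Lim_transform_eventually)
  then show ?thesis using unique by (rule that)
qed

end

context limit_sS
begin

text \<open>H and h differ by a constant and \<open>h S = 0\<close>, so the two sublevel conditions
  agree.\<close>

lemma Inf_order_fun_sublevel:
  "Inf {x \<in> X. x \<le> S \<and> order_fun I u x \<le> K + order_fun I u S} = Inf {x \<in> X. x \<le> S \<and> h x \<le> K}"
  using levels_state e_S by (intro arg_cong[where f = Inf]) (auto simp: order_fun_eq)

lemma limit_properties:
  shows "sS_policy s S \<in> stationary_policies I"
    and "(\<lambda>n. (s' (\<beta> n), S' (\<beta> n))) \<longlonglongrightarrow> (s, S)"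
    and "avg_optimal I (sS_policy s S)"
    and "\<exists>t. is_arg_min (order_fun I u) (\<lambda>x. x \<in> X) S \<and>
      t = Inf {x \<in> X. x \<le> S \<and> order_fun I u x \<le> K + order_fun I u S} \<and> t \<le> S \<and>
      avg_optimality_eq I w u (sS_policy t S) \<and> avg_optimal I (sS_policy t S)"
proof -
  show \<phi>: "sS_policy s S \<in> stationary_policies I"
    by (rule sS_policy_stationary[OF levels_state])
  show "(\<lambda>n. (s' (\<beta> n), S' (\<beta> n))) \<longlonglongrightarrow> (s, S)"
    by (rule tendsto_Pair[OF s_lim S_lim])
  show "avg_optimal I (sS_policy s S)"
    by (rule avg_optimalI[OF \<phi> limit_sS_policy])
  let ?t = "Inf {x \<in> X. x \<le> S \<and> h x \<le> K}"
  have "sS_policy ?t S \<in> stationary_policies I"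
    using second_sS_policy(1,2) levels_state(2) by (intro sS_policy_stationary)
  from avg_optimalI[OF this second_sS_policy(3)]
  have "avg_optimal I (sS_policy ?t S)" .
  moreover have "is_arg_min (order_fun I u) (\<lambda>x. x \<in> X) S"
    unfolding is_arg_min_linorder using levels_state e_S h_nonneg by (simp add: order_fun_eq)
  ultimately show "\<exists>t. is_arg_min (order_fun I u) (\<lambda>x. x \<in> X) S \<and>
      t = Inf {x \<in> X. x \<le> S \<and> order_fun I u x \<le> K + order_fun I u S} \<and> t \<le> S \<and>
      avg_optimality_eq I w u (sS_policy t S) \<and> avg_optimal I (sS_policy t S)"
    using second_sS_policy(2,3) unfolding Inf_order_fun_sublevel by blast
qed

end

theorem theorem5p1:
  fixes I :: "'w inventory" and \<alpha>0 :: real and s' S' :: "real \<Rightarrow> real"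
  assumes model: "inventory_model I"
    and \<alpha>0: "0 \<le> \<alpha>0" "\<alpha>0 < 1"
    and quasiconvex: "\<And>\<alpha>. \<alpha> \<in> {\<alpha>0<..1} \<Longrightarrow>
      quasiconvex_on (states I) (mean_after I (disc_holding I \<alpha>))"
    and left_limit: "\<And>\<alpha>. \<alpha> \<in> {\<alpha>0<..1} \<Longrightarrow>
      \<exists>L. ((\<lambda>x. ereal (mean_after I (disc_holding I \<alpha>) x)) \<longlongrightarrow> L)
            (inf at_bot (principal (states I))) \<and>
          L > ereal (setup_cost I)
                + (INF x\<in>states I. ereal (mean_after I (disc_holding I \<alpha>) x))"
    and levels: "\<And>\<alpha>. \<alpha> \<in> {\<alpha>0<..<1} \<Longrightarrow>
      s' \<alpha> \<in> states I \<and> S' \<alpha> \<in> states I \<and> s' \<alpha> \<le> S' \<alpha>"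
    and optimal: "\<And>\<alpha>. \<alpha> \<in> {\<alpha>0<..<1} \<Longrightarrow> disc_optimal I \<alpha> (sS_policy (s' \<alpha>) (S' \<alpha>))"
  shows "\<exists>w::real.
    ((\<lambda>\<alpha>. ereal (1 - \<alpha>) * enn2ereal (min_value I \<alpha>)) \<longlongrightarrow> ereal w) (at_left 1) \<and>
    (\<forall>\<alpha>::nat \<Rightarrow> real.
      (\<forall>n. 0 \<le> \<alpha> n \<and> \<alpha> n < 1) \<and> incseq \<alpha> \<and> \<alpha> \<longlonglongrightarrow> 1 \<and> \<alpha> 0 > \<alpha>0 \<longrightarrow>
      (\<exists>(r::nat \<Rightarrow> nat) (\<phi>::real \<Rightarrow> real) (u::real \<Rightarrow> real).
        strict_mono r \<and> \<phi> \<in> stationary_policies I \<and>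
        (\<forall>x\<in>states I.
          ereal (u x) = joint_liminf (states I) (\<lambda>k. rel_value I (\<alpha> (r k))) x) \<and>
        (\<forall>x\<in>states I. integrable (omega I) (\<lambda>\<omega>. u (x - demand I 1 \<omega>))) \<and>
        avg_optimality_eq I w u \<phi> \<and>
        continuous_on (states I) u \<and> inf_compact_on (states I) u \<and>
        continuous_on (states I) (order_fun I u) \<and> inf_compact_on (states I) (order_fun I u) \<and>
        (\<exists>s S. (\<lambda>k. (s' (\<alpha> (r k)), S' (\<alpha> (r k)))) \<longlonglongrightarrow> (s, S) \<and> s \<le> S \<and>
          avg_optimality_eq I w u (sS_policy s S) \<and> avg_optimal I (sS_policy s S)) \<and>
        (\<exists>s S. is_arg_min (order_fun I u) (\<lambda>x. x \<in> states I) S \<and>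
          s = Inf {x \<in> states I. x \<le> S \<and> order_fun I u x \<le> setup_cost I + order_fun I u S} \<and>
          s \<le> S \<and>
          avg_optimality_eq I w u (sS_policy s S) \<and> avg_optimal I (sS_policy s S))))"
proof -
  interpret inventory_sS I \<alpha>0 s' S'
    using model \<alpha>0 quasiconvex levels optimal
    by (simp add: inventory_sS_def inventory_sS_axioms_def)
  obtain \<alpha>1 B W x1 where near: "near_one I \<alpha>0 s' S' \<alpha>1 x1 B W"
  proof (rule uniform_levels)
    fix \<alpha>1 x1 B W
    assume "\<alpha>0 \<le> \<alpha>1" "\<alpha>1 < 1" "B \<ge> 0" "W \<ge> 0"
      "\<And>\<alpha>. \<alpha> \<in> {\<alpha>1<..<1} \<Longrightarrow> x1 < s' \<alpha>" "\<And>\<alpha>. \<alpha> \<in> {\<alpha>1<..<1} \<Longrightarrow> S' \<alpha> \<le> B"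
      "\<And>\<alpha>. \<alpha> \<in> {\<alpha>1<..<1} \<Longrightarrow> \<bar>(1 - \<alpha>) * level \<alpha> (S' \<alpha>)\<bar> \<le> W"
    then have "near_one I \<alpha>0 s' S' \<alpha>1 x1 B W"
      using inventory_sS_axioms by (simp add: near_one_def near_one_axioms_def)
    then show thesis by (rule that)
  qed
  interpret near_one I \<alpha>0 s' S' \<alpha>1 x1 B W by (rule near)
  obtain w where w: "((\<lambda>\<alpha>. ereal (1 - \<alpha>) * enn2ereal (min_value I \<alpha>)) \<longlongrightarrow> ereal w) (at_left 1)"
    "\<And>\<beta> w2 s S k e. limit_sS I \<alpha>0 s' S' \<alpha>1 x1 B W \<beta> w2 s S k e \<Longrightarrow> w2 = w"
    using min_value_limit by metis
  show ?thesis
  proof (intro exI[of _ w] conjI w(1) allI impI)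
    fix \<alpha> :: "nat \<Rightarrow> real"
    assume "(\<forall>n. 0 \<le> \<alpha> n \<and> \<alpha> n < 1) \<and> incseq \<alpha> \<and> \<alpha> \<longlonglongrightarrow> 1 \<and> \<alpha> 0 > \<alpha>0"
    then have \<alpha>: "\<And>n. \<alpha> n < 1" "\<alpha> \<longlonglongrightarrow> 1" by auto
    \<comment> \<open>The given sequence starts above \<open>\<alpha>0\<close>, but the uniform
      estimates hold only above \<open>\<alpha>1\<close>; its first N members are skipped, whence
      the shift by N in r.\<close>
    have "\<forall>\<^sub>F n in sequentially. \<alpha>1 < \<alpha> n" using \<alpha>(2) \<alpha>1(2) by (rule order_tendstoD)
    then obtain N where N: "\<And>n. n \<ge> N \<Longrightarrow> \<alpha>1 < \<alpha> n" by (auto simp: eventually_sequentially)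
    have shift: "(\<lambda>n. \<alpha> (n + N)) \<longlonglongrightarrow> 1" using \<alpha>(2) by (rule LIMSEQ_ignore_initial_segment)
    have shift_near: "\<alpha> (n + N) \<in> {\<alpha>1<..<1}" for n using N[of "n + N"] \<alpha>(1) by simp
    obtain q w2 s S k e where q: "strict_mono q"
      and L: "limit_sS I \<alpha>0 s' S' \<alpha>1 x1 B W ((\<lambda>n. \<alpha> (n + N)) \<circ> q) w2 s S k e"
      using convergent_subsequence[OF shift_near shift] by blast
    \<comment> \<open>The constant of this subsequence is replaced by the global limit, because w is
      chosen before the sequence.\<close>
    have w2: "w2 = w" by (rule w(2)[OF L])
    define r where "r n = q n + N" for n
    have r: "(\<lambda>n. \<alpha> (n + N)) \<circ> q = (\<lambda>n. \<alpha> (r n))" by (simp add: r_def fun_eq_iff)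
    interpret limit_sS I \<alpha>0 s' S' \<alpha>1 x1 B W "\<lambda>n. \<alpha> (r n)" w s S k e
      using L unfolding r w2 .
    show "\<exists>(r::nat \<Rightarrow> nat) (\<phi>::real \<Rightarrow> real) (u::real \<Rightarrow> real).
        strict_mono r \<and> \<phi> \<in> stationary_policies I \<and>
        (\<forall>x\<in>states I.
          ereal (u x) = joint_liminf (states I) (\<lambda>k. rel_value I (\<alpha> (r k))) x) \<and>
        (\<forall>x\<in>states I. integrable (omega I) (\<lambda>\<omega>. u (x - demand I 1 \<omega>))) \<and>
        avg_optimality_eq I w u \<phi> \<and>
        continuous_on (states I) u \<and> inf_compact_on (states I) u \<and>
        continuous_on (states I) (order_fun I u) \<and> inf_compact_on (states I) (order_fun I u) \<and>
        (\<exists>s S. (\<lambda>k. (s' (\<alpha> (r k)), S' (\<alpha> (r k)))) \<longlonglongrightarrow> (s, S) \<and> s \<le> S \<and>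
          avg_optimality_eq I w u (sS_policy s S) \<and> avg_optimal I (sS_policy s S)) \<and>
        (\<exists>s S. is_arg_min (order_fun I u) (\<lambda>x. x \<in> states I) S \<and>
          s = Inf {x \<in> states I. x \<le> S \<and> order_fun I u x \<le> setup_cost I + order_fun I u S} \<and>
          s \<le> S \<and>
          avg_optimality_eq I w u (sS_policy s S) \<and> avg_optimal I (sS_policy s S))"
    proof (rule exI[of _ r], rule exI[of _ "sS_policy s S"], rule exI[of _ u], intro conjI ballI)
      show "strict_mono r" using q by (simp add: r_def strict_mono_def)
      show "\<exists>s S. (\<lambda>k. (s' (\<alpha> (r k)), S' (\<alpha> (r k)))) \<longlonglongrightarrow> (s, S) \<and> s \<le> S \<and>
          avg_optimality_eq I w u (sS_policy s S) \<and> avg_optimal I (sS_policy s S)"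
        using limit_properties(2,3) levels_state(3) limit_sS_policy by blast
      show "\<exists>s S. is_arg_min (order_fun I u) (\<lambda>x. x \<in> states I) S \<and>
          s = Inf {x \<in> states I. x \<le> S \<and> order_fun I u x \<le> setup_cost I + order_fun I u S} \<and>
          s \<le> S \<and>
          avg_optimality_eq I w u (sS_policy s S) \<and> avg_optimal I (sS_policy s S)"
        using limit_properties(4) by blast
    qed (use limit_properties(1) joint_liminf_eq u_integrable limit_sS_policy continuous_u inf_compact_u
        continuous_order_fun inf_compact_order_fun in auto)
  qed
qed

end
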